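(* Let $Z$ be a real Gaussian random field on $\mathbb{R}^2$ with constant mean and isotropic autocovariance $\operatorname{cov}(Z(\mathbf{t}),Z(\mathbf{s}))=R(|\mathbf{t}-\mathbf{s}|)$, such that $R(|t|)=R(0)-|t|^\alpha+o(|t|^{\alpha+\gamma})$ as $|t|\to 0$ for some $0<\alpha<2$ and $\gamma>0$, $R$ is $C^4$ away from the origin, and there is $c_0>0$ with $|R^{(4)}(t)|\le c_0t^{\alpha-4}$ for all sufficiently small $t>0$. Let $\Omega\subset\mathbb{R}^2$ be a bounded simply connected domain, let $f$ be a $C^3$ diffeomorphism (in the sense of the context), and let $\mathbf{h},\mathbf{u}\in\mathbb{R}^2$ be nonzero. Let $K:\mathbb{R}^2\to\mathbb{R}$ be compactly supported with bounded, continuous first and second order (mixed) partial derivatives, $\int\!\!\int K(\mathbf{x})\,d\mathbf{x}=1$ and $\int\!\!\int|\mathbf{x}|K(\mathbf{x})\,d\mathbf{x}<\infty$. Let $(b_n)$ be positive numbers with $b_n\to 0$ and $n^{-1}b_n^{-4}=O(n^{-\beta})$ for some $\beta>0$ such that $\beta>1-4\gamma$. Then for every compact set $\Theta\subset\Omega$, with probability one, $$\sup_{\mathbf{t}\in\Theta}|\partial_{\mathbf{u}}B_{n,b_n}(\mathbf{t})-\partial_{\mathbf{u}}g(\mathbf{t})|\longrightarrow 0\quad\text{as } n\to\infty,\qquad\text{where } g(\mathbf{t})=(8-2^{\alpha+1})\,|J_f^{\mathbf{t}}\mathbf{h}|^\alpha .$$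
   Context: A $C^r$ diffeomorphism ($r\ge1$) means an injective map $f:\mathbb{R}^2\to\mathbb{R}^2$ having continuous (mixed) partial derivatives up to order $r$, whose inverse is $C^1$ on $f(\mathbb{R}^2)$, and with Jacobian determinant $\det J_f^{\mathbf{t}}>0$ for every $\mathbf{t}\in\mathbb{R}^2$; $J_f^{\mathbf{t}}$ is the Jacobian matrix of $f$ at $\mathbf{t}$. $\partial_{\mathbf{u}}=\mathbf{u}\cdot\nabla$ is the directional derivative in the variable $\mathbf{t}$. Put $Y=Z\circ f$, $\Delta_{\mathbf{h}}Y(\mathbf{t})=Y(\mathbf{t}+\mathbf{h})-Y(\mathbf{t})$, $\Delta^2_{\mathbf{h}}=\Delta_{\mathbf{h}}\Delta_{\mathbf{h}}$, $\Omega_n=\Omega\cap(\mathbb{Z}^2/n)$, and $$B_{n,b}(\mathbf{t})=\frac{1}{n^2b^2}\sum_{\mathbf{w}\in\Omega_n}K\Big(\frac{\mathbf{w}-\mathbf{t}}{b}\Big)\frac{(\Delta^2_{\mathbf{h}/n}Y(\mathbf{w}))^2}{n^{-\alpha}},\qquad \mathbf{t}\in\Omega.$$ *)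

theory Defs
  imports "HOL-Probability.Probability"
begin

subsection \<open>Partial derivatives and classes \<open>C\<^sup>r\<close>\<close>

definition partial_deriv ::
    "'a::euclidean_space \<Rightarrow> ('a \<Rightarrow> 'b::real_normed_vector) \<Rightarrow> 'a \<Rightarrow> 'b" where
  "partial_deriv e F x = vector_derivative (\<lambda>s. F (x + s *\<^sub>R e)) (at 0)"

text \<open>Two-sided partial derivatives are used, so this is meant for open sets \<open>S\<close>.
  All partial derivatives up to order \<open>r\<close> are required to exist, in any order of
  differentiation, and to be continuous.\<close>

fun Cr_on :: "nat \<Rightarrow> 'a::euclidean_space set \<Rightarrow> ('a \<Rightarrow> 'b::real_normed_vector) \<Rightarrow> bool" where
  "Cr_on 0 S F \<longleftrightarrow> continuous_on S F"
| "Cr_on (Suc r) S F \<longleftrightarrow> continuous_on S F \<and>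
     (\<forall>e\<in>Basis. (\<forall>x\<in>S. (\<lambda>s::real. F (x + s *\<^sub>R e)) differentiable (at 0)) \<and>
                Cr_on r S (partial_deriv e F))"

definition gradient :: "('a::euclidean_space \<Rightarrow> real) \<Rightarrow> 'a \<Rightarrow> 'a" where
  "gradient F x = (\<Sum>e\<in>Basis. partial_deriv e F x *\<^sub>R e)"

definition dir_deriv :: "'a::euclidean_space \<Rightarrow> ('a \<Rightarrow> real) \<Rightarrow> 'a \<Rightarrow> real" where
  "dir_deriv u F x = u \<bullet> gradient F x"

text \<open>The map need not be onto. Its range is open by invariance of domain, so \<open>Cr_on\<close>
  is meaningful there.\<close>

definition Cr_diffeo :: "nat \<Rightarrow> (real^2 \<Rightarrow> real^2) \<Rightarrow> bool" where
  "Cr_diffeo r f \<longleftrightarrow> 1 \<le> r \<and> inj f \<and> Cr_on r UNIV f \<and> Cr_on 1 (range f) (inv f) \<and>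
     (\<forall>t. det (jacobian f (at t)) > 0)"

subsection \<open>Gaussian random fields\<close>

text \<open>A Gaussian variable may be degenerate, that is almost surely constant.\<close>

definition gaussian_rv :: "'w measure \<Rightarrow> ('w \<Rightarrow> real) \<Rightarrow> bool" where
  "gaussian_rv M X \<longleftrightarrow> X \<in> borel_measurable M \<and>
     ((\<exists>m. AE \<omega> in M. X \<omega> = m) \<or>
      (\<exists>m \<sigma>. \<sigma> > 0 \<and> distributed M lborel X (\<lambda>x. ennreal (normal_density m \<sigma> x))))"

text \<open>All finite-dimensional distributions are (possibly degenerate) multivariate normal.\<close>

definition gaussian_field :: "'w measure \<Rightarrow> ('a \<Rightarrow> 'w \<Rightarrow> real) \<Rightarrow> bool" where
  "gaussian_field M Z \<longleftrightarrow>
     (\<forall>T a. finite T \<longrightarrow> gaussian_rv M (\<lambda>\<omega>. \<Sum>t\<in>T. a t * Z t \<omega>))"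

definition covar :: "'w measure \<Rightarrow> ('w \<Rightarrow> real) \<Rightarrow> ('w \<Rightarrow> real) \<Rightarrow> real" where
  "covar M X Y =
     (\<integral>\<omega>. (X \<omega> - (\<integral>\<xi>. X \<xi> \<partial>M)) * (Y \<omega> - (\<integral>\<xi>. Y \<xi> \<partial>M)) \<partial>M)"

subsection \<open>The estimator\<close>

definition incr :: "real^2 \<Rightarrow> (real^2 \<Rightarrow> real) \<Rightarrow> real^2 \<Rightarrow> real" where
  "incr h Y t = Y (t + h) - Y t"

definition grid :: "(real^2) set \<Rightarrow> nat \<Rightarrow> (real^2) set" where
  "grid \<Omega> n = \<Omega> \<inter> (\<lambda>z. z /\<^sub>R real n) ` {z. \<forall>i. z $ i \<in> \<int>}"

definition B_est ::
    "(real^2) set \<Rightarrow> (real^2 \<Rightarrow> real) \<Rightarrow> real \<Rightarrow> real^2 \<Rightarrow> nat \<Rightarrow> real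
      \<Rightarrow> (real^2 \<Rightarrow> real) \<Rightarrow> real^2 \<Rightarrow> real" where
  "B_est \<Omega> K \<alpha> h n b Y t =
     1 / ((real n)\<^sup>2 * b\<^sup>2) *
     (\<Sum>w\<in>grid \<Omega> n. K ((w - t) /\<^sub>R b) *
        ((incr (h /\<^sub>R real n) (incr (h /\<^sub>R real n) Y) w)\<^sup>2 / real n powr (- \<alpha>)))"

end

theory Submission
  imports Defs
begin

text \<open>
  Differentiating the kernel, \<open>\<partial>\<^sub>u B = - (n\<^sup>2 b\<^sup>3)\<^sup>-\<^sup>1 \<Sum>\<^sub>w \<kappa> ((w - t) / b) X\<^sub>w\<^sup>2\<close>, where
  \<open>\<kappa> = \<partial>\<^sub>u K\<close> and \<open>X\<^sub>w\<close> is \<open>n\<close> to the power \<open>\<alpha> / 2\<close> times the second difference of \<open>Y\<close> at \<open>w\<close>.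
  The variance of \<open>X\<^sub>w\<close> is \<open>g w + O(1/n + n\<^sup>-\<^sup>\<gamma>)\<close>, and since \<open>1/b = O(n\<^bsup>(1-\<beta>)/4\<^esup>)\<close> with
  \<open>(1 - \<beta>) / 4 < \<gamma>\<close>, the expectation of \<open>\<partial>\<^sub>u B\<close> is a Riemann sum of \<open>\<kappa>\<close> against \<open>g\<close> up to a
  vanishing error; its limit is \<open>\<partial>\<^sub>u g\<close> because \<open>\<integral> \<kappa> = 0\<close> and \<open>\<integral> \<kappa> x\<^sub>i = - u\<^sub>i\<close>.

  For the fluctuation, the covariance of \<open>X\<^sub>w\<close> and \<open>X\<^sub>v\<close> decays like \<open>(n |w - v|)\<^bsup>\<alpha>-3\<^esup>\<close>, which is
  square summable over the lattice. The fourth moment of a centred Gaussian quadratic form is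
  bounded by a constant times the square of its variance, so the fluctuation at a point has fourth moment
  \<open>O(n\<^sup>-\<^sup>4 b\<^sup>-\<^sup>8)\<close>. A union bound over a net of mesh slightly below \<open>b\<^sup>2\<close> costs a factor \<open>b\<^sup>-\<^sup>4\<close> up to
  a small power of \<open>n\<close>, and \<open>n\<^sup>-\<^sup>4 b\<^sup>-\<^sup>1\<^sup>2 = n\<^sup>-\<^sup>1 (n\<^sup>-\<^sup>1 b\<^sup>-\<^sup>4)\<^sup>3\<close> is summable, so Borel-Cantelli applies.
  Between net points the fluctuation is Lipschitz, because all \<open>X\<^sub>w\<^sup>2\<close> are at most a small power of \<open>n\<close>.
\<close>

subsection \<open>Moments of jointly Gaussian variables\<close>

text \<open>Why fourth moments: at one point the fluctuation has variance of order
  \<open>n^-2 b^-4\<close>, and with about \<open>b^-4\<close> net points a second moment bound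
  would leave \<open>n^-2 b^-8\<close>, which the bandwidth condition only makes
  \<open>O(n^(-2 \<beta>))\<close>. For small \<beta> this need not be summable; the fourth moment
  brings the additional factor \<open>n^-1\<close>.

  Joint normality is given only through linear combinations, so moments of products have to come
  from one-dimensional moments. They are extracted by differentiating in an auxiliary real
  parameter, which produces Wick's recursion.

  Since \<open>f\<close> is not linear, \<open>Z o f\<close> is not stationary, and covariances of
  its increments depend on both points. A lower Lipschitz bound for \<open>f\<close> on compact sets
  converts distances of images into distances of grid points. The covariance is singular at distance
  0, so Taylor estimates serve only pairs further apart than a fixed multiple of \<open>1/n\<close>;
  for closer pairs the variances give the bound.\<close>

definition all_moments :: "'w measure \<Rightarrow> ('w \<Rightarrow> real) \<Rightarrow> bool" where
  "all_moments M F \<longleftrightarrow> F \<in> borel_measurable M \<and> (\<forall>k. integrable M (\<lambda>\<omega>. \<bar>F \<omega>\<bar> ^ k))"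

text \<open>By \<open>2 x y \<le> x^2 + y^2\<close> the moment of order \<open>k\<close> of a
  product is controlled by moments of order \<open>2k\<close>. Requiring all orders at once is what
  makes the class closed under products.\<close>

lemma all_moments_mult:
  assumes "all_moments M F" "all_moments M G"
  shows "all_moments M (\<lambda>\<omega>. F \<omega> * G \<omega>)"
proof -
  have [measurable]: "F \<in> borel_measurable M" "G \<in> borel_measurable M"
    using assms by (auto simp: all_moments_def)
  have "integrable M (\<lambda>\<omega>. \<bar>F \<omega> * G \<omega>\<bar> ^ k)" for k
  proof (rule Bochner_Integration.integrable_bound)
    show "integrable M (\<lambda>\<omega>. \<bar>F \<omega>\<bar> ^ (2*k) + \<bar>G \<omega>\<bar> ^ (2*k))"
      using assms by (auto simp: all_moments_def)
    have "\<bar>F \<omega> * G \<omega>\<bar> ^ k \<le> \<bar>F \<omega>\<bar> ^ (2*k) + \<bar>G \<omega>\<bar> ^ (2*k)" for \<omega>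
    proof -
      have "2 * \<bar>F \<omega>\<bar>^k * \<bar>G \<omega>\<bar>^k \<le> (\<bar>F \<omega>\<bar>^k)\<^sup>2 + (\<bar>G \<omega>\<bar>^k)\<^sup>2"
        by (rule sum_squares_bound)
      moreover have "0 \<le> \<bar>F \<omega>\<bar>^k * \<bar>G \<omega>\<bar>^k" by simp
      ultimately show ?thesis
        unfolding abs_mult power_mult_distrib power_even_eq by linarith
    qed
    then show "AE \<omega> in M. norm (\<bar>F \<omega> * G \<omega>\<bar> ^ k) \<le> norm (\<bar>F \<omega>\<bar> ^ (2*k) + \<bar>G \<omega>\<bar> ^ (2*k))"
      by (intro AE_I2) (smt (verit) real_norm_def zero_le_power abs_ge_zero)
  qed measurable
  then show ?thesis by (auto simp: all_moments_def)
qed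

lemma all_moments_add:
  assumes "all_moments M F" "all_moments M G"
  shows "all_moments M (\<lambda>\<omega>. F \<omega> + G \<omega>)"
proof -
  have [measurable]: "F \<in> borel_measurable M" "G \<in> borel_measurable M"
    using assms by (auto simp: all_moments_def)
  have "integrable M (\<lambda>\<omega>. \<bar>F \<omega> + G \<omega>\<bar> ^ k)" for k
  proof (rule Bochner_Integration.integrable_bound)
    show "integrable M (\<lambda>\<omega>. 2^k * (\<bar>F \<omega>\<bar> ^ k + \<bar>G \<omega>\<bar> ^ k))"
      using assms by (auto simp: all_moments_def)
    have "\<bar>F \<omega> + G \<omega>\<bar> ^ k \<le> 2^k * (\<bar>F \<omega>\<bar> ^ k + \<bar>G \<omega>\<bar> ^ k)" for \<omega>
    proof -
      have "\<bar>F \<omega> + G \<omega>\<bar> ^ k \<le> (2 * max \<bar>F \<omega>\<bar> \<bar>G \<omega>\<bar>) ^ k"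
        by (intro power_mono) auto
      also have "\<dots> = 2^k * (max \<bar>F \<omega>\<bar> \<bar>G \<omega>\<bar>) ^ k" by (simp add: power_mult_distrib)
      also have "\<dots> \<le> 2^k * (\<bar>F \<omega>\<bar> ^ k + \<bar>G \<omega>\<bar> ^ k)"
        by (intro mult_left_mono) (auto simp: max_def)
      finally show ?thesis .
    qed
    then show "AE \<omega> in M. norm (\<bar>F \<omega> + G \<omega>\<bar> ^ k) \<le> norm (2^k * (\<bar>F \<omega>\<bar> ^ k + \<bar>G \<omega>\<bar> ^ k))"
      by (intro AE_I2) (smt (verit) real_norm_def zero_le_power abs_ge_zero)
  qed measurable
  then show ?thesis by (auto simp: all_moments_def)
qed

lemma (in finite_measure) all_moments_const: "all_moments M (\<lambda>\<omega>. c)"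
  by (auto simp: all_moments_def)

lemma all_moments_integrable:
  assumes "all_moments M F" shows "integrable M F"
proof -
  have "integrable M (\<lambda>\<omega>. \<bar>F \<omega>\<bar> ^ 1)" and m: "F \<in> borel_measurable M"
    using assms unfolding all_moments_def by blast+
  then have "integrable M (\<lambda>\<omega>. \<bar>F \<omega>\<bar>)" by simp
  then show ?thesis by (rule integrable_abs_cancel[OF _ m])
qed

text \<open>The moments of the standard normal law: \<open>(m - 1)!!\<close> for even
  \<open>m\<close>, written with factorials.\<close>

definition normal_moment :: "nat \<Rightarrow> real" where
  "normal_moment m = (if even m then fact m / (2 ^ (m div 2) * fact (m div 2)) else 0)"

lemma normal_moment_Suc_Suc: "normal_moment (Suc (Suc m)) = real (Suc m) * normal_moment m"
proof (cases "even m")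
  case True
  then obtain k where k: "m = 2 * k" by auto
  show ?thesis unfolding k normal_moment_def
    by (simp add: field_simps del: of_nat_Suc) (simp add: algebra_simps)
qed (simp add: normal_moment_def)

lemma normal_moment_nonneg: "0 \<le> normal_moment m"
  by (simp add: normal_moment_def)

text \<open>Entries are removed by position, so a repeated element is listed once per occurrence.
  This is the multiplicity that Wick's formula counts.\<close>

fun removals :: "'a list \<Rightarrow> ('a \<times> 'a list) list" where
  "removals [] = []"
| "removals (x # xs) = (x, xs) # map (\<lambda>(y, r). (y, x # r)) (removals xs)"

lemma removals_subset: "(y, r) \<in> set (removals xs) \<Longrightarrow> y \<in> set xs \<and> set r \<subseteq> set xs"
  by (induction xs arbitrary: r) fastforce+

text \<open>A linear space of centred, possibly degenerate, Gaussian variables, described through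
  the moments of single members only. Closure under linear combinations turns this into information
  on joint moments. The case \<open>m = 1\<close> of \<open>moment_eq\<close> says that the means
  vanish.\<close>

locale gaussian_space = prob_space M for M :: "'w measure" +
  fixes V :: "('w \<Rightarrow> real) set"
  assumes add_closed: "X \<in> V \<Longrightarrow> Y \<in> V \<Longrightarrow> (\<lambda>\<omega>. X \<omega> + Y \<omega>) \<in> V"
    and scale_closed: "X \<in> V \<Longrightarrow> (\<lambda>\<omega>. c * X \<omega>) \<in> V"
    and moments: "X \<in> V \<Longrightarrow> all_moments M X"
    and moment_eq: "X \<in> V \<Longrightarrow> (\<integral>\<omega>. X \<omega> ^ m \<partial>M) = normal_moment m * (\<integral>\<omega>. (X \<omega>)\<^sup>2 \<partial>M) ^ (m div 2)"
begin

section \<open>Mixed moments and Wick's formula\<close>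

definition ev :: "('w \<Rightarrow> real) list \<Rightarrow> real" where
  "ev xs = (\<integral>\<omega>. (\<Prod>x\<leftarrow>xs. x \<omega>) \<partial>M)"

definition cv :: "('w \<Rightarrow> real) \<Rightarrow> ('w \<Rightarrow> real) \<Rightarrow> real" where
  "cv X Y = (\<integral>\<omega>. X \<omega> * Y \<omega> \<partial>M)"

lemma all_moments_power:
  assumes "all_moments M F"
  shows "all_moments M (\<lambda>\<omega>. F \<omega> ^ k)"
  by (induction k) (use assms in \<open>auto intro: all_moments_const all_moments_mult\<close>)

lemma all_moments_prod_list:
  assumes "set xs \<subseteq> V"
  shows "all_moments M (\<lambda>\<omega>. \<Prod>x\<leftarrow>xs. x \<omega>)"
  using assms by (induction xs) (auto intro: all_moments_const all_moments_mult moments)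

lemma all_moments_sum:
  assumes "\<And>i. i \<in> I \<Longrightarrow> all_moments M (F i)"
  shows "all_moments M (\<lambda>\<omega>. \<Sum>i\<in>I. F i \<omega>)"
  using assms
  by (induction I rule: infinite_finite_induct) (auto intro: all_moments_const all_moments_add)

lemmas all_moments_intros = all_moments_const all_moments_mult all_moments_add all_moments_power
  all_moments_sum

text \<open>The integral is a polynomial in \<open>t\<close>, so no differentiation under the
  integral is involved: the induction splits off one factor \<open>Y + t W\<close> and moves
  \<open>Y\<close> or \<open>W\<close> into the weight \<open>G\<close>.\<close>

lemma deriv_moment_0:
  assumes "all_moments M G" "all_moments M Y" "all_moments M W"
  shows "((\<lambda>t. \<integral>\<omega>. G \<omega> * (Y \<omega> + t * W \<omega>) ^ m \<partial>M) has_real_derivative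
          real m * (\<integral>\<omega>. G \<omega> * W \<omega> * Y \<omega> ^ (m - 1) \<partial>M)) (at 0)"
  using assms(1)
proof (induction m arbitrary: G)
  case 0
  then show ?case by simp
next
  case (Suc m)
  have i1: "integrable M (\<lambda>\<omega>. (G \<omega> * Y \<omega>) * (Y \<omega> + t * W \<omega>) ^ m)"
   and i2: "integrable M (\<lambda>\<omega>. (G \<omega> * W \<omega>) * (Y \<omega> + t * W \<omega>) ^ m)" for t
    using Suc.prems assms by (auto intro!: all_moments_integrable all_moments_intros)
  have eq: "(\<lambda>t. \<integral>\<omega>. G \<omega> * (Y \<omega> + t * W \<omega>) ^ Suc m \<partial>M) =
    (\<lambda>t. (\<integral>\<omega>. (G \<omega> * Y \<omega>) * (Y \<omega> + t * W \<omega>) ^ m \<partial>M) + t * (\<integral>\<omega>. (G \<omega> * W \<omega>) * (Y \<omega> + t * W \<omega>) ^ m \<partial>M))"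
  proof
    fix t
    have "(\<integral>\<omega>. G \<omega> * (Y \<omega> + t * W \<omega>) ^ Suc m \<partial>M) =
      (\<integral>\<omega>. (G \<omega> * Y \<omega>) * (Y \<omega> + t * W \<omega>) ^ m + t * ((G \<omega> * W \<omega>) * (Y \<omega> + t * W \<omega>) ^ m) \<partial>M)"
      by (simp add: algebra_simps)
    also have "\<dots> = (\<integral>\<omega>. (G \<omega> * Y \<omega>) * (Y \<omega> + t * W \<omega>) ^ m \<partial>M) + t * (\<integral>\<omega>. (G \<omega> * W \<omega>) * (Y \<omega> + t * W \<omega>) ^ m \<partial>M)"
      using i1 i2 by (subst Bochner_Integration.integral_add) auto
    finally show "(\<integral>\<omega>. G \<omega> * (Y \<omega> + t * W \<omega>) ^ Suc m \<partial>M) = \<dots>" .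
  qed
  have "all_moments M (\<lambda>\<omega>. G \<omega> * Y \<omega>)" "all_moments M (\<lambda>\<omega>. G \<omega> * W \<omega>)"
    using Suc.prems assms by (auto intro!: all_moments_intros)
  note d = Suc.IH[OF this(1)] Suc.IH[OF this(2)]
  have "((\<lambda>t. (\<integral>\<omega>. (G \<omega> * Y \<omega>) * (Y \<omega> + t * W \<omega>) ^ m \<partial>M) + t * (\<integral>\<omega>. (G \<omega> * W \<omega>) * (Y \<omega> + t * W \<omega>) ^ m \<partial>M))
    has_real_derivative real m * (\<integral>\<omega>. (G \<omega> * Y \<omega>) * W \<omega> * Y \<omega> ^ (m - 1) \<partial>M) +
      (1 * (\<integral>\<omega>. (G \<omega> * W \<omega>) * (Y \<omega> + 0 * W \<omega>) ^ m \<partial>M) + real m * (\<integral>\<omega>. (G \<omega> * W \<omega>) * W \<omega> * Y \<omega> ^ (m - 1) \<partial>M) * 0)) (at 0)"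
    by (intro DERIV_add DERIV_mult d DERIV_ident)
  moreover have "real m * (\<integral>\<omega>. (G \<omega> * Y \<omega>) * W \<omega> * Y \<omega> ^ (m - 1) \<partial>M) = real m * (\<integral>\<omega>. G \<omega> * W \<omega> * Y \<omega> ^ m \<partial>M)"
  proof (cases m)
    case (Suc k)
    have "(\<lambda>\<omega>. (G \<omega> * Y \<omega>) * W \<omega> * Y \<omega> ^ (m - 1)) = (\<lambda>\<omega>. G \<omega> * W \<omega> * Y \<omega> ^ m)"
      by (rule ext) (simp add: Suc algebra_simps)
    then show ?thesis by simp
  qed simp
  ultimately show ?case unfolding eq
    by (elim DERIV_cong) (simp add: algebra_simps)
qed

lemma cv_commute: "cv X Y = cv Y X"
  by (simp add: cv_def mult.commute)

lemma cv_add_scale: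
  assumes "X \<in> V" "Y \<in> V" "W \<in> V"
  shows "cv X (\<lambda>\<omega>. Y \<omega> + t * W \<omega>) = cv X Y + t * cv X W"
proof -
  have "integrable M (\<lambda>\<omega>. X \<omega> * Y \<omega>)" "integrable M (\<lambda>\<omega>. X \<omega> * W \<omega>)"
    using assms by (blast intro: all_moments_integrable all_moments_mult moments)+
  then have "(\<integral>\<omega>. X \<omega> * Y \<omega> + t * (X \<omega> * W \<omega>) \<partial>M) = cv X Y + t * cv X W"
    unfolding cv_def by (subst Bochner_Integration.integral_add) auto
  then show ?thesis by (simp add: cv_def algebra_simps)
qed

text \<open>Gaussian integration by parts, read off from the moment identity of order
  \<open>m + 1\<close> for \<open>Y + t X\<close> by comparing the derivatives of its two sides at
  \<open>t = 0\<close>.\<close>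

lemma stein_power:
  assumes X: "X \<in> V" and Y: "Y \<in> V"
  shows "(\<integral>\<omega>. X \<omega> * Y \<omega> ^ m \<partial>M) = real m * cv X Y * (\<integral>\<omega>. Y \<omega> ^ (m - 1) \<partial>M)"
proof -
  let ?s = "\<integral>\<omega>. (Y \<omega>)\<^sup>2 \<partial>M"
  have mem: "(\<lambda>\<omega>. Y \<omega> + t * X \<omega>) \<in> V" for t
    using add_closed[OF Y scale_closed[OF X]] .
  have d1: "((\<lambda>t. \<integral>\<omega>. (Y \<omega> + t * X \<omega>) ^ k \<partial>M) has_real_derivative
          real k * (\<integral>\<omega>. X \<omega> * Y \<omega> ^ (k - 1) \<partial>M)) (at 0)" for k
    using deriv_moment_0[OF all_moments_const[of 1] moments[OF Y] moments[OF X], of k] by simp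
  have d2: "((\<lambda>t. normal_moment (Suc m) * (\<integral>\<omega>. (Y \<omega> + t * X \<omega>)\<^sup>2 \<partial>M) ^ (Suc m div 2)) has_real_derivative
          normal_moment (Suc m) * (real (Suc m div 2) * (2 * cv X Y) * ?s ^ (Suc m div 2 - 1))) (at 0)"
    by (rule derivative_eq_intros d1 refl)+ (simp add: cv_def)
  have "((\<lambda>t. normal_moment (Suc m) * (\<integral>\<omega>. (Y \<omega> + t * X \<omega>)\<^sup>2 \<partial>M) ^ (Suc m div 2)) has_real_derivative
          real (Suc m) * (\<integral>\<omega>. X \<omega> * Y \<omega> ^ (Suc m - 1) \<partial>M)) (at 0)"
    using d1[of "Suc m"] moment_eq[OF mem, of _ "Suc m"] by simp
  from DERIV_unique[OF this d2]
  have *: "real (Suc m) * (\<integral>\<omega>. X \<omega> * Y \<omega> ^ m \<partial>M) =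
     normal_moment (Suc m) * (real (Suc m div 2) * (2 * cv X Y) * ?s ^ (Suc m div 2 - 1))" by simp
  show ?thesis
  \<comment> \<open>For even \<open>m\<close> the factor \<open>normal_moment (m + 1)\<close> is
    zero, and so is the odd moment on the right. At \<open>m = 0\<close>, where \<open>m - 1\<close>
    truncates to 0, the factor \<open>real m\<close> makes the right side vanish.\<close>
  proof (cases "even m")
    case True
    then have "normal_moment (Suc m) = 0" "m = 0 \<or> normal_moment (m - 1) = 0"
      by (auto simp: normal_moment_def)
    then show ?thesis using * moment_eq[OF Y, of "m - 1"] by auto
  next
    case False
    then obtain k where k: "m = Suc (2 * k)" by (auto elim: oddE)
    have "normal_moment (Suc m) = real m * normal_moment (2 * k)"
      unfolding k by (rule normal_moment_Suc_Suc)
    moreover have "(\<integral>\<omega>. Y \<omega> ^ (2 * k) \<partial>M) = normal_moment (2 * k) * ?s ^ k"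
      using moment_eq[OF Y, of "2 * k"] by simp
    ultimately have "real (Suc m) * (\<integral>\<omega>. X \<omega> * Y \<omega> ^ m \<partial>M) = real (Suc m) * (real m * cv X Y * (\<integral>\<omega>. Y \<omega> ^ (2 * k) \<partial>M))"
      using * by (simp add: k algebra_simps)
    then have "(\<integral>\<omega>. X \<omega> * Y \<omega> ^ m \<partial>M) = real m * cv X Y * (\<integral>\<omega>. Y \<omega> ^ (2 * k) \<partial>M)"
      by (simp del: of_nat_Suc)
    then show ?thesis by (simp add: k)
  qed
qed

lemma sum_list_DERIV:
  assumes "\<And>i. i \<in> set is \<Longrightarrow> ((f i) has_real_derivative (f' i)) (at x)"
  shows "((\<lambda>t. \<Sum>i\<leftarrow>is. f i t) has_real_derivative (\<Sum>i\<leftarrow>is. f' i)) (at x)"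
  using assms by (induction "is") (auto intro!: derivative_eq_intros)

text \<open>Polarization: the case \<open>y # ys\<close> is the derivative at \<open>t = 0\<close> of the case \<open>ys\<close>
  applied to \<open>Y + t y\<close> with exponent \<open>m + 1\<close>.\<close>
lemma stein_list_power:
  assumes "X \<in> V" "Y \<in> V" "set ys \<subseteq> V"
  shows "(\<integral>\<omega>. X \<omega> * (\<Prod>y\<leftarrow>ys. y \<omega>) * Y \<omega> ^ m \<partial>M) =
     real m * cv X Y * (\<integral>\<omega>. (\<Prod>y\<leftarrow>ys. y \<omega>) * Y \<omega> ^ (m - 1) \<partial>M) +
     (\<Sum>p\<leftarrow>removals ys. cv X (fst p) * (\<integral>\<omega>. (\<Prod>y\<leftarrow>snd p. y \<omega>) * Y \<omega> ^ m \<partial>M))"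
  using assms
proof (induction ys arbitrary: Y m)
  case Nil
  then show ?case using stein_power[of X Y m] by simp
next
  case (Cons y ys)
  then have V: "X \<in> V" "Y \<in> V" "y \<in> V" "set ys \<subseteq> V" by auto
  let ?Q = "\<lambda>ys \<omega>. (\<Prod>y\<leftarrow>ys. y \<omega>) :: real"
  have mem: "(\<lambda>\<omega>. Y \<omega> + t * y \<omega>) \<in> V" for t
    using add_closed[OF V(2) scale_closed[OF V(3)]] .
  have am: "all_moments M (?Q r)" if "set r \<subseteq> set ys" for r
    using that V by (intro all_moments_prod_list) auto
  have d0: "((\<lambda>t. \<integral>\<omega>. X \<omega> * ?Q ys \<omega> * (Y \<omega> + t * y \<omega>) ^ Suc m \<partial>M) has_real_derivative
      real (Suc m) * (\<integral>\<omega>. X \<omega> * ?Q ys \<omega> * y \<omega> * Y \<omega> ^ (Suc m - 1) \<partial>M)) (at 0)"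
    using V by (intro deriv_moment_0 all_moments_intros am moments) auto
  have d1: "((\<lambda>t. \<integral>\<omega>. ?Q r \<omega> * (Y \<omega> + t * y \<omega>) ^ k \<partial>M) has_real_derivative
      real k * (\<integral>\<omega>. ?Q r \<omega> * y \<omega> * Y \<omega> ^ (k - 1) \<partial>M)) (at 0)" if "set r \<subseteq> set ys" for r k
    using V that by (intro deriv_moment_0 all_moments_intros am moments) auto
  have eq: "(\<integral>\<omega>. X \<omega> * ?Q ys \<omega> * (Y \<omega> + t * y \<omega>) ^ Suc m \<partial>M) =
     real (Suc m) * (cv X Y + t * cv X y) * (\<integral>\<omega>. ?Q ys \<omega> * (Y \<omega> + t * y \<omega>) ^ m \<partial>M) +
     (\<Sum>p\<leftarrow>removals ys. cv X (fst p) * (\<integral>\<omega>. ?Q (snd p) \<omega> * (Y \<omega> + t * y \<omega>) ^ Suc m \<partial>M))" for t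
    using Cons.IH[OF V(1) mem V(4), of t "Suc m"] cv_add_scale[OF V(1-3), of t] by simp
  have d2: "((\<lambda>t. \<Sum>p\<leftarrow>removals ys. cv X (fst p) * (\<integral>\<omega>. ?Q (snd p) \<omega> * (Y \<omega> + t * y \<omega>) ^ Suc m \<partial>M))
     has_real_derivative
     (\<Sum>p\<leftarrow>removals ys. cv X (fst p) * (real (Suc m) * (\<integral>\<omega>. ?Q (snd p) \<omega> * y \<omega> * Y \<omega> ^ (Suc m - 1) \<partial>M)))) (at 0)"
    by (intro sum_list_DERIV DERIV_cmult d1) (metis prod.collapse removals_subset)
  have d3: "((\<lambda>t. real (Suc m) * (cv X Y + t * cv X y) * (\<integral>\<omega>. ?Q ys \<omega> * (Y \<omega> + t * y \<omega>) ^ m \<partial>M))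
     has_real_derivative
     real (Suc m) * cv X y * (\<integral>\<omega>. ?Q ys \<omega> * Y \<omega> ^ m \<partial>M)
     + real (Suc m) * cv X Y * (real m * (\<integral>\<omega>. ?Q ys \<omega> * y \<omega> * Y \<omega> ^ (m - 1) \<partial>M))) (at 0)"
    by (rule derivative_eq_intros d1 order_refl refl)+ (simp add: algebra_simps)
  have e2: "(\<Sum>p\<leftarrow>removals ys. cv X (fst p) * (real (Suc m) * (\<integral>\<omega>. ?Q (snd p) \<omega> * y \<omega> * Y \<omega> ^ (Suc m - 1) \<partial>M)))
     = real (Suc m) * (\<Sum>p\<leftarrow>removals ys. cv X (fst p) * (\<integral>\<omega>. ?Q (snd p) \<omega> * y \<omega> * Y \<omega> ^ m \<partial>M))"
    by (simp add: sum_list_const_mult[symmetric] algebra_simps del: of_nat_Suc)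
  have "real (Suc m) * (\<integral>\<omega>. X \<omega> * ?Q ys \<omega> * y \<omega> * Y \<omega> ^ m \<partial>M) =
     real (Suc m) * (cv X y * (\<integral>\<omega>. ?Q ys \<omega> * Y \<omega> ^ m \<partial>M)
      + cv X Y * (real m * (\<integral>\<omega>. ?Q ys \<omega> * y \<omega> * Y \<omega> ^ (m - 1) \<partial>M))
      + (\<Sum>p\<leftarrow>removals ys. cv X (fst p) * (\<integral>\<omega>. ?Q (snd p) \<omega> * y \<omega> * Y \<omega> ^ m \<partial>M)))"
    using DERIV_unique[OF d0[unfolded eq] DERIV_add[OF d3 d2, unfolded e2]]
    by (simp add: algebra_simps del: of_nat_Suc)
  then have "(\<integral>\<omega>. X \<omega> * ?Q ys \<omega> * y \<omega> * Y \<omega> ^ m \<partial>M) =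
     (cv X y * (\<integral>\<omega>. ?Q ys \<omega> * Y \<omega> ^ m \<partial>M)
      + cv X Y * (real m * (\<integral>\<omega>. ?Q ys \<omega> * y \<omega> * Y \<omega> ^ (m - 1) \<partial>M))
      + (\<Sum>p\<leftarrow>removals ys. cv X (fst p) * (\<integral>\<omega>. ?Q (snd p) \<omega> * y \<omega> * Y \<omega> ^ m \<partial>M)))"
    by (simp del: of_nat_Suc)
  then show ?case
    by (simp add: split_beta o_def algebra_simps)
qed

text \<open>The head is paired with every other entry in turn. With exponent 0 the auxiliary
  variable of \<open>stein_list_power\<close> disappears, so \<open>X\<close> can be put in its
  place.\<close>

lemma wick:
  assumes "X \<in> V" "set ys \<subseteq> V"
  shows "ev (X # ys) = (\<Sum>p\<leftarrow>removals ys. cv X (fst p) * ev (snd p))"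
  using stein_list_power[OF assms(1,1,2), of 0] by (simp add: ev_def)

section \<open>Fourth moments of centred quadratic forms\<close>

lemma ev_Nil: "ev [] = 1"
  by (simp add: ev_def prob_space)

text \<open>Subtracting the variance cancels, in Wick's expansion, every pairing of the two factors
  of one square with each other.\<close>

definition csq :: "('w \<Rightarrow> real) \<Rightarrow> 'w \<Rightarrow> real" where
  "csq X \<omega> = (X \<omega>)\<^sup>2 - cv X X"

lemma ev_linear:
  assumes "\<forall>p\<in>set L. set (snd p) \<subseteq> V"
  shows "(\<integral>\<omega>. (\<Sum>p\<leftarrow>L. fst p * (\<Prod>x\<leftarrow>snd p. x \<omega>)) \<partial>M) = (\<Sum>p\<leftarrow>L. fst p * ev (snd p))"
proof -
  have "(\<integral>\<omega>. (\<Sum>p\<leftarrow>L. fst p * (\<Prod>x\<leftarrow>snd p. x \<omega>)) \<partial>M) = (\<Sum>p\<leftarrow>L. fst p * ev (snd p))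
      \<and> integrable M (\<lambda>\<omega>. \<Sum>p\<leftarrow>L. fst p * (\<Prod>x\<leftarrow>snd p. x \<omega>))"
    using assms
  proof (induction L)
    case (Cons p L)
    then have "integrable M (\<lambda>\<omega>. fst p * (\<Prod>x\<leftarrow>snd p. x \<omega>))"
      by (auto intro!: all_moments_integrable all_moments_intros all_moments_prod_list)
    then show ?case using Cons by (simp add: ev_def)
  qed simp
  then show ?thesis ..
qed


text \<open>The left side is the expectation of \<open>X Y csq C csq D\<close> multiplied out. What
  remains are the 10 pairings of \<open>X, Y, C, C, D, D\<close> that join neither the two
  \<open>C\<close> nor the two \<open>D\<close>.\<close>

lemma ev_csq2:
  assumes V: "X \<in> V" "Y \<in> V" "C \<in> V" "D \<in> V"
  shows "ev [X,Y,C,C,D,D] - cv C C * ev [X,Y,D,D] - cv D D * ev [X,Y,C,C] + cv C C * cv D D * ev [X,Y]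
    = 2 * cv X Y * (cv C D)\<^sup>2 + 4 * cv X C * cv Y D * cv C D + 4 * cv X D * cv Y C * cv C D"
  using V by (simp add: wick ev_Nil power2_eq_square algebra_simps)

text \<open>The pairings of four doubled points without a pair inside a doublet: three ways to form
  two 2-cycles, each with weight 4, and three 4-cycles, each with weight 16, hence 60 in
  all.\<close>

lemma ev_csq4:
  assumes V: "A \<in> V" "B \<in> V" "C \<in> V" "D \<in> V"
  shows "(\<integral>\<omega>. csq A \<omega> * csq B \<omega> * csq C \<omega> * csq D \<omega> \<partial>M) =
    4 * ((cv A B)\<^sup>2 * (cv C D)\<^sup>2 + (cv A C)\<^sup>2 * (cv B D)\<^sup>2 + (cv A D)\<^sup>2 * (cv B C)\<^sup>2)
    + 16 * (cv A B * cv B C * cv C D * cv A D + cv A B * cv B D * cv C D * cv A C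
      + cv A C * cv B C * cv B D * cv A D)"
proof -
  let ?a = "cv A A" and ?b = "cv B B" and ?c = "cv C C" and ?d = "cv D D"
  \<comment> \<open>The 16 terms of the product of four differences, as coefficients with lists to
    which \<open>wick\<close> applies.\<close>
  let ?L = "[(1, [A,A,B,B,C,C,D,D]),
    (-?a, [B,B,C,C,D,D]), (-?b, [A,A,C,C,D,D]), (-?c, [A,A,B,B,D,D]), (-?d, [A,A,B,B,C,C]),
    (?a*?b, [C,C,D,D]), (?a*?c, [B,B,D,D]), (?a*?d, [B,B,C,C]), (?b*?c, [A,A,D,D]),
    (?b*?d, [A,A,C,C]), (?c*?d, [A,A,B,B]),
    (-?a*?b*?c, [D,D]), (-?a*?b*?d, [C,C]), (-?a*?c*?d, [B,B]), (-?b*?c*?d, [A,A]),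
    (?a*?b*?c*?d, [])]"
  \<comment> \<open>Products commute; the entries are reordered to the shape expected by
    \<open>ev_csq2\<close>.\<close>
  have e: "ev [A,B,B,C,D,D] = ev [A,C,B,B,D,D]" "ev [A,B,B,C] = ev [A,C,B,B]"
     "ev [A,B,B,C,C,D] = ev [A,D,B,B,C,C]" "ev [A,B,B,D] = ev [A,D,B,B]" "ev [A,C,C,D] = ev [A,D,C,C]"
    by (simp_all add: ev_def mult_ac)
  have "(\<lambda>\<omega>. csq A \<omega> * csq B \<omega> * csq C \<omega> * csq D \<omega>) = (\<lambda>\<omega>. \<Sum>p\<leftarrow>?L. fst p * (\<Prod>x\<leftarrow>snd p. x \<omega>))"
    by (rule ext) (simp add: csq_def power2_eq_square algebra_simps)
  then have "(\<integral>\<omega>. csq A \<omega> * csq B \<omega> * csq C \<omega> * csq D \<omega> \<partial>M) = (\<Sum>p\<leftarrow>?L. fst p * ev (snd p))"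
    using ev_linear[of ?L] V by simp
  \<comment> \<open>Wick's recursion is applied only to the first \<open>A\<close>. Its pairing with
    the other \<open>A\<close> cancels, each other partner occurs twice, and every bracket is an
    instance of \<open>ev_csq2\<close>.\<close>
  also have "\<dots> = 2 * cv A B * (ev [A,B,C,C,D,D] - ?c * ev [A,B,D,D] - ?d * ev [A,B,C,C] + ?c * ?d * ev [A,B])
     + 2 * cv A C * (ev [A,B,B,C,D,D] - ?b * ev [A,C,D,D] - ?d * ev [A,B,B,C] + ?b * ?d * ev [A,C])
     + 2 * cv A D * (ev [A,B,B,C,C,D] - ?b * ev [A,C,C,D] - ?c * ev [A,B,B,D] + ?b * ?c * ev [A,D])"
    using wick[of A "[A,B,B,C,C,D,D]"] wick[of A "[A,B,B,C,C]"] wick[of A "[A,B,B,D,D]"]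
      wick[of A "[A,C,C,D,D]"] wick[of A "[A,B,B]"] wick[of A "[A,C,C]"] wick[of A "[A,D,D]"]
      wick[of A "[A]"] V
    by (simp add: ev_Nil) (simp add: algebra_simps)
  finally show ?thesis
    unfolding e ev_csq2[OF V(1) V(2) V(3) V(4)] ev_csq2[OF V(1) V(3) V(2) V(4)]
      ev_csq2[OF V(1) V(4) V(2) V(3)] cv_commute[of C B] cv_commute[of D B] cv_commute[of D C]
    by (simp add: power2_eq_square algebra_simps)
qed

lemma cv_self_nonneg:
  assumes "X \<in> V"
  shows "0 \<le> cv X X"
  by (simp add: cv_def)

lemma csq_moments: assumes "Y \<in> V" shows "all_moments M (csq Y)"
proof -
  have "all_moments M (\<lambda>\<omega>. Y \<omega> * Y \<omega> + - cv Y Y)"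
    by (intro all_moments_intros moments assms)
  then show ?thesis by (simp add: csq_def[abs_def] power2_eq_square)
qed

text \<open>The 4-cycles are split by the arithmetic-geometric inequality into products of two
  squared covariances. After this all 60 pairings are bounded by the square of one double
  sum.\<close>

lemma fourth_moment_quadratic_form:
  assumes I: "finite I" and V: "\<And>i. i \<in> I \<Longrightarrow> X i \<in> V" and c: "\<And>i. i \<in> I \<Longrightarrow> \<bar>c i\<bar> \<le> B"
  shows "(\<integral>\<omega>. (\<Sum>i\<in>I. c i * csq (X i) \<omega>) ^ 4 \<partial>M) \<le> 60 * B ^ 4 * (\<Sum>i\<in>I. \<Sum>j\<in>I. (cv (X i) (X j))\<^sup>2)\<^sup>2"
proof -
  let ?s = "\<lambda>i j. cv (X i) (X j)"
  let ?T = "\<Sum>i\<in>I. \<Sum>j\<in>I. (?s i j)\<^sup>2"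
  let ?S4 = "\<lambda>F. \<Sum>i\<in>I. \<Sum>j\<in>I. \<Sum>k\<in>I. \<Sum>l\<in>I. (F i j k l :: real)"
  have am: "all_moments M (csq (X i))" if "i \<in> I" for i
    by (intro csq_moments V that)
  define G where "G i j k l \<omega> = csq (X i) \<omega> * csq (X j) \<omega> * csq (X k) \<omega> * csq (X l) \<omega>" for i j k l \<omega>
  have intG: "integrable M (G i j k l)" if "i \<in> I" "j \<in> I" "k \<in> I" "l \<in> I" for i j k l
    unfolding G_def[abs_def] by (intro all_moments_integrable all_moments_intros am that)
  have "(\<Sum>i\<in>I. c i * csq (X i) \<omega>) ^ 4 = ?S4 (\<lambda>i j k l. (c i * c j * c k * c l) * G i j k l \<omega>)" for \<omega>
    by (simp add: power4_eq_xxxx sum_product sum_distrib_left sum_distrib_right G_def mult_ac)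
  then have "(\<integral>\<omega>. (\<Sum>i\<in>I. c i * csq (X i) \<omega>) ^ 4 \<partial>M)
     = (\<integral>\<omega>. ?S4 (\<lambda>i j k l. (c i * c j * c k * c l) * G i j k l \<omega>) \<partial>M)" by simp
  also have "\<dots> = ?S4 (\<lambda>i j k l. (c i * c j * c k * c l) * (\<integral>\<omega>. G i j k l \<omega> \<partial>M))"
    by (subst Bochner_Integration.integral_sum; (intro Bochner_Integration.integrable_sum integrable_mult_right intG)?; simp?; intro sum.cong refl)+
  also have "\<dots> \<le> ?S4 (\<lambda>i j k l. B ^ 4 * (4 * ((?s i j)\<^sup>2 * (?s k l)\<^sup>2 + (?s i k)\<^sup>2 * (?s j l)\<^sup>2 + (?s i l)\<^sup>2 * (?s j k)\<^sup>2)
     + 8 * (((?s i j)\<^sup>2 * (?s k l)\<^sup>2 + (?s i l)\<^sup>2 * (?s j k)\<^sup>2)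
        + ((?s i j)\<^sup>2 * (?s k l)\<^sup>2 + (?s i k)\<^sup>2 * (?s j l)\<^sup>2)
        + ((?s i k)\<^sup>2 * (?s j l)\<^sup>2 + (?s i l)\<^sup>2 * (?s j k)\<^sup>2))))"
  proof (intro sum_mono)
    fix i j k l assume i: "i \<in> I" "j \<in> I" "k \<in> I" "l \<in> I"
    let ?c = "c i * c j * c k * c l" and ?E = "\<integral>\<omega>. G i j k l \<omega> \<partial>M"
    let ?R = "4 * ((?s i j)\<^sup>2 * (?s k l)\<^sup>2 + (?s i k)\<^sup>2 * (?s j l)\<^sup>2 + (?s i l)\<^sup>2 * (?s j k)\<^sup>2)
     + 8 * (((?s i j)\<^sup>2 * (?s k l)\<^sup>2 + (?s i l)\<^sup>2 * (?s j k)\<^sup>2)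
        + ((?s i j)\<^sup>2 * (?s k l)\<^sup>2 + (?s i k)\<^sup>2 * (?s j l)\<^sup>2)
        + ((?s i k)\<^sup>2 * (?s j l)\<^sup>2 + (?s i l)\<^sup>2 * (?s j k)\<^sup>2))"
    have E: "?E = 4 * ((?s i j)\<^sup>2 * (?s k l)\<^sup>2 + (?s i k)\<^sup>2 * (?s j l)\<^sup>2 + (?s i l)\<^sup>2 * (?s j k)\<^sup>2)
      + 16 * (?s i j * ?s j k * ?s k l * ?s i l + ?s i j * ?s j l * ?s k l * ?s i k
      + ?s i k * ?s j k * ?s j l * ?s i l)"
      unfolding G_def by (rule ev_csq4) (use V i in auto)
    \<comment> \<open>Opposite edges of a 4-cycle are grouped, so that each of the two resulting
      products uses every index once.\<close>
    have am_gm: "2 * \<bar>p * q * r * t\<bar> \<le> p\<^sup>2 * r\<^sup>2 + t\<^sup>2 * q\<^sup>2" for p q r t :: real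
      using sum_squares_bound[of "\<bar>p * r\<bar>" "\<bar>t * q\<bar>"]
      by (simp add: power_mult_distrib abs_mult mult_ac)
    have am: "\<bar>x\<bar> \<le> 4 * (a + b + c) + 8 * ((a + c) + (a + b) + (b + c))"
      if "0 \<le> a" "0 \<le> b" "0 \<le> c" "2 * \<bar>y1\<bar> \<le> a + c" "2 * \<bar>y2\<bar> \<le> a + b" "2 * \<bar>y3\<bar> \<le> b + c"
        "x = 4 * (a + b + c) + 16 * (y1 + y2 + y3)" for x a b c y1 y2 y3 :: real
      using that by (smt (verit))
    have "\<bar>?E\<bar> \<le> ?R"
      by (rule am[OF _ _ _ am_gm am_gm am_gm E]) auto
    have "0 \<le> B" using c[OF i(1)] by linarith
    then have "\<bar>?c\<bar> \<le> B ^ 4"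
      unfolding power4_eq_xxxx abs_mult using c i \<open>0 \<le> B\<close>
      by (intro mult_mono) auto
    with \<open>\<bar>?E\<bar> \<le> ?R\<close> have "\<bar>?c\<bar> * \<bar>?E\<bar> \<le> B ^ 4 * ?R"
      by (intro mult_mono) auto
    moreover have "?c * ?E \<le> \<bar>?c\<bar> * \<bar>?E\<bar>"
      using abs_ge_self[of "?c * ?E"] unfolding abs_mult[of ?c ?E] .
    ultimately show "?c * ?E \<le> B ^ 4 * ?R" by (rule order_trans[rotated])
  qed
  \<comment> \<open>Each of the three index matchings receives weight 4 from the 2-cycles and weight
    8 from each of the two 4-cycles that contain it, which makes 20.\<close>
  also have "\<dots> = B ^ 4 * (20 * ?S4 (\<lambda>i j k l. (?s i j)\<^sup>2 * (?s k l)\<^sup>2)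
      + 20 * ?S4 (\<lambda>i j k l. (?s i k)\<^sup>2 * (?s j l)\<^sup>2) + 20 * ?S4 (\<lambda>i j k l. (?s i l)\<^sup>2 * (?s j k)\<^sup>2))"
    by (simp add: sum_distrib_left sum.distrib[symmetric] algebra_simps)
  also have "?S4 (\<lambda>i j k l. (?s i j)\<^sup>2 * (?s k l)\<^sup>2) = ?T\<^sup>2"
    unfolding sum_distrib_left[symmetric] sum_distrib_right[symmetric] power2_eq_square[of ?T] ..
  also have "?S4 (\<lambda>i j k l. (?s i k)\<^sup>2 * (?s j l)\<^sup>2) = (\<Sum>i\<in>I. \<Sum>k\<in>I. \<Sum>j\<in>I. \<Sum>l\<in>I. (?s i k)\<^sup>2 * (?s j l)\<^sup>2)"
    by (intro sum.cong refl sum.swap)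
  also have "\<dots> = ?T\<^sup>2"
    unfolding sum_distrib_left[symmetric] sum_distrib_right[symmetric] power2_eq_square[of ?T] ..
  also have "?S4 (\<lambda>i j k l. (?s i l)\<^sup>2 * (?s j k)\<^sup>2) = (\<Sum>i\<in>I. \<Sum>j\<in>I. \<Sum>l\<in>I. \<Sum>k\<in>I. (?s i l)\<^sup>2 * (?s j k)\<^sup>2)"
    by (intro sum.cong refl sum.swap)
  also have "\<dots> = (\<Sum>i\<in>I. \<Sum>l\<in>I. \<Sum>j\<in>I. \<Sum>k\<in>I. (?s i l)\<^sup>2 * (?s j k)\<^sup>2)"
    by (intro sum.cong refl sum.swap)
  also have "\<dots> = ?T\<^sup>2"
    unfolding sum_distrib_left[symmetric] sum_distrib_right[symmetric] power2_eq_square[of ?T] ..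
  finally show ?thesis by simp
qed

end

subsection \<open>Derivatives of the covariance function\<close>

lemma partial_deriv_cong_open:
  assumes "open S" "x \<in> S" "\<And>y. y \<in> S \<Longrightarrow> F y = G y"
  shows "partial_deriv e F x = partial_deriv e G x"
proof -
  have "((\<lambda>s::real. x + s *\<^sub>R e) \<longlongrightarrow> x + 0 *\<^sub>R e) (at 0)"
    by (intro tendsto_intros)
  then have "\<forall>\<^sub>F s in at 0. x + s *\<^sub>R e \<in> S"
    using assms(1,2) by (intro topological_tendstoD) auto
  then have "\<forall>\<^sub>F s in nhds 0. x + s *\<^sub>R e \<in> S"
    using assms by (auto simp: eventually_nhds_conv_at)
  then have "\<forall>\<^sub>F s in nhds 0. F (x + s *\<^sub>R e) = G (x + s *\<^sub>R e)"
    by eventually_elim (use assms in auto)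
  then show ?thesis
    unfolding partial_deriv_def by (intro vector_derivative_cong_eq) auto
qed

lemma differentiable_line_cong_open:
  fixes F G :: "'a::euclidean_space \<Rightarrow> 'b::real_normed_vector"
  assumes "open S" "x \<in> S" "\<And>y. y \<in> S \<Longrightarrow> F y = G y" "(\<lambda>s::real. F (x + s *\<^sub>R e)) differentiable (at 0)"
  shows "(\<lambda>s::real. G (x + s *\<^sub>R e)) differentiable (at 0)"
proof -
  obtain F' where F': "((\<lambda>s::real. F (x + s *\<^sub>R e)) has_derivative F') (at 0)"
    using assms(4) by (auto simp: differentiable_def)
  have op: "open ((\<lambda>s::real. x + s *\<^sub>R e) -` S)"
    by (intro open_vimage assms) (auto intro!: continuous_intros)
  have "((\<lambda>s::real. G (x + s *\<^sub>R e)) has_derivative F') (at 0)"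
    by (rule has_derivative_transform_within_open[OF F' op]) (use assms in auto)
  then show ?thesis by (auto simp: differentiable_def)
qed

lemma Cr_on_cong_open:
  assumes "open S" "\<And>y. y \<in> S \<Longrightarrow> F y = G y" "Cr_on r S F"
  shows "Cr_on r S G"
  using assms
proof (induction r arbitrary: F G)
  case 0
  then show ?case using continuous_on_cong[of S S F G] by simp
next
  case (Suc r)
  have "continuous_on S G" using Suc.prems continuous_on_cong[of S S F G] by simp
  moreover have "(\<lambda>s::real. G (x + s *\<^sub>R e)) differentiable (at 0)" if "x \<in> S" "e \<in> Basis" for x e
    by (rule differentiable_line_cong_open[of S x F G]) (use Suc.prems that in auto)
  moreover have "Cr_on r S (partial_deriv e G)" if "e \<in> Basis" for e
    by (rule Suc.IH[of "partial_deriv e F"])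
       (use Suc.prems that in \<open>auto intro: partial_deriv_cong_open\<close>)
  ultimately show ?case by auto
qed

text \<open>On the real line the only basis vector is 1, so the partial derivative agrees with
  \<open>deriv\<close> on the open set, and the smoothness class passes to
  \<open>deriv\<close>.\<close>

lemma Cr_on_real_DERIV:
  fixes F :: "real \<Rightarrow> real"
  assumes "open S" "Cr_on (Suc r) S F"
  shows "\<And>x. x \<in> S \<Longrightarrow> (F has_real_derivative deriv F x) (at x)" "Cr_on r S (deriv F)"
proof -
  have D: "(F has_real_derivative partial_deriv 1 F x) (at x)" if "x \<in> S" for x
  proof -
    have "(\<lambda>s::real. F (x + s *\<^sub>R 1)) differentiable (at 0)"
      using assms that by auto
    then have "((\<lambda>s. F (x + s *\<^sub>R 1)) has_vector_derivative partial_deriv 1 F x) (at 0)"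
      unfolding partial_deriv_def by (simp only: vector_derivative_works)
    then have "((\<lambda>s. F (s + x)) has_real_derivative partial_deriv 1 F x) (at 0)"
      by (simp add: has_real_derivative_iff_has_vector_derivative add.commute)
    then show ?thesis using DERIV_shift[of F _ 0 x] by simp
  qed
  then have eq: "partial_deriv 1 F x = deriv F x" if "x \<in> S" for x
    using that by (metis DERIV_imp_deriv)
  show "(F has_real_derivative deriv F x) (at x)" if "x \<in> S" for x
    using D eq that by metis
  show "Cr_on r S (deriv F)"
    by (rule Cr_on_cong_open[OF assms(1), of "partial_deriv 1 F"]) (use eq assms in auto)
qed

text \<open>The derivative bound makes \<open>\<phi> s + C/p s^(-p)\<close> nonincreasing on the way
  from \<open>t\<close> to \<open>t0\<close>.\<close>

lemma powr_bound_from_deriv_one_sided: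
  fixes \<phi> :: "real \<Rightarrow> real"
  assumes "0 < p" "0 \<le> C"
    and "\<And>t. 0 < t \<Longrightarrow> t \<le> t0 \<Longrightarrow> (\<phi> has_real_derivative \<phi>' t) (at t)"
    and "\<And>t. 0 < t \<Longrightarrow> t \<le> t0 \<Longrightarrow> \<bar>\<phi>' t\<bar> \<le> C * t powr (- p - 1)"
    and t: "0 < t" "t \<le> t0"
  shows "\<phi> t0 - C / p * t powr (-p) \<le> \<phi> t"
proof -
  let ?A = "\<lambda>s. \<phi> s + C / p * s powr (-p)"
  have "?A t0 \<le> ?A t"
  proof (rule DERIV_nonpos_imp_nonincreasing[OF t(2)])
    fix x assume "t \<le> x" "x \<le> t0"
    then have x: "0 < x" "x \<le> t0" using t by auto
    have "(?A has_real_derivative (\<phi>' x + C / p * (-p * x powr (-p - 1)))) (at x)"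
      using x by (auto intro!: derivative_eq_intros assms)
    moreover have "\<phi>' x + C / p * (-p * x powr (-p - 1)) \<le> 0"
      using assms(4)[OF x] \<open>0 < p\<close> by auto
    ultimately show "\<exists>y. (?A has_real_derivative y) (at x) \<and> y \<le> 0" by blast
  qed
  moreover have "0 \<le> C / p * t0 powr (-p)" using assms by auto
  ultimately show ?thesis by linarith
qed

text \<open>The one-sided estimate for \<phi> and for its negative. The constant
  \<open>\<phi> t0\<close> is absorbed because \<open>t^(-p)\<close> is bounded below on
  \<open>(0, t0]\<close>.\<close>

lemma powr_bound_from_deriv:
  fixes \<phi> :: "real \<Rightarrow> real"
  assumes "0 < p" "0 \<le> C" "0 < t0"
    and "\<And>t. 0 < t \<Longrightarrow> t \<le> t0 \<Longrightarrow> (\<phi> has_real_derivative \<phi>' t) (at t)"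
    and "\<And>t. 0 < t \<Longrightarrow> t \<le> t0 \<Longrightarrow> \<bar>\<phi>' t\<bar> \<le> C * t powr (- p - 1)"
  shows "\<exists>C'\<ge>0. \<forall>t. 0 < t \<and> t \<le> t0 \<longrightarrow> \<bar>\<phi> t\<bar> \<le> C' * t powr (-p)"
proof (intro exI conjI allI impI)
  let ?C = "\<bar>\<phi> t0\<bar> * t0 powr p + C / p"
  show "0 \<le> ?C" using assms by auto
  fix t assume "0 < t \<and> t \<le> t0"
  then have t: "0 < t" "t \<le> t0" by auto
  have "\<phi> t0 - C / p * t powr (-p) \<le> \<phi> t"
    using assms t by (intro powr_bound_from_deriv_one_sided[of p C t0 \<phi> \<phi>' t]) auto
  moreover have "- \<phi> t0 - C / p * t powr (-p) \<le> - \<phi> t"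
    using assms t
    by (intro powr_bound_from_deriv_one_sided[of p C t0 "\<lambda>x. - \<phi> x" "\<lambda>x. - \<phi>' x" t])
       (auto intro!: derivative_eq_intros)
  ultimately have "\<bar>\<phi> t\<bar> \<le> \<bar>\<phi> t0\<bar> + C / p * t powr (-p)" by linarith
  also have "\<bar>\<phi> t0\<bar> = \<bar>\<phi> t0\<bar> * t0 powr p * t0 powr (-p)"
    using \<open>0 < t0\<close> by (simp add: powr_minus)
  also have "\<dots> \<le> \<bar>\<phi> t0\<bar> * t0 powr p * t powr (-p)"
    using t assms by (intro mult_left_mono powr_mono2') auto
  finally show "\<bar>\<phi> t\<bar> \<le> ?C * t powr (-p)" by (simp add: algebra_simps)
qed

text \<open>Between \<open>t0\<close> and \<open>D\<close> the quotient of the two sides is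
  continuous on a compact interval, so enlarging the constant is enough.\<close>

lemma powr_bound_extend:
  fixes \<phi> :: "real \<Rightarrow> real"
  assumes "0 < t0" "0 < D" "continuous_on {0<..} \<phi>"
    and "\<And>t. 0 < t \<Longrightarrow> t \<le> t0 \<Longrightarrow> \<bar>\<phi> t\<bar> \<le> C * t powr q"
  shows "\<exists>C'\<ge>0. \<forall>t. 0 < t \<and> t \<le> D \<longrightarrow> \<bar>\<phi> t\<bar> \<le> C' * t powr q"
proof -
  have "continuous_on {t0..D} (\<lambda>t. \<phi> t / t powr q)"
    using assms by (intro continuous_intros continuous_on_subset[OF assms(3)]) auto
  then have "bounded ((\<lambda>t. \<phi> t / t powr q) ` {t0..D})"
    by (intro compact_imp_bounded compact_continuous_image) auto
  then obtain B where "\<forall>x\<in>(\<lambda>t. \<phi> t / t powr q) ` {t0..D}. norm x \<le> B"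
    unfolding bounded_iff by blast
  then have B: "\<bar>\<phi> t / t powr q\<bar> \<le> B" if "t \<in> {t0..D}" for t
    using that by (auto simp: real_norm_def simp del: abs_divide)
  show ?thesis
  proof (intro exI conjI allI impI)
    show "0 \<le> max \<bar>C\<bar> B" by simp
    fix t assume t: "0 < t \<and> t \<le> D"
    show "\<bar>\<phi> t\<bar> \<le> max \<bar>C\<bar> B * t powr q"
    proof (cases "t \<le> t0")
      case True
      then have "\<bar>\<phi> t\<bar> \<le> C * t powr q" using t assms by auto
      also have "\<dots> \<le> max \<bar>C\<bar> B * t powr q" by (intro mult_right_mono) auto
      finally show ?thesis .
    next
      case False
      then have "\<bar>\<phi> t\<bar> \<le> B * t powr q" using t B[of t] by (auto simp: divide_simps abs_mult)
      also have "\<dots> \<le> max \<bar>C\<bar> B * t powr q" by (intro mult_right_mono) auto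
      finally show ?thesis .
    qed
  qed
qed

text \<open>Integrating the bound on the fourth derivative from \<open>t0\<close> towards 0 gives
  the third and then the second derivative. The first derivative needs another argument, and the
  bounds are finally extended from a neighbourhood of 0 to \<open>(0, D]\<close>.\<close>

lemma covariance_derivative_bounds:
  fixes R :: "real \<Rightarrow> real"
  assumes \<alpha>: "0 < \<alpha>" "\<alpha> < 2" and "0 < t0" "0 \<le> c" "0 < D"
    and R0: "\<And>t. 0 < t \<Longrightarrow> t \<le> t0 \<Longrightarrow> \<bar>R t - r0\<bar> \<le> c * t powr \<alpha>"
    and R4: "\<And>t. 0 < t \<Longrightarrow> t \<le> t0 \<Longrightarrow> \<bar>(deriv ^^ 4) R t\<bar> \<le> c * t powr (\<alpha> - 4)"
    and Cr: "Cr_on 4 {0<..} R"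
  obtains C where "0 \<le> C" "\<And>j t. j \<in> {1,2,3} \<Longrightarrow> 0 < t \<Longrightarrow> t \<le> D \<Longrightarrow> \<bar>(deriv ^^ j) R t\<bar> \<le> C * t powr (\<alpha> - real j)"
    "\<And>j t. j \<in> {0,1,2} \<Longrightarrow> 0 < t \<Longrightarrow> ((deriv ^^ j) R has_real_derivative (deriv ^^ Suc j) R t) (at t)"
proof -
  have C3: "Cr_on 3 {0<..} (deriv R)" and D0: "\<And>t. t > 0 \<Longrightarrow> (R has_real_derivative deriv R t) (at t)"
    using Cr_on_real_DERIV[of "{0<..}" 3 R] Cr by auto
  have C2: "Cr_on 2 {0<..} (deriv (deriv R))"
    and D1: "\<And>t. t > 0 \<Longrightarrow> (deriv R has_real_derivative deriv (deriv R) t) (at t)"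
    using Cr_on_real_DERIV[of "{0<..}" 2 "deriv R"] C3 by (auto simp: numeral_3_eq_3 numeral_2_eq_2)
  have C1: "Cr_on 1 {0<..} (deriv (deriv (deriv R)))"
    and D2: "\<And>t. t > 0 \<Longrightarrow> (deriv (deriv R) has_real_derivative deriv (deriv (deriv R)) t) (at t)"
    using Cr_on_real_DERIV[of "{0<..}" 1 "deriv (deriv R)"] C2 by (auto simp: numeral_2_eq_2)
  have D3: "\<And>t. t > 0 \<Longrightarrow> (deriv (deriv (deriv R)) has_real_derivative deriv (deriv (deriv (deriv R))) t) (at t)"
    using Cr_on_real_DERIV[of "{0<..}" 0 "deriv (deriv (deriv R))"] C1 by auto
  have cont: "continuous_on {0<..} (deriv R)" "continuous_on {0<..} (deriv (deriv R))"
    "continuous_on {0<..} (deriv (deriv (deriv R)))"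
    using C3 C2 C1 by (simp_all add: numeral_3_eq_3 numeral_2_eq_2)
  have "(deriv ^^ 4) R = deriv (deriv (deriv (deriv R)))" by (simp add: eval_nat_numeral)
  then have "\<exists>C'\<ge>0. \<forall>t. 0 < t \<and> t \<le> t0 \<longrightarrow> \<bar>deriv (deriv (deriv R)) t\<bar> \<le> C' * t powr (-(3-\<alpha>))"
    using R4 assms D3 by (intro powr_bound_from_deriv[where \<phi>'="(deriv ^^ 4) R" and C=c]) (auto simp: algebra_simps)
  then obtain c3 where c3: "0 \<le> c3" "\<And>t. 0 < t \<Longrightarrow> t \<le> t0 \<Longrightarrow> \<bar>deriv (deriv (deriv R)) t\<bar> \<le> c3 * t powr (\<alpha> - 3)"
    by auto
  then have "\<exists>C'\<ge>0. \<forall>t. 0 < t \<and> t \<le> t0 \<longrightarrow> \<bar>deriv (deriv R) t\<bar> \<le> C' * t powr (-(2-\<alpha>))"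
    using assms D2 by (intro powr_bound_from_deriv[where \<phi>'="deriv (deriv (deriv R))" and C=c3]) (auto simp: algebra_simps)
  then obtain c2 where c2: "0 \<le> c2" "\<And>t. 0 < t \<Longrightarrow> t \<le> t0 \<Longrightarrow> \<bar>deriv (deriv R) t\<bar> \<le> c2 * t powr (\<alpha> - 2)"
    by auto
  \<comment> \<open>Integration from \<open>t0\<close> would leave a constant that is too large if
    \<open>\<alpha> > 1\<close> and a logarithm if \<open>\<alpha> = 1\<close>. Instead the
    increment of \<open>R\<close> over \<open>[t, 2t]\<close> bounds \<open>R'\<close> at some
    intermediate point, and \<open>R''\<close> transfers this to \<open>t\<close>;
    \<open>2t \<le> t0\<close> keeps the expansion valid.\<close>
  have c1: "\<bar>deriv R t\<bar> \<le> (c * (1 + 2 powr \<alpha>) + c2) * t powr (\<alpha> - 1)" if t: "0 < t" "t \<le> t0/2" for t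
  proof -
    obtain x where x: "t < x" "x < 2*t" "R (2*t) - R t = (2*t - t) * deriv R x"
      using MVT2[of t "2*t" R "deriv R"] D0 t by auto
    obtain y where y: "t < y" "y < x" "deriv R x - deriv R t = (x - t) * deriv (deriv R) y"
      using MVT2[of t x "deriv R" "deriv (deriv R)"] D1 t x by auto
    have "t * \<bar>deriv R x\<bar> = \<bar>R (2*t) - R t\<bar>" using x t by (simp add: abs_mult)
    also have "\<dots> \<le> c * (2*t) powr \<alpha> + c * t powr \<alpha>" using R0[of t] R0[of "2*t"] t by linarith
    also have "\<dots> = t * (c * (1 + 2 powr \<alpha>) * t powr (\<alpha> - 1))"
      using t by (simp add: powr_mult powr_diff algebra_simps)
    finally have 1: "\<bar>deriv R x\<bar> \<le> c * (1 + 2 powr \<alpha>) * t powr (\<alpha> - 1)" using t by simp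
    have "\<bar>deriv R x - deriv R t\<bar> = (x - t) * \<bar>deriv (deriv R) y\<bar>" using y x by (simp add: abs_mult)
    also have "\<dots> \<le> t * (c2 * y powr (\<alpha> - 2))" using x y t c2 by (intro mult_mono) auto
    also have "\<dots> \<le> t * (c2 * t powr (\<alpha> - 2))"
      using x y t c2 \<alpha> by (intro mult_left_mono powr_mono2') auto
    also have "\<dots> = c2 * t powr (\<alpha> - 1)"
      using t powr_add[of t 1 "\<alpha> - 2"] by (simp add: algebra_simps)
    finally show ?thesis using 1 by (simp add: algebra_simps)
  qed
  obtain k1 where k1: "k1 \<ge> 0" "\<And>t. 0 < t \<Longrightarrow> t \<le> D \<Longrightarrow> \<bar>deriv R t\<bar> \<le> k1 * t powr (\<alpha> - 1)"
    using powr_bound_extend[of "t0/2" D "deriv R", OF _ _ cont(1) c1] assms by auto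
  obtain k2 where k2: "k2 \<ge> 0" "\<And>t. 0 < t \<Longrightarrow> t \<le> D \<Longrightarrow> \<bar>deriv (deriv R) t\<bar> \<le> k2 * t powr (\<alpha> - 2)"
    using powr_bound_extend[of "t0" D "deriv (deriv R)", OF _ _ cont(2) c2(2)] assms by auto
  obtain k3 where k3: "k3 \<ge> 0" "\<And>t. 0 < t \<Longrightarrow> t \<le> D \<Longrightarrow> \<bar>deriv (deriv (deriv R)) t\<bar> \<le> k3 * t powr (\<alpha> - 3)"
    using powr_bound_extend[of "t0" D "deriv (deriv (deriv R))", OF _ _ cont(3) c3(2)] assms by auto
  show thesis
  proof (rule that[of "k1 + k2 + k3"])
    show "0 \<le> k1 + k2 + k3" using k1 k2 k3 by auto
    have mono: "a * t powr q \<le> (k1 + k2 + k3) * t powr q" if "a \<le> k1 + k2 + k3" for a t q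
      using that by (intro mult_right_mono) auto
    show "\<bar>(deriv ^^ j) R t\<bar> \<le> (k1 + k2 + k3) * t powr (\<alpha> - real j)" if "j \<in> {1,2,3}" "0 < t" "t \<le> D" for j t
      using that k1(1) k2(1) k3(1) order_trans[OF k1(2) mono] order_trans[OF k2(2) mono] order_trans[OF k3(2) mono]
      by (auto simp: numeral_3_eq_3 numeral_2_eq_2)
    show "((deriv ^^ j) R has_real_derivative (deriv ^^ Suc j) R t) (at t)" if "j \<in> {0,1,2}" "0 < t" for j t
      using that D0 D1 D2 by (auto simp: numeral_2_eq_2)
  qed
qed

text \<open>Passing to \<open>S y = R (sqrt y)\<close> makes the argument \<open>|f w - f w'|\<^sup>2\<close> a smooth function.\<close>
lemma covariance_sqrt_bounds:
  fixes R :: "real \<Rightarrow> real"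
  assumes \<alpha>: "0 < \<alpha>" "\<alpha> < 2" and "0 < t0" "0 \<le> c" "0 < D"
    and R0: "\<And>t. 0 < t \<Longrightarrow> t \<le> t0 \<Longrightarrow> \<bar>R t - r0\<bar> \<le> c * t powr \<alpha>"
    and R4: "\<And>t. 0 < t \<Longrightarrow> t \<le> t0 \<Longrightarrow> \<bar>(deriv ^^ 4) R t\<bar> \<le> c * t powr (\<alpha> - 4)"
    and Cr: "Cr_on 4 {0<..} R"
  obtains C S1 S2 S3 where "0 \<le> C"
    "\<And>y. 0 < y \<Longrightarrow> ((\<lambda>y. R (sqrt y)) has_real_derivative S1 y) (at y)"
    "\<And>y. 0 < y \<Longrightarrow> (S1 has_real_derivative S2 y) (at y)"
    "\<And>y. 0 < y \<Longrightarrow> (S2 has_real_derivative S3 y) (at y)"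
    "\<And>t. 0 < t \<Longrightarrow> t \<le> D \<Longrightarrow> \<bar>S1 (t\<^sup>2)\<bar> \<le> C * t powr (\<alpha> - 2)"
    "\<And>t. 0 < t \<Longrightarrow> t \<le> D \<Longrightarrow> \<bar>S2 (t\<^sup>2)\<bar> \<le> C * t powr (\<alpha> - 4)"
    "\<And>t. 0 < t \<Longrightarrow> t \<le> D \<Longrightarrow> \<bar>S3 (t\<^sup>2)\<bar> \<le> C * t powr (\<alpha> - 6)"
proof -
  obtain C where C: "0 \<le> C"
    and B: "\<And>j t. j \<in> {1,2,3} \<Longrightarrow> 0 < t \<Longrightarrow> t \<le> D \<Longrightarrow> \<bar>(deriv ^^ j) R t\<bar> \<le> C * t powr (\<alpha> - real j)"
    and Dv: "\<And>j t. j \<in> {0,1,2} \<Longrightarrow> 0 < t \<Longrightarrow> ((deriv ^^ j) R has_real_derivative (deriv ^^ Suc j) R t) (at t)"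
    by (rule covariance_derivative_bounds[OF assms]) auto
  define R1 R2 R3 where "R1 = deriv R" and "R2 = (deriv ^^ 2) R" and "R3 = (deriv ^^ 3) R"
  have d0: "(R has_real_derivative R1 t) (at t)" if "0 < t" for t
    using Dv[of 0 t] that by (simp add: R1_def)
  have d1: "(R1 has_real_derivative R2 t) (at t)" if "0 < t" for t
    using Dv[of 1 t] that by (simp add: R1_def R2_def numeral_2_eq_2)
  have d2: "(R2 has_real_derivative R3 t) (at t)" if "0 < t" for t
    using Dv[of 2 t] that by (simp add: R3_def R2_def numeral_2_eq_2 numeral_3_eq_3)
  have b1: "\<bar>R1 t\<bar> \<le> C * t powr (\<alpha> - 1)" if "0 < t" "t \<le> D" for t
    using B[of 1 t] that by (simp add: R1_def)
  have b2: "\<bar>R2 t\<bar> \<le> C * t powr (\<alpha> - 2)" if "0 < t" "t \<le> D" for t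
    using B[of 2 t] that by (simp add: R2_def)
  have b3: "\<bar>R3 t\<bar> \<le> C * t powr (\<alpha> - 3)" if "0 < t" "t \<le> D" for t
    using B[of 3 t] that by (simp add: R3_def)
  \<comment> \<open>The first three derivatives of \<open>R (sqrt y)\<close>, as the chain rule
    gives them with \<open>sqrt y\<close> for the distance.\<close>
  define S1 where "S1 y = R1 (sqrt y) / (2 * sqrt y)" for y
  define S2 where "S2 y = R2 (sqrt y) / (4 * sqrt y ^ 2) - R1 (sqrt y) / (4 * sqrt y ^ 3)" for y
  define S3 where "S3 y = R3 (sqrt y) / (8 * sqrt y ^ 3) - 3 * R2 (sqrt y) / (8 * sqrt y ^ 4) + 3 * R1 (sqrt y) / (8 * sqrt y ^ 5)" for y
  have sq: "(sqrt has_real_derivative 1 / (2 * sqrt y)) (at y)" if "0 < y" for y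
    using DERIV_real_sqrt[OF that] by (elim DERIV_cong) (simp add: field_simps)
  have ch: "((\<lambda>y. F (sqrt y)) has_real_derivative F' (sqrt y) * (1 / (2 * sqrt y))) (at y)"
    if "\<And>t. 0 < t \<Longrightarrow> (F has_real_derivative F' t) (at t)" "0 < y" for F F' :: "real \<Rightarrow> real" and y
    by (rule DERIV_chain2[OF that(1) sq]) (use that in auto)
  have 1: "((\<lambda>y. R (sqrt y)) has_real_derivative S1 y) (at y)" if "0 < y" for y
    using ch[OF d0 that] by (simp add: S1_def)
  have 2: "(S1 has_real_derivative S2 y) (at y)" if "0 < y" for y
  proof -
    define r where "r = sqrt y"
    have r: "r > 0" using that by (simp add: r_def)
    have "((\<lambda>t. R1 t / (2 * t)) has_real_derivative R2 t / (2 * t) - R1 t / (2 * t\<^sup>2)) (at t)" if "0 < t" for t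
      using that by (auto intro!: derivative_eq_intros d1 simp: field_simps power2_eq_square)
    then show ?thesis unfolding S1_def[abs_def] S2_def
      by (rule DERIV_cong[OF ch[OF _ that]]) (use r in \<open>simp_all add: r_def[symmetric] field_simps eval_nat_numeral\<close>)
  qed
  have 3: "(S2 has_real_derivative S3 y) (at y)" if "0 < y" for y
  proof -
    define r where "r = sqrt y"
    have r: "r > 0" using that by (simp add: r_def)
    have "((\<lambda>t. R2 t / (4 * t ^ 2) - R1 t / (4 * t ^ 3)) has_real_derivative
       (R3 t / (4 * t ^ 2) - R2 t / (2 * t ^ 3)) - (R2 t / (4 * t ^ 3) - 3 * R1 t / (4 * t ^ 4))) (at t)" if "0 < t" for t
      using that by (auto intro!: derivative_eq_intros d1 d2 simp: field_simps eval_nat_numeral)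
    then show ?thesis unfolding S2_def[abs_def] S3_def
      by (rule DERIV_cong[OF ch[OF _ that]]) (use r in \<open>simp_all add: r_def[symmetric] field_simps eval_nat_numeral\<close>)
  qed
  \<comment> \<open>Every summand is a derivative of order \<open>j\<close> divided by
    \<open>t^k\<close>, where \<open>j + k\<close> is 2, 4 and 6 for \<open>S1\<close>,
    \<open>S2\<close> and \<open>S3\<close>. All summands of one function therefore obey the same
    power bound.\<close>
  have pw: "C * t powr (\<alpha> - real j) / t ^ k = C * t powr (\<alpha> - real (j + k))" if "0 < t" for t j k
    using that by (simp add: powr_realpow[symmetric] powr_diff powr_add)
  have q: "\<bar>F t / t ^ k\<bar> \<le> C * t powr (\<alpha> - real (j + k))" if "\<bar>F t\<bar> \<le> C * t powr (\<alpha> - real j)" "0 < t" for F :: "real \<Rightarrow> real" and t j k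
    using divide_right_mono[OF that(1), of "t ^ k"] pw[OF that(2), of j k] that(2) by (simp add: abs_divide)
  show thesis
  proof (rule that[OF C 1 2 3])
    fix t assume t: "0 < t" "t \<le> D"
    have "S1 (t\<^sup>2) = (R1 t / t) / 2"
      using t by (simp add: S1_def)
    moreover have "\<bar>R1 t / t\<bar> \<le> C * t powr (\<alpha> - 2)"
      using q[of R1 t 1 1] b1[OF t] t by simp
    moreover have "\<bar>x\<bar> \<le> Y \<Longrightarrow> \<bar>x / 2\<bar> \<le> Y" for x Y :: real by linarith
    ultimately show "\<bar>S1 (t\<^sup>2)\<bar> \<le> C * t powr (\<alpha> - 2)" by (simp only:)
    have "S2 (t\<^sup>2) = (R2 t / t ^ 2) / 4 - (R1 t / t ^ 3) / 4"
      using t by (simp add: S2_def)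
    moreover have "\<bar>R2 t / t ^ 2\<bar> \<le> C * t powr (\<alpha> - 4)" "\<bar>R1 t / t ^ 3\<bar> \<le> C * t powr (\<alpha> - 4)"
      using q[of R1 t 1 3] q[of R2 t 2 2] b1[OF t] b2[OF t] t by simp_all
    moreover have "\<bar>x\<bar> \<le> Y \<Longrightarrow> \<bar>y\<bar> \<le> Y \<Longrightarrow> \<bar>x / 4 - y / 4\<bar> \<le> Y" for x y Y :: real by linarith
    ultimately show "\<bar>S2 (t\<^sup>2)\<bar> \<le> C * t powr (\<alpha> - 4)" by (simp only:)
    have "S3 (t\<^sup>2) = (R3 t / t ^ 3) / 8 - 3 * ((R2 t / t ^ 4) / 8) + 3 * ((R1 t / t ^ 5) / 8)"
      using t by (simp add: S3_def)
    moreover have "\<bar>R3 t / t ^ 3\<bar> \<le> C * t powr (\<alpha> - 6)" "\<bar>R2 t / t ^ 4\<bar> \<le> C * t powr (\<alpha> - 6)"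
        "\<bar>R1 t / t ^ 5\<bar> \<le> C * t powr (\<alpha> - 6)"
      using q[of R1 t 1 5] q[of R2 t 2 4] q[of R3 t 3 3] b1[OF t] b2[OF t] b3[OF t] t by simp_all
    moreover have "\<bar>x\<bar> \<le> Y \<Longrightarrow> \<bar>y\<bar> \<le> Y \<Longrightarrow> \<bar>z\<bar> \<le> Y \<Longrightarrow> \<bar>x / 8 - 3 * (y / 8) + 3 * (z / 8)\<bar> \<le> Y"
      for x y z Y :: real by linarith
    ultimately show "\<bar>S3 (t\<^sup>2)\<bar> \<le> C * t powr (\<alpha> - 6)" by (simp only:)
  qed
qed

subsection \<open>Directional derivatives\<close>

lemma partial_deriv_eqI:
  assumes "(F has_derivative F') (at x)"
  shows "partial_deriv e F x = F' e"
proof -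
  have "((\<lambda>s::real. x + s *\<^sub>R e) has_derivative (\<lambda>s. s *\<^sub>R e)) (at 0)"
    by (auto intro!: derivative_eq_intros)
  then have "((\<lambda>s. F (x + s *\<^sub>R e)) has_derivative (\<lambda>s. F' (s *\<^sub>R e))) (at 0)"
    by (rule has_derivative_compose[where g=F and g'=F']) (use assms in simp)
  then have "((\<lambda>s. F (x + s *\<^sub>R e)) has_vector_derivative F' e) (at 0)"
    using has_derivative_linear[OF assms] by (simp add: has_vector_derivative_def linear_cmul)
  then show ?thesis
    unfolding partial_deriv_def by (rule vector_derivative_at)
qed

text \<open>The counterpart of \<open>dir_deriv\<close> with values in an arbitrary normed space,
  since the map \<open>f\<close> is differentiated too.\<close>

definition dirD :: "real^2 \<Rightarrow> (real^2 \<Rightarrow> 'b::real_normed_vector) \<Rightarrow> real^2 \<Rightarrow> 'b" where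
  "dirD k F x = (\<Sum>e\<in>Basis. (k \<bullet> e) *\<^sub>R partial_deriv e F x)"

lemma dir_deriv_eq_dirD: "dir_deriv u F x = dirD u F x"
  by (simp add: dir_deriv_def gradient_def dirD_def inner_sum_right mult.commute)

lemma Basis_real2: "(Basis :: (real^2) set) = {axis 1 1, axis 2 1}"
  by (auto simp: Basis_vec_def UNIV_2)

lemma axis_neq_2: "axis 1 (1::real) \<noteq> (axis 2 1 :: real^2)"
  by (simp add: axis_eq_axis)

lemma vec2_eq: "x = x $ 1 *\<^sub>R axis 1 1 + x $ 2 *\<^sub>R (axis 2 1 :: real^2)"
  by (simp add: vec_eq_iff forall_2 axis_def)

lemma inner_axis_2: "(k :: real^2) \<bullet> axis i 1 = k $ i"
  by (simp add: inner_axis)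

lemma dirD_2: "dirD k F x = k $ 1 *\<^sub>R partial_deriv (axis 1 1) F x + k $ 2 *\<^sub>R partial_deriv (axis 2 1) F x"
  using axis_neq_2 by (simp add: dirD_def Basis_real2 inner_axis_2)

text \<open>Continuous partial derivatives imply total differentiability. The plane is identified
  with pairs of reals and the criterion for functions of two variables is applied there.\<close>

lemma Cr_on_1_has_derivative:
  fixes F :: "real^2 \<Rightarrow> 'b::real_normed_vector"
  assumes "Cr_on (Suc r) UNIV F"
  shows "(F has_derivative (\<lambda>k. dirD k F x)) (at x)"
proof -
  let ?e1 = "axis 1 1 :: real^2" and ?e2 = "axis 2 1 :: real^2"
  have B: "?e1 \<in> Basis" "?e2 \<in> Basis" by (auto simp: Basis_real2)
  have vd: "((\<lambda>s. F (x + s *\<^sub>R e)) has_vector_derivative partial_deriv e F x) (at 0)" if "e \<in> Basis" for e x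
    using assms that unfolding partial_deriv_def by (auto simp: vector_derivative_works[symmetric])
  have cont: "continuous_on UNIV (partial_deriv e F)" if "e \<in> Basis" for e
  proof -
    have "Cr_on r UNIV (partial_deriv e F)" using assms that by simp
    then show ?thesis by (cases r) auto
  qed
  have vd': "((\<lambda>s. F (y + s *\<^sub>R e)) has_derivative (\<lambda>t. t *\<^sub>R partial_deriv e F (y + a *\<^sub>R e))) (at a)"
    if "e \<in> Basis" for e y a
  proof -
    have "((\<lambda>s. F ((y + a *\<^sub>R e) + (s - a) *\<^sub>R e)) has_vector_derivative
        1 *\<^sub>R partial_deriv e F (y + a *\<^sub>R e)) (at a)"
      using vector_diff_chain_at[of "\<lambda>s. s - a" 1 a "\<lambda>s. F ((y + a *\<^sub>R e) + s *\<^sub>R e)"] vd[OF that, of "y + a *\<^sub>R e"]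
      by (simp add: o_def has_vector_derivative_diff_const has_vector_derivative_id)
    then show ?thesis by (simp add: has_vector_derivative_def algebra_simps)
  qed
  define G where "G a b = F (a *\<^sub>R ?e1 + b *\<^sub>R ?e2)" for a b
  define Gy where "Gy a b = blinfun_scaleR_left (partial_deriv ?e2 F (a *\<^sub>R ?e1 + b *\<^sub>R ?e2))" for a b
  have "((\<lambda>(a, b). G a b) has_derivative (\<lambda>(ta, tb). ta *\<^sub>R partial_deriv ?e1 F (x $ 1 *\<^sub>R ?e1 + x $ 2 *\<^sub>R ?e2)
      + blinfun_apply (Gy (x $ 1) (x $ 2)) tb)) (at (x $ 1, x $ 2) within UNIV \<times> UNIV)"
  proof (rule has_derivative_partialsI)
    show "((\<lambda>a. G a (x $ 2)) has_derivative (\<lambda>ta. ta *\<^sub>R partial_deriv ?e1 F (x $ 1 *\<^sub>R ?e1 + x $ 2 *\<^sub>R ?e2))) (at (x $ 1))"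
      using vd'[OF B(1), of "x $ 2 *\<^sub>R ?e2" "x $ 1"] by (simp add: G_def add.commute)
    show "((\<lambda>b. G a b) has_derivative blinfun_apply (Gy a b)) (at b)" for a b
      using vd'[OF B(2), of "a *\<^sub>R ?e1" b] by (simp add: G_def Gy_def)
    have "continuous_on UNIV (\<lambda>p. partial_deriv ?e2 F (fst p *\<^sub>R ?e1 + snd p *\<^sub>R ?e2))"
      by (rule continuous_on_compose2[OF cont[OF B(2)]]) (auto intro!: continuous_intros)
    then have "continuous_on UNIV (\<lambda>p. blinfun_scaleR_left (partial_deriv ?e2 F (fst p *\<^sub>R ?e1 + snd p *\<^sub>R ?e2)))"
      by (rule bounded_linear.continuous_on[OF bounded_linear_blinfun_scaleR_left])
    moreover have "(\<lambda>(a, b). Gy a b) = (\<lambda>p. blinfun_scaleR_left (partial_deriv ?e2 F (fst p *\<^sub>R ?e1 + snd p *\<^sub>R ?e2)))"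
      by (simp add: fun_eq_iff Gy_def)
    ultimately show "continuous (at (x $ 1, x $ 2) within UNIV \<times> UNIV) (\<lambda>(a, b). Gy a b)"
      by (simp add: continuous_on_eq_continuous_at)
  qed auto
  then have G: "((\<lambda>p. G (fst p) (snd p)) has_derivative (\<lambda>t. fst t *\<^sub>R partial_deriv ?e1 F x
      + snd t *\<^sub>R partial_deriv ?e2 F x)) (at (x $ 1, x $ 2))"
    by (simp add: Gy_def case_prod_beta' vec2_eq[symmetric])
  have "((\<lambda>x. (x $ 1, x $ 2)) has_derivative (\<lambda>k::real^2. (k $ 1, k $ 2))) (at x)"
    by (intro has_derivative_Pair bounded_linear.has_derivative[OF bounded_linear_vec_nth] has_derivative_ident)
  from has_derivative_compose[OF this G]
  show ?thesis by (simp add: G_def vec2_eq[symmetric] dirD_2)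
qed

lemma Cr_on_partial: "Cr_on (Suc r) S F \<Longrightarrow> e \<in> Basis \<Longrightarrow> Cr_on r S (partial_deriv e F)"
  by simp

lemma Cr_on_continuous: "Cr_on r S F \<Longrightarrow> continuous_on S F"
  by (cases r) auto

lemma continuous_on_dirD:
  assumes "Cr_on (Suc r) UNIV F" shows "continuous_on UNIV (dirD k F)"
  unfolding dirD_def using assms by (intro continuous_intros Cr_on_continuous[of r] Cr_on_partial)

section \<open>Nondegeneracy of the diffeomorphism\<close>

lemma jacobian_mult_eq_dirD:
  fixes f :: "real^2 \<Rightarrow> real^2"
  assumes "Cr_on (Suc r) UNIV f"
  shows "jacobian f (at x) *v h = dirD h f x"
proof -
  have "frechet_derivative f (at x) = (\<lambda>k. dirD k f x)"
    using frechet_derivative_at[OF Cr_on_1_has_derivative[OF assms]] by simp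
  then show ?thesis
    unfolding jacobian_def using has_derivative_linear[OF Cr_on_1_has_derivative[OF assms, of x]]
    by simp
qed

text \<open>A nonzero determinant leaves no kernel. Thus \<open>|J h|\<close> stays away from the
  point where its power \<alpha> can fail to be differentiable.\<close>

lemma Cr_diffeo_dirD_nonzero:
  assumes "Cr_diffeo (Suc r) f" "k \<noteq> 0"
  shows "dirD k f x \<noteq> 0"
proof
  assume "dirD k f x = 0"
  moreover have "Cr_on (Suc r) UNIV f" "det (jacobian f (at x)) > 0"
    using assms by (auto simp: Cr_diffeo_def)
  ultimately have "jacobian f (at x) *v k = 0" "invertible (jacobian f (at x))"
    using jacobian_mult_eq_dirD[of r f x k] by (simp_all add: invertible_det_nz)
  then show False using assms(2) by (metis matrix_left_invertible_ker invertible_def)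
qed

text \<open>The derivative at \<open>a\<close> expands lengths at least by a factor
  \<open>B\<close>, while near \<open>a\<close> the difference between \<open>f\<close> and this
  linear map has Lipschitz constant at most \<open>B / 2\<close>.\<close>

lemma local_lower_Lipschitz:
  fixes f :: "real^2 \<Rightarrow> real^2"
  assumes "Cr_diffeo (Suc r) f"
  obtains c d where "c > 0" "d > 0" "\<And>x y. x \<in> ball a d \<Longrightarrow> y \<in> ball a d \<Longrightarrow> c * norm (x - y) \<le> norm (f x - f y)"
proof -
  have Cr: "Cr_on (Suc r) UNIV f" using assms by (simp add: Cr_diffeo_def)
  let ?L = "\<lambda>k. dirD k f a"
  note der = Cr_on_1_has_derivative[OF Cr]
  have lin: "linear (\<lambda>k. dirD k f x)" for x by (rule has_derivative_linear[OF der])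
  have "inj ?L"
    using Cr_diffeo_dirD_nonzero[OF assms] by (intro linear_injective_0[OF lin, THEN iffD2]) auto
  then obtain B where B: "B > 0" "\<And>k. B * norm k \<le> norm (?L k)"
    by (rule linear_inj_bounded_below_pos[OF lin]) auto
  \<comment> \<open>The oscillation of the partial derivatives around \<open>a\<close>; it bounds
    the operator norm of the difference of derivatives and is continuous with value 0 at
    \<open>a\<close>.\<close>
  define \<eta> where "\<eta> x = (\<Sum>e\<in>Basis. norm (partial_deriv e f x - partial_deriv e f a))" for x
  have "continuous_on UNIV \<eta>"
    unfolding \<eta>_def using Cr by (intro continuous_intros Cr_on_continuous[of r] Cr_on_partial)
  then have "(\<eta> \<longlongrightarrow> \<eta> a) (nhds a)"
    unfolding tendsto_at_iff_tendsto_nhds[symmetric] isCont_def[symmetric] by (simp add: continuous_on_eq_continuous_at)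
  moreover have "\<eta> a < B / 2" using B by (simp add: \<eta>_def)
  ultimately have "\<forall>\<^sub>F x in nhds a. \<eta> x < B / 2"
    by (rule order_tendstoD)
  then obtain d where d: "d > 0" "\<And>x. dist x a < d \<Longrightarrow> \<eta> x < B / 2"
    by (auto simp: eventually_nhds_metric)
  have main: "B / 2 * norm (x - y) \<le> norm (f x - f y)" if "x \<in> ball a d" "y \<in> ball a d" for x y
  proof -
    have "norm ((f x - ?L x) - (f y - ?L y)) \<le> B / 2 * norm (x - y)"
    proof (rule differentiable_bound[of "ball a d" "\<lambda>z. f z - ?L z" "\<lambda>z k. dirD k f z - ?L k"])
      fix z assume z: "z \<in> ball a d"
      show "((\<lambda>z. f z - ?L z) has_derivative (\<lambda>k. dirD k f z - ?L k)) (at z within ball a d)"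
        by (intro has_derivative_diff has_derivative_at_withinI[OF der]
             linear_imp_has_derivative lin)
      show "onorm (\<lambda>k. dirD k f z - ?L k) \<le> B / 2"
      proof (rule onorm_bound)
        fix k :: "real^2"
        have "norm (dirD k f z - ?L k) \<le> (\<Sum>e\<in>Basis. norm ((k \<bullet> e) *\<^sub>R (partial_deriv e f z - partial_deriv e f a)))"
          unfolding dirD_def sum_subtractf[symmetric] scaleR_diff_right[symmetric] by (rule norm_sum)
        also have "\<dots> \<le> (\<Sum>e\<in>Basis. norm k * norm (partial_deriv e f z - partial_deriv e f a))"
          by (intro sum_mono) (auto intro!: mult_right_mono Basis_le_norm)
        also have "\<dots> = norm k * \<eta> z" by (simp add: \<eta>_def sum_distrib_left)
        also have "\<dots> \<le> norm k * (B / 2)"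
          using d(2)[of z] z by (intro mult_left_mono) (auto simp: dist_commute)
        finally show "norm (dirD k f z - ?L k) \<le> B / 2 * norm k" by (simp add: mult.commute)
      qed (use B in auto)
    qed (use that in auto)
    moreover have "B * norm (x - y) \<le> norm (?L x - ?L y)"
      using B(2)[of "x - y"] by (simp add: linear_diff[OF lin])
    moreover have "norm (?L x - ?L y) \<le> norm (f x - f y) + norm ((f x - ?L x) - (f y - ?L y))"
    proof -
      have "?L x - ?L y = (f x - f y) - ((f x - ?L x) - (f y - ?L y))" by simp
      then show ?thesis by (metis norm_triangle_ineq4)
    qed
    ultimately show ?thesis by linarith
  qed
  show thesis by (rule that[of "B / 2" d]) (use B d main in auto)
qed

text \<open>If every constant failed, compactness would give two convergent sequences whose limits
  have the same image. Injectivity makes the limits equal, and there the local bound contradicts the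
  failure.\<close>

lemma Cr_diffeo_lower_Lipschitz:
  fixes f :: "real^2 \<Rightarrow> real^2"
  assumes "Cr_diffeo (Suc r) f" "compact D"
  obtains (lower) c where "c > 0" "\<And>x y. x \<in> D \<Longrightarrow> y \<in> D \<Longrightarrow> c * norm (x - y) \<le> norm (f x - f y)"
proof (rule ccontr)
  assume neg0: "\<not> thesis"
  have neg: "\<exists>x\<in>D. \<exists>y\<in>D. norm (f x - f y) < c * norm (x - y)" if c: "c > 0" for c
  proof (rule ccontr)
    assume "\<not> ?thesis"
    then have "\<forall>x\<in>D. \<forall>y\<in>D. c * norm (x - y) \<le> norm (f x - f y)" by (auto simp: not_less)
    then show False using neg0 lower c by blast
  qed
  have Cr: "Cr_on (Suc r) UNIV f" and "inj f" using assms by (simp_all add: Cr_diffeo_def)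
  have cont: "continuous_on UNIV f" using Cr by (rule Cr_on_continuous)
  have "\<exists>p. fst p \<in> D \<and> snd p \<in> D \<and> norm (f (fst p) - f (snd p)) < inverse (real (Suc n)) * norm (fst p - snd p)" for n
    using neg[of "inverse (real (Suc n))"] by auto
  then obtain p where p: "\<And>n. fst (p n) \<in> D" "\<And>n. snd (p n) \<in> D"
    "\<And>n. norm (f (fst (p n)) - f (snd (p n))) < inverse (real (Suc n)) * norm (fst (p n) - snd (p n))"
    by metis
  have "compact (D \<times> D)" using assms by (intro compact_Times)
  moreover have "\<forall>n. p n \<in> D \<times> D" using p by (simp add: mem_Times_iff)
  ultimately obtain q \<sigma> where q: "q \<in> D \<times> D" "strict_mono (\<sigma> :: nat \<Rightarrow> nat)" "(p \<circ> \<sigma>) \<longlonglongrightarrow> q"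
    unfolding compact_def by metis
  have f1: "(\<lambda>n. fst (p (\<sigma> n))) \<longlonglongrightarrow> fst q" and f2: "(\<lambda>n. snd (p (\<sigma> n))) \<longlonglongrightarrow> snd q"
    using tendsto_fst[OF q(3)] tendsto_snd[OF q(3)] by (simp_all add: o_def)
  have iC: "isCont f x" for x using cont by (simp add: continuous_on_eq_continuous_at)
  have l1: "(\<lambda>n. norm (f (fst (p (\<sigma> n))) - f (snd (p (\<sigma> n))))) \<longlonglongrightarrow> norm (f (fst q) - f (snd q))"
    by (intro tendsto_intros isCont_tendsto_compose[OF iC] f1 f2)
  have l2: "(\<lambda>n. inverse (real (Suc (\<sigma> n))) * norm (fst (p (\<sigma> n)) - snd (p (\<sigma> n)))) \<longlonglongrightarrow> 0 * norm (fst q - snd q)"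
    by (intro tendsto_intros f1 f2 LIMSEQ_subseq_LIMSEQ[OF LIMSEQ_inverse_real_of_nat q(2), unfolded o_def])
  have "norm (f (fst q) - f (snd q)) \<le> 0 * norm (fst q - snd q)"
    by (rule LIMSEQ_le[OF l1 l2]) (use p in \<open>auto intro!: exI[of _ 0] less_imp_le\<close>)
  then have "fst q = snd q" using \<open>inj f\<close> by (simp add: inj_eq)
  obtain c d where cd: "c > 0" "d > 0"
    "\<And>x y. x \<in> ball (fst q) d \<Longrightarrow> y \<in> ball (fst q) d \<Longrightarrow> c * norm (x - y) \<le> norm (f x - f y)"
    using local_lower_Lipschitz[OF assms(1), of "fst q"] by metis
  have "\<forall>\<^sub>F n in sequentially. fst (p (\<sigma> n)) \<in> ball (fst q) d"
    "\<forall>\<^sub>F n in sequentially. snd (p (\<sigma> n)) \<in> ball (fst q) d"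
    using topological_tendstoD[OF f1, of "ball (fst q) d"] topological_tendstoD[OF f2, of "ball (fst q) d"]
      \<open>fst q = snd q\<close> cd by auto
  moreover have "\<forall>\<^sub>F n in sequentially. inverse (real (Suc (\<sigma> n))) < c"
    using order_tendstoD(2)[OF LIMSEQ_subseq_LIMSEQ[OF LIMSEQ_inverse_real_of_nat q(2)] cd(1)] by (simp add: o_def)
  ultimately have "\<forall>\<^sub>F n in sequentially. False"
  proof eventually_elim
    case (elim n)
    have "norm (f (fst (p (\<sigma> n))) - f (snd (p (\<sigma> n)))) < c * norm (fst (p (\<sigma> n)) - snd (p (\<sigma> n)))"
      using p(3)[of "\<sigma> n"] mult_right_mono[OF less_imp_le[OF elim(3)], of "norm (fst (p (\<sigma> n)) - snd (p (\<sigma> n)))"]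
      by (meson less_le_trans norm_ge_zero)
    then show False using cd(3)[OF elim(1) elim(2)] by simp
  qed
  then show False by simp
qed

lemma dirD_has_derivative:
  fixes f :: "real^2 \<Rightarrow> 'b::real_normed_vector"
  assumes "Cr_on (Suc (Suc r)) UNIV f"
  shows "(dirD h f has_derivative (\<lambda>k. \<Sum>e\<in>Basis. (h \<bullet> e) *\<^sub>R dirD k (partial_deriv e f) x)) (at x)"
  unfolding dirD_def[of h, abs_def] using assms
  by (intro has_derivative_sum has_derivative_scaleR_right Cr_on_1_has_derivative[of r] Cr_on_partial)

lemma continuous_on_dirD2:
  fixes f :: "real^2 \<Rightarrow> 'b::real_normed_vector"
  assumes "Cr_on (Suc (Suc r)) UNIV f"
  shows "continuous_on UNIV (\<lambda>x. \<Sum>e\<in>Basis. (h \<bullet> e) *\<^sub>R dirD k (partial_deriv e f) x)"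
  using assms by (intro continuous_intros continuous_on_dirD[of r] Cr_on_partial)

lemma norm_powr_has_derivative:
  fixes v :: "real^2 \<Rightarrow> real^2"
  assumes "(v has_derivative v') (at x)" "v x \<noteq> 0"
  shows "((\<lambda>x. c * norm (v x) powr \<alpha>) has_derivative
     (\<lambda>k. c * \<alpha> * norm (v x) powr (\<alpha> - 2) * (v x \<bullet> v' k))) (at x)"
proof -
  have nz: "norm (v x) > 0" using assms by simp
  have "((\<lambda>x. norm (v x)) has_derivative (\<lambda>k. (v x \<bullet> v' k) / norm (v x))) (at x)"
    using has_derivative_compose[OF assms(1) has_derivative_norm[OF assms(2)]]
    by (simp add: sgn_div_norm inner_commute divide_inverse mult.commute)
  note d = this
  have "((\<lambda>x. c * norm (v x) powr \<alpha>) has_derivative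
     (\<lambda>k. c * (norm (v x) powr \<alpha> * ((v x \<bullet> v' k) / norm (v x) * \<alpha> / norm (v x))))) (at x)"
    using nz by (auto intro!: derivative_eq_intros d simp: field_simps)
  moreover have "norm (v x) powr (\<alpha> - 2) = norm (v x) powr \<alpha> / (norm (v x))\<^sup>2"
    using nz by (simp add: powr_diff)
  ultimately show ?thesis using nz by (elim has_derivative_eq_rhs) (auto simp: field_simps power2_eq_square)
qed

subsection \<open>Covariances of second differences\<close>

lemma has_vector_derivative_inner:
  fixes a b :: "real \<Rightarrow> 'a::real_inner"
  assumes "(a has_vector_derivative a') (at s)" "(b has_vector_derivative b') (at s)"
  shows "((\<lambda>s. a s \<bullet> b s) has_real_derivative (a s \<bullet> b' + a' \<bullet> b s)) (at s)"
  using bounded_bilinear.has_vector_derivative[OF bounded_bilinear_inner assms]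
  by (simp add: has_real_derivative_iff_has_vector_derivative)

text \<open>The mean value theorem is applied to \<open>G (s + \<epsilon>) - G s\<close> and then to
  \<open>G1\<close>.\<close>

lemma second_difference_MVT:
  fixes G :: "real \<Rightarrow> real"
  assumes "0 < \<epsilon>"
    and "\<And>s. 0 \<le> s \<Longrightarrow> s \<le> 2 * \<epsilon> \<Longrightarrow> (G has_real_derivative G1 s) (at s)"
    and "\<And>s. 0 \<le> s \<Longrightarrow> s \<le> 2 * \<epsilon> \<Longrightarrow> (G1 has_real_derivative G2 s) (at s)"
  shows "\<exists>s. 0 \<le> s \<and> s \<le> 2 * \<epsilon> \<and> G (2 * \<epsilon>) - 2 * G \<epsilon> + G 0 = \<epsilon>\<^sup>2 * G2 s"
proof -
  have "((\<lambda>s. G (s + \<epsilon>) - G s) has_real_derivative G1 (s + \<epsilon>) - G1 s) (at s)" if "0 \<le> s" "s \<le> \<epsilon>" for s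
  proof -
    have "((\<lambda>s. G (s + \<epsilon>)) has_real_derivative G1 (s + \<epsilon>)) (at s)"
      using assms that by (simp add: DERIV_shift[symmetric])
    then show ?thesis using assms that by (intro DERIV_diff) auto
  qed
  then obtain x where x: "0 < x" "x < \<epsilon>" "(G (\<epsilon> + \<epsilon>) - G \<epsilon>) - (G (0 + \<epsilon>) - G 0) = (\<epsilon> - 0) * (G1 (x + \<epsilon>) - G1 x)"
    using MVT2[OF assms(1), of "\<lambda>s. G (s + \<epsilon>) - G s" "\<lambda>s. G1 (s + \<epsilon>) - G1 s"] by auto
  obtain y where y: "x < y" "y < x + \<epsilon>" "G1 (x + \<epsilon>) - G1 x = (x + \<epsilon> - x) * G2 y"
    using MVT2[of x "x + \<epsilon>" G1 G2] assms x by auto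
  show ?thesis using x y by (intro exI[of _ y]) (auto simp: power2_eq_square algebra_simps)
qed

lemma powr_mult_power_le:
  fixes \<rho> :: real
  assumes "0 < \<rho>"
  shows "\<rho> powr a * \<rho> ^ k = \<rho> powr (a + real k)"
  using assms by (simp add: powr_add powr_realpow)

text \<open>Two differences in \<open>s\<close> but only one in \<open>s'\<close>: third derivatives of the covariance give the
  decay exponent \<open>\<alpha> - 3\<close>, whose square is summable over the lattice since \<open>\<alpha> < 2\<close>.\<close>
lemma mixed_difference_bound:
  fixes p q p1 p2 q1 :: "real \<Rightarrow> real^2" and S S1 S2 S3 :: "real \<Rightarrow> real"
  assumes \<alpha>: "\<alpha> < 2" and \<epsilon>: "0 < \<epsilon>" and nn: "0 \<le> B" "0 \<le> C" "0 < r"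
    and p: "\<And>s. 0 \<le> s \<Longrightarrow> s \<le> 2 * \<epsilon> \<Longrightarrow> (p has_vector_derivative p1 s) (at s)"
    and p1: "\<And>s. 0 \<le> s \<Longrightarrow> s \<le> 2 * \<epsilon> \<Longrightarrow> (p1 has_vector_derivative p2 s) (at s)"
    and q: "\<And>s. 0 \<le> s \<Longrightarrow> s \<le> 2 * \<epsilon> \<Longrightarrow> (q has_vector_derivative q1 s) (at s)"
    and B: "\<And>s. 0 \<le> s \<Longrightarrow> s \<le> 2 * \<epsilon> \<Longrightarrow> norm (p1 s) \<le> B"
      "\<And>s. 0 \<le> s \<Longrightarrow> s \<le> 2 * \<epsilon> \<Longrightarrow> norm (p2 s) \<le> B"
      "\<And>s. 0 \<le> s \<Longrightarrow> s \<le> 2 * \<epsilon> \<Longrightarrow> norm (q1 s) \<le> B"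
    and r: "\<And>s s'. 0 \<le> s \<Longrightarrow> s \<le> 2 * \<epsilon> \<Longrightarrow> 0 \<le> s' \<Longrightarrow> s' \<le> 2 * \<epsilon> \<Longrightarrow> r \<le> norm (p s - q s') \<and> norm (p s - q s') \<le> D"
    and S: "\<And>y. 0 < y \<Longrightarrow> (S has_real_derivative S1 y) (at y)"
      "\<And>y. 0 < y \<Longrightarrow> (S1 has_real_derivative S2 y) (at y)"
      "\<And>y. 0 < y \<Longrightarrow> (S2 has_real_derivative S3 y) (at y)"
    and SB: "\<And>t. 0 < t \<Longrightarrow> t \<le> D \<Longrightarrow> \<bar>S1 (t\<^sup>2)\<bar> \<le> C * t powr (\<alpha> - 2)"
      "\<And>t. 0 < t \<Longrightarrow> t \<le> D \<Longrightarrow> \<bar>S2 (t\<^sup>2)\<bar> \<le> C * t powr (\<alpha> - 4)"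
      "\<And>t. 0 < t \<Longrightarrow> t \<le> D \<Longrightarrow> \<bar>S3 (t\<^sup>2)\<bar> \<le> C * t powr (\<alpha> - 6)"
  defines "\<psi> \<equiv> \<lambda>s s'. S ((norm (p s - q s'))\<^sup>2)"
  shows "\<bar>(\<psi> (2*\<epsilon>) 0 - 2 * \<psi> (2*\<epsilon>) \<epsilon> + \<psi> (2*\<epsilon>) (2*\<epsilon>)) - 2 * (\<psi> \<epsilon> 0 - 2 * \<psi> \<epsilon> \<epsilon> + \<psi> \<epsilon> (2*\<epsilon>))
     + (\<psi> 0 0 - 2 * \<psi> 0 \<epsilon> + \<psi> 0 (2*\<epsilon>))\<bar> \<le> 2 * (20 * C * B^3 + 6 * C * B\<^sup>2 * D) * \<epsilon>^3 * r powr (\<alpha> - 3)"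
proof -
  let ?K = "20 * C * B^3 + 6 * C * B\<^sup>2 * D"
  define y where "y s s' = (p s - q s') \<bullet> (p s - q s')" for s s'
  have ypos: "0 < y s s'" if "0 \<le> s" "s \<le> 2 * \<epsilon>" "0 \<le> s'" "s' \<le> 2 * \<epsilon>" for s s'
    using r[OF that] nn by (auto simp: y_def)
  define H1 where "H1 s s' = S1 (y s s') * (2 * ((p s - q s') \<bullet> p1 s))" for s s'
  define H where "H s s' = 4 * S2 (y s s') * ((p s - q s') \<bullet> p1 s)\<^sup>2
     + 2 * S1 (y s s') * (p1 s \<bullet> p1 s + (p s - q s') \<bullet> p2 s)" for s s'
  have \<psi>: "\<psi> s s' = S (y s s')" for s s' by (simp add: \<psi>_def y_def power2_norm_eq_inner)
  have dps: "((\<lambda>s. p s - q s') has_vector_derivative p1 s) (at s)" if "0 \<le> s" "s \<le> 2 * \<epsilon>" for s s'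
    using has_vector_derivative_diff[OF p[OF that] has_vector_derivative_const[of "q s'"]] by simp
  have dys: "((\<lambda>s. y s s') has_real_derivative 2 * ((p s - q s') \<bullet> p1 s)) (at s)"
    if "0 \<le> s" "s \<le> 2 * \<epsilon>" for s s'
    unfolding y_def using has_vector_derivative_inner[OF dps[OF that, of s'] dps[OF that, of s']]
    by (elim DERIV_cong) (simp add: inner_commute)
  have d1: "((\<lambda>s. \<psi> s s') has_real_derivative H1 s s') (at s)"
    if "0 \<le> s" "s \<le> 2 * \<epsilon>" "0 \<le> s'" "s' \<le> 2 * \<epsilon>" for s s'
    unfolding \<psi> H1_def by (rule DERIV_chain2[OF S(1)[OF ypos[OF that]] dys[OF that(1,2)]])
  have d2: "((\<lambda>s. H1 s s') has_real_derivative H s s') (at s)"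
    if "0 \<le> s" "s \<le> 2 * \<epsilon>" "0 \<le> s'" "s' \<le> 2 * \<epsilon>" for s s'
    unfolding H1_def
    by (rule DERIV_cong[OF DERIV_mult[OF DERIV_chain2[OF S(2)[OF ypos[OF that]] dys[OF that(1,2)]]
          DERIV_cmult[OF has_vector_derivative_inner[OF dps[OF that(1,2), of s'] p1[OF that(1,2)]], of 2]]])
       (simp add: H_def power2_eq_square algebra_simps)
  have dq: "((\<lambda>s'. p s - q s') has_vector_derivative - q1 s') (at s')" if "0 \<le> s'" "s' \<le> 2 * \<epsilon>" for s s'
    using has_vector_derivative_diff[OF has_vector_derivative_const[of "p s"] q[OF that]] by simp
  have dyq: "((\<lambda>s'. y s s') has_real_derivative - 2 * ((p s - q s') \<bullet> q1 s')) (at s')"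
    if "0 \<le> s'" "s' \<le> 2 * \<epsilon>" for s s'
    unfolding y_def using has_vector_derivative_inner[OF dq[OF that, of s] dq[OF that, of s]]
    by (elim DERIV_cong) (simp add: inner_commute)
  have inner_const: "((\<lambda>s'. (p s - q s') \<bullet> c) has_real_derivative - (q1 s' \<bullet> c)) (at s')"
    if "0 \<le> s'" "s' \<le> 2 * \<epsilon>" for s s' c
    using has_vector_derivative_inner[OF dq[OF that, of s] has_vector_derivative_const[of c]] by simp
  \<comment> \<open>The \<open>s'\<close>-derivative of \<open>H\<close>, hence a mixed derivative
    of order three, two in \<open>s\<close> and one in \<open>s'\<close>.\<close>
  define H3 where "H3 s s' = 4 * (S3 (y s s') * (- 2 * ((p s - q s') \<bullet> q1 s'))) * ((p s - q s') \<bullet> p1 s)\<^sup>2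
     + 4 * S2 (y s s') * (2 * ((p s - q s') \<bullet> p1 s) * - (q1 s' \<bullet> p1 s))
     + 2 * (S2 (y s s') * (- 2 * ((p s - q s') \<bullet> q1 s'))) * (p1 s \<bullet> p1 s + (p s - q s') \<bullet> p2 s)
     + 2 * S1 (y s s') * (- (q1 s' \<bullet> p2 s))" for s s'
  have d3: "((\<lambda>s'. H s s') has_real_derivative H3 s s') (at s')"
    if "0 \<le> s" "s \<le> 2 * \<epsilon>" "0 \<le> s'" "s' \<le> 2 * \<epsilon>" for s s'
  proof -
    note a = DERIV_chain2[OF S(3)[OF ypos[OF that]] dyq[OF that(3,4)]]
      and b = DERIV_chain2[OF S(2)[OF ypos[OF that]] dyq[OF that(3,4)]]
      and c = inner_const[OF that(3,4), of s "p1 s"] inner_const[OF that(3,4), of s "p2 s"]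
    show ?thesis unfolding H_def
      by (rule DERIV_cong[OF DERIV_add[OF DERIV_mult[OF DERIV_cmult[OF a, of 4] DERIV_power[OF c(1), of 2]]
           DERIV_mult[OF DERIV_cmult[OF b, of 2] DERIV_add[OF DERIV_const[of "p1 s \<bullet> p1 s"] c(2)]]]])
         (simp add: H3_def algebra_simps)
  qed
  have H3: "\<bar>H3 s s'\<bar> \<le> ?K * r powr (\<alpha> - 3)"
    if s: "0 \<le> s" "s \<le> 2 * \<epsilon>" "0 \<le> s'" "s' \<le> 2 * \<epsilon>" for s s'
  proof -
    define \<rho> where "\<rho> = norm (p s - q s')"
    have \<rho>: "0 < \<rho>" "r \<le> \<rho>" "\<rho> \<le> D" using r[OF s] nn by (auto simp: \<rho>_def)
    have y\<rho>: "y s s' = \<rho>\<^sup>2" by (simp add: y_def \<rho>_def power2_norm_eq_inner)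
    have in1: "\<bar>(p s - q s') \<bullet> z\<bar> \<le> \<rho> * B" if "norm z \<le> B" for z
      using Cauchy_Schwarz_ineq2[of "p s - q s'" z] mult_left_mono[OF that, of \<rho>] \<rho>(1) unfolding \<rho>_def by linarith
    have in2: "\<bar>w \<bullet> z\<bar> \<le> B * B" if "norm z \<le> B" "norm w \<le> B" for z w :: "real^2"
      using Cauchy_Schwarz_ineq2[of w z] mult_mono[OF that(2) that(1)] nn by simp
    note b1 = B(1)[OF s(1,2)] and b2 = B(2)[OF s(1,2)] and b3 = B(3)[OF s(3,4)]
    have sq: "\<bar>((p s - q s') \<bullet> p1 s)\<^sup>2\<bar> \<le> (\<rho> * B)\<^sup>2"
      using power_mono[OF in1[OF b1] abs_ge_zero, of 2] by simp
    have sm: "\<bar>p1 s \<bullet> p1 s + (p s - q s') \<bullet> p2 s\<bar> \<le> B * B + \<rho> * B"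
      using in1[OF b2] in2[OF b1 b1] by linarith
    have t1: "\<bar>4 * (S3 (\<rho>\<^sup>2) * (- 2 * ((p s - q s') \<bullet> q1 s'))) * ((p s - q s') \<bullet> p1 s)\<^sup>2\<bar>
       \<le> 4 * ((C * \<rho> powr (\<alpha> - 6)) * (2 * (\<rho> * B))) * (\<rho> * B)\<^sup>2"
      unfolding abs_mult using SB(3)[OF \<rho>(1,3)] in1[OF b3] sq nn \<rho> by (intro mult_mono) auto
    have t2: "\<bar>4 * S2 (\<rho>\<^sup>2) * (2 * ((p s - q s') \<bullet> p1 s) * - (q1 s' \<bullet> p1 s))\<bar>
       \<le> 4 * (C * \<rho> powr (\<alpha> - 4)) * (2 * (\<rho> * B) * (B * B))"
      unfolding abs_mult using SB(2)[OF \<rho>(1,3)] in1[OF b1] in2[OF b1 b3] nn \<rho> by (intro mult_mono) auto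
    have t3: "\<bar>2 * (S2 (\<rho>\<^sup>2) * (- 2 * ((p s - q s') \<bullet> q1 s'))) * (p1 s \<bullet> p1 s + (p s - q s') \<bullet> p2 s)\<bar>
       \<le> 2 * ((C * \<rho> powr (\<alpha> - 4)) * (2 * (\<rho> * B))) * (B * B + \<rho> * B)"
      unfolding abs_mult using SB(2)[OF \<rho>(1,3)] in1[OF b3] sm nn \<rho> by (intro mult_mono) auto
    have t4: "\<bar>2 * S1 (\<rho>\<^sup>2) * (- (q1 s' \<bullet> p2 s))\<bar> \<le> 2 * (C * \<rho> powr (\<alpha> - 2)) * (B * B)"
      unfolding abs_mult using SB(1)[OF \<rho>(1,3)] in2[OF b2 b3] nn \<rho> by (intro mult_mono) auto
    have e: "\<rho> powr (\<alpha> - 6) * \<rho> ^ 3 = \<rho> powr (\<alpha> - 3)" "\<rho> powr (\<alpha> - 4) * \<rho> = \<rho> powr (\<alpha> - 3)"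
        "\<rho> powr (\<alpha> - 2) = \<rho> powr (\<alpha> - 3) * \<rho>"
      using powr_mult_power_le[OF \<rho>(1), of "\<alpha> - 6" 3] powr_mult_power_le[OF \<rho>(1), of "\<alpha> - 4" 1]
        powr_mult_power_le[OF \<rho>(1), of "\<alpha> - 3" 1] by simp_all
    have "\<bar>H3 s s'\<bar> \<le> 4 * ((C * \<rho> powr (\<alpha> - 6)) * (2 * (\<rho> * B))) * (\<rho> * B)\<^sup>2
       + 4 * (C * \<rho> powr (\<alpha> - 4)) * (2 * (\<rho> * B) * (B * B))
       + 2 * ((C * \<rho> powr (\<alpha> - 4)) * (2 * (\<rho> * B))) * (B * B + \<rho> * B)
       + 2 * (C * \<rho> powr (\<alpha> - 2)) * (B * B)"
      unfolding H3_def y\<rho> using t1 t2 t3 t4 by linarith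
    \<comment> \<open>With \<rho> for the distance, every term is \<rho> to the power
      \<open>\<alpha> - 3\<close>, possibly times one surplus \<rho> that is bounded by
      \<open>D\<close> below. The coefficients add up to 8 + 8 + 4 = 20 and 4 + 2 = 6.\<close>
    also have "\<dots> = 8 * C * B^3 * (\<rho> powr (\<alpha> - 6) * \<rho> ^ 3) + 8 * C * B^3 * (\<rho> powr (\<alpha> - 4) * \<rho>)
       + 4 * C * B\<^sup>2 * (B + \<rho>) * (\<rho> powr (\<alpha> - 4) * \<rho>) + 2 * C * B\<^sup>2 * \<rho> powr (\<alpha> - 2)"
      by (simp add: power2_eq_square power3_eq_cube algebra_simps)
    also have "\<dots> = (20 * C * B^3 + 6 * C * B\<^sup>2 * \<rho>) * \<rho> powr (\<alpha> - 3)"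
      unfolding e by (simp add: power2_eq_square power3_eq_cube algebra_simps)
    also have "\<dots> \<le> ?K * r powr (\<alpha> - 3)"
      using nn \<rho> \<alpha> by (intro mult_mono add_left_mono mult_left_mono powr_mono2') auto
    finally show ?thesis .
  qed
  define G where "G s = \<psi> s 0 - 2 * \<psi> s \<epsilon> + \<psi> s (2*\<epsilon>)" for s
  have "\<exists>s. 0 \<le> s \<and> s \<le> 2 * \<epsilon> \<and> G (2 * \<epsilon>) - 2 * G \<epsilon> + G 0 = \<epsilon>\<^sup>2 * (H s 0 - 2 * H s \<epsilon> + H s (2*\<epsilon>))"
    unfolding G_def
    by (rule second_difference_MVT[OF \<epsilon>, of _ "\<lambda>s. H1 s 0 - 2 * H1 s \<epsilon> + H1 s (2*\<epsilon>)"])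
       (use \<epsilon> in \<open>auto intro!: DERIV_add DERIV_diff DERIV_cmult d1 d2\<close>)
  then obtain s where s: "0 \<le> s" "s \<le> 2 * \<epsilon>"
    and eq: "G (2 * \<epsilon>) - 2 * G \<epsilon> + G 0 = \<epsilon>\<^sup>2 * (H s 0 - 2 * H s \<epsilon> + H s (2*\<epsilon>))" by auto
  \<comment> \<open>The second difference in \<open>s'\<close> is a difference of two first
    differences, each estimated separately. It contributes one factor \<epsilon>, after the two from
    the differences in \<open>s\<close>.\<close>
  have Hd: "\<bar>H s (x + \<epsilon>) - H s x\<bar> \<le> \<epsilon> * (?K * r powr (\<alpha> - 3))" if "0 \<le> x" "x \<le> \<epsilon>" for x
  proof -
    have "\<exists>z>x. z < x + \<epsilon> \<and> H s (x + \<epsilon>) - H s x = (x + \<epsilon> - x) * H3 s z"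
      by (rule MVT2) (use that \<epsilon> in \<open>auto intro!: d3[OF s]\<close>)
    then obtain z where z: "x < z" "z < x + \<epsilon>" "H s (x + \<epsilon>) - H s x = (x + \<epsilon> - x) * H3 s z"
      by auto
    then show ?thesis using H3[OF s, of z] that \<epsilon> by (simp add: abs_mult)
  qed
  have "\<bar>H s 0 - 2 * H s \<epsilon> + H s (2*\<epsilon>)\<bar> \<le> 2 * (\<epsilon> * (?K * r powr (\<alpha> - 3)))"
    using Hd[of 0] Hd[of \<epsilon>] \<epsilon> unfolding mult_2[of \<epsilon>] by simp
  then have "\<bar>G (2 * \<epsilon>) - 2 * G \<epsilon> + G 0\<bar> \<le> \<epsilon>\<^sup>2 * (2 * (\<epsilon> * (?K * r powr (\<alpha> - 3))))"
    unfolding eq abs_mult by (intro mult_mono) auto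
  then show ?thesis by (simp add: G_def power2_eq_square power3_eq_cube algebra_simps)
qed

text \<open>The covariance of the second differences at \<open>w\<close> and \<open>w'\<close>, with
  step \<open>\<epsilon> h\<close>, of a field with covariance \<open>R (|f x - f y|)\<close>,
  expressed without any random variables.\<close>

definition sdiff_cov :: "(real \<Rightarrow> real) \<Rightarrow> (real^2 \<Rightarrow> real^2) \<Rightarrow> real^2 \<Rightarrow> real \<Rightarrow> real^2 \<Rightarrow> real^2 \<Rightarrow> real" where
  "sdiff_cov R f h \<epsilon> w w' = (let \<psi> = (\<lambda>s s'. R (norm (f (w + s *\<^sub>R h) - f (w' + s' *\<^sub>R h)))) in
     (\<psi> (2*\<epsilon>) 0 - 2 * \<psi> (2*\<epsilon>) \<epsilon> + \<psi> (2*\<epsilon>) (2*\<epsilon>)) - 2 * (\<psi> \<epsilon> 0 - 2 * \<psi> \<epsilon> \<epsilon> + \<psi> \<epsilon> (2*\<epsilon>))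
     + (\<psi> 0 0 - 2 * \<psi> 0 \<epsilon> + \<psi> 0 (2*\<epsilon>)))"

text \<open>The derivative is monotone, but in a direction that depends on whether \<alpha> exceeds
  1. The sum of its powers at both endpoints covers both cases.\<close>

lemma powr_Lipschitz:
  fixes a b m M \<alpha> :: real
  assumes "0 < m" "0 < \<alpha>" "m \<le> a" "a \<le> M" "m \<le> b" "b \<le> M"
  shows "\<bar>a powr \<alpha> - b powr \<alpha>\<bar> \<le> \<alpha> * (m powr (\<alpha> - 1) + M powr (\<alpha> - 1)) * \<bar>a - b\<bar>"
  using assms
proof (induction a b rule: linorder_wlog)
  case (le a b)
  show ?case
  proof (cases "a = b")
    case False
    then obtain z where z: "a < z" "z < b" "b powr \<alpha> - a powr \<alpha> = (b - a) * (\<alpha> * z powr (\<alpha> - 1))"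
      using le MVT2[of a b "\<lambda>x. x powr \<alpha>" "\<lambda>x. \<alpha> * x powr (\<alpha> - 1)"]
        has_real_derivative_powr[of _ \<alpha>] by fastforce
    have "z powr (\<alpha> - 1) \<le> m powr (\<alpha> - 1) + M powr (\<alpha> - 1)"
    proof (cases "\<alpha> \<ge> 1")
      case True
      then have "z powr (\<alpha> - 1) \<le> M powr (\<alpha> - 1)" using z le by (intro powr_mono2) auto
      then show ?thesis by (smt (verit) powr_ge_zero)
    next
      case False
      then have "z powr (\<alpha> - 1) \<le> m powr (\<alpha> - 1)" using z le by (intro powr_mono2') auto
      then show ?thesis by (smt (verit) powr_ge_zero)
    qed
    then have "(b - a) * (\<alpha> * z powr (\<alpha> - 1)) \<le> (b - a) * (\<alpha> * (m powr (\<alpha> - 1) + M powr (\<alpha> - 1)))"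
      using le assms by (intro mult_left_mono) auto
    moreover have "0 \<le> (b - a) * (\<alpha> * z powr (\<alpha> - 1))" using le assms by auto
    ultimately have "\<bar>a powr \<alpha> - b powr \<alpha>\<bar> \<le> (b - a) * (\<alpha> * (m powr (\<alpha> - 1) + M powr (\<alpha> - 1)))"
      using z(3) by linarith
    then show ?thesis using le by (simp add: mult.commute)
  qed simp
next
  case (sym a b)
  then show ?case by (simp add: abs_minus_commute)
qed

text \<open>The second derivative of \<open>f (x + s h)\<close> in \<open>s\<close> at 0.\<close>

definition dirD2 :: "real^2 \<Rightarrow> (real^2 \<Rightarrow> 'b::real_normed_vector) \<Rightarrow> real^2 \<Rightarrow> 'b" where
  "dirD2 h f x = (\<Sum>e\<in>Basis. (h \<bullet> e) *\<^sub>R dirD h (partial_deriv e f) x)"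

section \<open>Second differences along a line seen through the diffeomorphism\<close>

lemma line_has_vector_derivative:
  assumes "(F has_derivative F') (at (w + s *\<^sub>R h))"
  shows "((\<lambda>s. F (w + s *\<^sub>R h)) has_vector_derivative F' h) (at s)"
proof -
  have "((\<lambda>s::real. w + s *\<^sub>R h) has_derivative (\<lambda>s. s *\<^sub>R h)) (at s)"
    by (auto intro!: derivative_eq_intros)
  from has_derivative_compose[OF this assms] show ?thesis
    using has_derivative_linear[OF assms] by (simp add: has_vector_derivative_def linear_cmul)
qed

lemma norm_diff_le_of_vector_derivative:
  fixes p :: "real \<Rightarrow> 'a::real_normed_vector"
  assumes "a \<le> b" "0 \<le> B"
    and "\<And>s. a \<le> s \<Longrightarrow> s \<le> b \<Longrightarrow> (p has_vector_derivative p' s) (at s)"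
    and "\<And>s. a \<le> s \<Longrightarrow> s \<le> b \<Longrightarrow> norm (p' s) \<le> B"
  shows "norm (p b - p a) \<le> B * (b - a)"
proof -
  have "norm (p b - p a) \<le> B * norm (b - a)"
  proof (rule differentiable_bound[of "{a..b}" p "\<lambda>s t. t *\<^sub>R p' s"])
    show "(p has_derivative (\<lambda>t. t *\<^sub>R p' s)) (at s within {a..b})" if "s \<in> {a..b}" for s
      using assms(3)[of s] that has_derivative_at_withinI by (auto simp: has_vector_derivative_def)
    show "onorm (\<lambda>t. t *\<^sub>R p' s) \<le> B" if "s \<in> {a..b}" for s
    proof (rule onorm_bound)
      show "norm (t *\<^sub>R p' s) \<le> B * norm t" for t
        using mult_left_mono[OF assms(4)[of s], of "\<bar>t\<bar>"] that by (simp add: mult.commute)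
    qed fact
  qed (use assms in auto)
  then show ?thesis using assms by simp
qed

lemma continuous_bounded_on_cball:
  fixes F :: "real^2 \<Rightarrow> 'b::real_normed_vector"
  assumes "continuous_on UNIV F"
  obtains B where "0 < B" "\<And>x. x \<in> cball 0 r \<Longrightarrow> norm (F x) \<le> B"
proof -
  have "bounded (F ` cball 0 r)"
    by (intro compact_imp_bounded compact_continuous_image continuous_on_subset[OF assms]) auto
  then obtain B where "0 < B" "\<forall>x\<in>F ` cball 0 r. norm x \<le> B" by (auto simp: bounded_pos)
  then show thesis by (intro that[of B]) auto
qed

text \<open>The ball is enlarged by \<open>2 |h|\<close> because a second difference at
  \<open>w\<close> reaches as far as \<open>w + 2 \<epsilon> h\<close> with
  \<open>\<epsilon> \<le> 1\<close>.\<close>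

locale diffeo_line =
  fixes f :: "real^2 \<Rightarrow> real^2" and h :: "real^2" and \<rho> B m :: real
  assumes f: "Cr_diffeo 3 f" and h: "h \<noteq> 0" and \<rho>: "0 \<le> \<rho>"
    and B0: "0 < B" and B1: "\<And>x. x \<in> cball 0 (\<rho> + 2 * norm h) \<Longrightarrow> norm (dirD h f x) \<le> B"
    and B2: "\<And>x. x \<in> cball 0 (\<rho> + 2 * norm h) \<Longrightarrow> norm (dirD2 h f x) \<le> B"
    and m0: "0 < m" and m: "\<And>x. x \<in> cball 0 (\<rho> + 2 * norm h) \<Longrightarrow> m \<le> norm (dirD h f x)"
begin

lemma Cr: "Cr_on (Suc (Suc (Suc 0))) UNIV f"
  using f by (simp add: Cr_diffeo_def numeral_3_eq_3)

lemma on_line: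
  assumes "w \<in> cball 0 \<rho>" "0 \<le> s" "s \<le> 2"
  shows "w + s *\<^sub>R h \<in> cball 0 (\<rho> + 2 * norm h)"
  using assms norm_triangle_ineq[of w "s *\<^sub>R h"] mult_right_mono[of s 2 "norm h"] by auto

lemma line1: "((\<lambda>s. f (w + s *\<^sub>R h)) has_vector_derivative dirD h f (w + s *\<^sub>R h)) (at s)"
  by (intro line_has_vector_derivative[where F'="\<lambda>k. dirD k f (w + s *\<^sub>R h)"] Cr_on_1_has_derivative[OF Cr])

lemma line2: "((\<lambda>s. dirD h f (w + s *\<^sub>R h)) has_vector_derivative dirD2 h f (w + s *\<^sub>R h)) (at s)"
  unfolding dirD2_def
  by (intro line_has_vector_derivative[where F="dirD h f" and F'="\<lambda>k. (\<Sum>e\<in>Basis. (h \<bullet> e) *\<^sub>R dirD k (partial_deriv e f) (w + s *\<^sub>R h))"]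
     dirD_has_derivative[OF Cr])

text \<open>The factor \<open>\<epsilon>^3\<close> of the mixed difference bound and the
  normalization combine to \<open>\<epsilon>^(3 - \<alpha>)\<close>. So the bound depends only on
  the distance measured in units of \<epsilon>, uniformly in the mesh.\<close>

lemma sdiff_cov_far:
  assumes \<alpha>: "0 < \<alpha>" "\<alpha> < 2" and "0 < t0" "0 \<le> c"
    and R0: "\<And>t. 0 < t \<Longrightarrow> t \<le> t0 \<Longrightarrow> \<bar>R t - r0\<bar> \<le> c * t powr \<alpha>"
    and R4: "\<And>t. 0 < t \<Longrightarrow> t \<le> t0 \<Longrightarrow> \<bar>(deriv ^^ 4) R t\<bar> \<le> c * t powr (\<alpha> - 4)"
    and CrR: "Cr_on 4 {0<..} R"
  obtains K where "0 \<le> K" "\<And>\<epsilon> w w'. 0 < \<epsilon> \<Longrightarrow> \<epsilon> \<le> 1 \<Longrightarrow> w \<in> cball 0 \<rho> \<Longrightarrow> w' \<in> cball 0 \<rho> \<Longrightarrow>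
     4 * norm h * \<epsilon> \<le> norm (w - w') \<Longrightarrow>
     \<bar>\<epsilon> powr (-\<alpha>) * sdiff_cov R f h \<epsilon> w w'\<bar> \<le> K * (norm (w - w') / \<epsilon>) powr (\<alpha> - 3)"
proof -
  let ?D0 = "cball 0 (\<rho> + 2 * norm h) :: (real^2) set"
  obtain F where F: "0 < F" "\<And>x. x \<in> ?D0 \<Longrightarrow> norm (f x) \<le> F"
    by (rule continuous_bounded_on_cball[OF Cr_on_continuous[OF Cr]]) auto
  obtain l where l: "l > 0" "\<And>x y. x \<in> ?D0 \<Longrightarrow> y \<in> ?D0 \<Longrightarrow> l * norm (x - y) \<le> norm (f x - f y)"
    by (rule Cr_diffeo_lower_Lipschitz[of 2 f ?D0]) (use f in \<open>auto simp: numeral_3_eq_3 numeral_2_eq_2\<close>)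
  obtain C S1 S2 S3 where C: "0 \<le> C"
    and S: "\<And>y. 0 < y \<Longrightarrow> ((\<lambda>y. R (sqrt y)) has_real_derivative S1 y) (at y)"
      "\<And>y. 0 < y \<Longrightarrow> (S1 has_real_derivative S2 y) (at y)"
      "\<And>y. 0 < y \<Longrightarrow> (S2 has_real_derivative S3 y) (at y)"
    and SB: "\<And>t. 0 < t \<Longrightarrow> t \<le> 2 * F \<Longrightarrow> \<bar>S1 (t\<^sup>2)\<bar> \<le> C * t powr (\<alpha> - 2)"
      "\<And>t. 0 < t \<Longrightarrow> t \<le> 2 * F \<Longrightarrow> \<bar>S2 (t\<^sup>2)\<bar> \<le> C * t powr (\<alpha> - 4)"
      "\<And>t. 0 < t \<Longrightarrow> t \<le> 2 * F \<Longrightarrow> \<bar>S3 (t\<^sup>2)\<bar> \<le> C * t powr (\<alpha> - 6)"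
    by (rule covariance_sqrt_bounds[OF assms(1-4) mult_pos_pos[OF zero_less_numeral F(1)] R0 R4 CrR];
       (assumption | (rule that, assumption+)))
  let ?K = "2 * (20 * C * B^3 + 6 * C * B\<^sup>2 * (2 * F))"
  show thesis
  proof (rule that[of "?K * (l / 2) powr (\<alpha> - 3)"])
    show "0 \<le> ?K * (l / 2) powr (\<alpha> - 3)" using C B0 F by auto
    fix \<epsilon> and w w' :: "real^2" assume \<epsilon>: "0 < \<epsilon>" "\<epsilon> \<le> 1" and w: "w \<in> cball 0 \<rho>" "w' \<in> cball 0 \<rho>"
      and far: "4 * norm h * \<epsilon> \<le> norm (w - w')"
    let ?d = "norm (w - w')"
    have dpos: "0 < ?d" using far h \<epsilon> by (metis less_le_trans mult_pos_pos zero_less_norm_iff zero_less_numeral)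
    have lower: "l / 2 * ?d \<le> norm (f (w + s *\<^sub>R h) - f (w' + s' *\<^sub>R h)) \<and> norm (f (w + s *\<^sub>R h) - f (w' + s' *\<^sub>R h)) \<le> 2 * F"
      if s: "0 \<le> s" "s \<le> 2 * \<epsilon>" "0 \<le> s'" "s' \<le> 2 * \<epsilon>" for s s'
    proof
      have D: "w + s *\<^sub>R h \<in> ?D0" "w' + s' *\<^sub>R h \<in> ?D0" using on_line w s \<epsilon> by auto
      \<comment> \<open>Moving along both segments changes the difference by at most
        \<open>2 \<epsilon> |h|\<close>, which is at most half of \<open>|w - w'|\<close>; this is
        the reason for the factor 4 in the separation condition.\<close>
      have "w - w' = ((w + s *\<^sub>R h) - (w' + s' *\<^sub>R h)) + (s' - s) *\<^sub>R h" by (simp add: algebra_simps)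
      then have "?d \<le> norm ((w + s *\<^sub>R h) - (w' + s' *\<^sub>R h)) + norm ((s' - s) *\<^sub>R h)"
        by (metis norm_triangle_ineq)
      moreover have "norm ((s' - s) *\<^sub>R h) \<le> 2 * \<epsilon> * norm h"
        using s by (auto intro!: mult_right_mono)
      ultimately have "?d / 2 \<le> norm ((w + s *\<^sub>R h) - (w' + s' *\<^sub>R h))" using far by (simp add: algebra_simps)
      then have "l * (?d / 2) \<le> l * norm ((w + s *\<^sub>R h) - (w' + s' *\<^sub>R h))" using l(1) by (intro mult_left_mono) auto
      then show "l / 2 * ?d \<le> norm (f (w + s *\<^sub>R h) - f (w' + s' *\<^sub>R h))" using l(2)[OF D] by simp
      show "norm (f (w + s *\<^sub>R h) - f (w' + s' *\<^sub>R h)) \<le> 2 * F"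
        using norm_triangle_ineq4[of "f (w + s *\<^sub>R h)" "f (w' + s' *\<^sub>R h)"] F(2)[OF D(1)] F(2)[OF D(2)] by linarith
    qed
    have bd: "norm (dirD h f (z + s *\<^sub>R h)) \<le> B" "norm (dirD2 h f (z + s *\<^sub>R h)) \<le> B"
      if "0 \<le> s" "s \<le> 2 * \<epsilon>" "z \<in> cball 0 \<rho>" for s z
      using that \<epsilon> by (auto intro!: B1 B2 on_line)
    have "\<bar>sdiff_cov R f h \<epsilon> w w'\<bar> \<le> ?K * \<epsilon>^3 * (l / 2 * ?d) powr (\<alpha> - 3)"
      unfolding sdiff_cov_def Let_def
      using mixed_difference_bound[where p="\<lambda>s. f (w + s *\<^sub>R h)" and q="\<lambda>s. f (w' + s *\<^sub>R h)"
         and ?p1.0="\<lambda>s. dirD h f (w + s *\<^sub>R h)" and ?p2.0="\<lambda>s. dirD2 h f (w + s *\<^sub>R h)"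
         and ?q1.0="\<lambda>s. dirD h f (w' + s *\<^sub>R h)" and r="l / 2 * ?d",
         OF \<alpha>(2) \<epsilon>(1) less_imp_le[OF B0] C _ line1 line2 line1 bd(1)[OF _ _ w(1)] bd(2)[OF _ _ w(1)] bd(1)[OF _ _ w(2)]
           lower S SB] dpos l(1)
      by simp
    then have "\<epsilon> powr (-\<alpha>) * \<bar>sdiff_cov R f h \<epsilon> w w'\<bar> \<le> \<epsilon> powr (-\<alpha>) * (?K * \<epsilon>^3 * (l / 2 * ?d) powr (\<alpha> - 3))"
      by (intro mult_left_mono) auto
    also have "(l / 2 * ?d) powr (\<alpha> - 3) = (l / 2) powr (\<alpha> - 3) * ?d powr (\<alpha> - 3)"
      by (rule powr_mult)
    also have "\<epsilon> powr (-\<alpha>) * (?K * \<epsilon>^3 * ((l / 2) powr (\<alpha> - 3) * ?d powr (\<alpha> - 3)))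
      = ?K * (l / 2) powr (\<alpha> - 3) * (?d powr (\<alpha> - 3) * (\<epsilon> powr (-\<alpha>) * \<epsilon>^3))" by (simp only: mult_ac)
    also have "\<epsilon> powr (-\<alpha>) * \<epsilon>^3 = 1 / \<epsilon> powr (\<alpha> - 3)"
      using \<epsilon> by (simp add: powr_mult_power_le powr_minus_divide[symmetric])
    also have "?d powr (\<alpha> - 3) * (1 / \<epsilon> powr (\<alpha> - 3)) = (?d / \<epsilon>) powr (\<alpha> - 3)"
      using \<epsilon> by (simp add: powr_divide)
    finally show "\<bar>\<epsilon> powr (-\<alpha>) * sdiff_cov R f h \<epsilon> w w'\<bar> \<le> ?K * (l / 2) powr (\<alpha> - 3) * (?d / \<epsilon>) powr (\<alpha> - 3)"
      by (simp add: abs_mult)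
  qed
qed

text \<open>After subtraction of its linear part at \<open>w\<close>, the curve has derivative at
  most \<open>2 B \<epsilon>\<close>, by the bound on its second derivative over a parameter
  interval of length \<open>2 \<epsilon>\<close>.\<close>

lemma line_increment:
  assumes w: "w \<in> cball 0 \<rho>" and s: "0 \<le> r" "r \<le> s" "s \<le> 2 * \<epsilon>" and \<epsilon>: "0 < \<epsilon>" "\<epsilon> \<le> 1"
  shows "\<bar>norm (f (w + s *\<^sub>R h) - f (w + r *\<^sub>R h)) - (s - r) * norm (dirD h f w)\<bar> \<le> 2 * B * \<epsilon> * (s - r)"
proof -
  have "norm (dirD h f (w + z *\<^sub>R h) - dirD h f w) \<le> 2 * B * \<epsilon>" if z: "0 \<le> z" "z \<le> 2 * \<epsilon>" for z
  proof -
    have "norm (dirD h f (w + z *\<^sub>R h) - dirD h f (w + 0 *\<^sub>R h)) \<le> B * (z - 0)"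
      by (rule norm_diff_le_of_vector_derivative[OF z(1) _ line2])
         (use B2 on_line[OF w] z \<epsilon> B0 in auto)
    also have "\<dots> \<le> B * (2 * \<epsilon>)" using z B0 by (intro mult_left_mono) auto
    finally show ?thesis by (simp add: algebra_simps)
  qed
  then have "norm ((f (w + s *\<^sub>R h) - s *\<^sub>R dirD h f w) - (f (w + r *\<^sub>R h) - r *\<^sub>R dirD h f w)) \<le> 2 * B * \<epsilon> * (s - r)"
    by (intro norm_diff_le_of_vector_derivative[where p="\<lambda>z. f (w + z *\<^sub>R h) - z *\<^sub>R dirD h f w"
         and p'="\<lambda>z. dirD h f (w + z *\<^sub>R h) - dirD h f w"] s)
       (use s B0 \<epsilon> in \<open>auto intro!: derivative_eq_intros line1\<close>)
  moreover have "(f (w + s *\<^sub>R h) - s *\<^sub>R dirD h f w) - (f (w + r *\<^sub>R h) - r *\<^sub>R dirD h f w)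
     = (f (w + s *\<^sub>R h) - f (w + r *\<^sub>R h)) - (s - r) *\<^sub>R dirD h f w" by (simp add: algebra_simps)
  moreover have "\<bar>norm (f (w + s *\<^sub>R h) - f (w + r *\<^sub>R h)) - norm ((s - r) *\<^sub>R dirD h f w)\<bar>
     \<le> norm ((f (w + s *\<^sub>R h) - f (w + r *\<^sub>R h)) - (s - r) *\<^sub>R dirD h f w)" by (rule norm_triangle_ineq3)
  ultimately show ?thesis using s by simp
qed

text \<open>The weights 1, -2, 1 give 6 on the diagonal, -8 in total on distances near
  \<open>\<epsilon> |v|\<close> and 2 on the distance near \<open>2 \<epsilon> |v|\<close>, with
  \<open>v\<close> the derivative of \<open>f\<close> along \<open>h\<close>. They sum to 0, so
  \<open>R 0\<close> drops out, and the leading term is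
  \<open>(8 - 2 * 2^\<alpha>) |v|^\<alpha>\<close>.\<close>

lemma sdiff_cov_variance:
  assumes \<alpha>: "0 < \<alpha>" "\<alpha> < 2" and "0 < \<gamma>" "0 < t0"
    and R0: "\<And>t. 0 \<le> t \<Longrightarrow> t \<le> t0 \<Longrightarrow> \<bar>R t - (R 0 - t powr \<alpha>)\<bar> \<le> t powr (\<alpha> + \<gamma>)"
  obtains K \<epsilon>0 where "0 \<le> K" "0 < \<epsilon>0" "\<epsilon>0 \<le> 1" "\<And>\<epsilon> (w :: real^2). 0 < \<epsilon> \<Longrightarrow> \<epsilon> \<le> \<epsilon>0 \<Longrightarrow> w \<in> cball 0 \<rho> \<Longrightarrow>
     \<bar>\<epsilon> powr (-\<alpha>) * sdiff_cov R f h \<epsilon> w w - (8 - 2 powr (\<alpha> + 1)) * norm (dirD h f w) powr \<alpha>\<bar> \<le> K * (\<epsilon> + \<epsilon> powr \<gamma>)"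
proof -
  define L where "L = \<alpha> * ((m / 2) powr (\<alpha> - 1) + (6 * B) powr (\<alpha> - 1))"
  define K where "K = max (24 * L * B) (10 * (6 * B) powr (\<alpha> + \<gamma>))"
  have L: "0 \<le> L" using \<alpha> by (simp add: L_def)
  \<comment> \<open>The second entry keeps the rescaled distances above \<open>m / 2\<close>; the
    third keeps the distances themselves below \<open>t0\<close>, where the expansion of
    \<open>R\<close> holds.\<close>
  define \<epsilon>0 where "\<epsilon>0 = min 1 (min (m / (4 * B)) (t0 / (6 * B)))"
  show thesis
  proof (rule that[of K \<epsilon>0])
    show "0 \<le> K" unfolding K_def by (simp add: le_max_iff_disj)
    show "0 < \<epsilon>0" "\<epsilon>0 \<le> 1" using m0 B0 assms by (auto simp: \<epsilon>0_def)
    fix \<epsilon> and w :: "real^2" assume e: "0 < \<epsilon>" "\<epsilon> \<le> \<epsilon>0" and w: "w \<in> cball 0 \<rho>"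
    have \<epsilon>: "0 < \<epsilon>" "\<epsilon> \<le> 1" "2 * B * \<epsilon> \<le> m / 2" "6 * B * \<epsilon> \<le> t0"
      using e B0 by (auto simp: \<epsilon>0_def field_simps)
    let ?v = "norm (dirD h f w)"
    have w0: "w \<in> cball 0 (\<rho> + 2 * norm h)" using on_line[OF w, of 0] by simp
    have v: "m \<le> ?v" "?v \<le> B" using B1[OF w0] m[OF w0] by auto
    define d where "d s r = norm (f (w + s *\<^sub>R h) - f (w + r *\<^sub>R h))" for s r
    have d_sym: "d s r = d r s" "d s s = 0" for s r by (simp_all add: d_def norm_minus_commute)
    define a where "a s r = d s r / \<epsilon>" for s r
    have a1: "\<bar>a s r - ?v\<bar> \<le> 2 * B * \<epsilon>" if "0 \<le> r" "s = r + \<epsilon>" "s \<le> 2 * \<epsilon>" for r s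
    proof -
      have "\<bar>d s r - \<epsilon> * ?v\<bar> \<le> 2 * B * \<epsilon> * \<epsilon>"
        using line_increment[OF w that(1) _ that(3) \<epsilon>(1,2)] that \<epsilon> by (simp add: d_def)
      then have "\<bar>d s r - \<epsilon> * ?v\<bar> / \<epsilon> \<le> 2 * B * \<epsilon>" using \<epsilon> by (simp add: divide_simps)
      also have "\<bar>d s r - \<epsilon> * ?v\<bar> / \<epsilon> = \<bar>a s r - ?v\<bar>"
        using \<epsilon> by (subst abs_of_pos[OF \<epsilon>(1), symmetric], subst abs_divide[symmetric]) (simp add: a_def diff_divide_distrib)
      finally show ?thesis .
    qed
    have a2: "\<bar>a (2*\<epsilon>) 0 - 2 * ?v\<bar> \<le> 4 * B * \<epsilon>"
    proof -
      have "\<bar>d (2*\<epsilon>) 0 - \<epsilon> * (2 * ?v)\<bar> \<le> 4 * B * \<epsilon> * \<epsilon>"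
        using line_increment[OF w order_refl, of "2*\<epsilon>" \<epsilon>] \<epsilon> by (simp add: d_def algebra_simps)
      then have "\<bar>d (2*\<epsilon>) 0 - \<epsilon> * (2 * ?v)\<bar> / \<epsilon> \<le> 4 * B * \<epsilon>" using \<epsilon> by (simp add: divide_simps)
      also have "\<bar>d (2*\<epsilon>) 0 - \<epsilon> * (2 * ?v)\<bar> / \<epsilon> = \<bar>a (2*\<epsilon>) 0 - 2 * ?v\<bar>"
        using \<epsilon> by (subst abs_of_pos[OF \<epsilon>(1), symmetric], subst abs_divide[symmetric]) (simp add: a_def diff_divide_distrib)
      finally show ?thesis .
    qed
    \<comment> \<open>The largest rescaled distance is at most \<open>2 B + 4 B \<epsilon>\<close>,
      hence at most \<open>6 B\<close>, the upper end of the interval on which \<open>L\<close> is a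
      Lipschitz constant.\<close>
    have Be: "B * \<epsilon> \<le> B" using \<epsilon> B0 by (simp add: mult_left_le)
    have a01: "m / 2 \<le> a \<epsilon> 0" "a \<epsilon> 0 \<le> 6 * B" and a12: "m / 2 \<le> a (2*\<epsilon>) \<epsilon>" "a (2*\<epsilon>) \<epsilon> \<le> 6 * B"
      and a02: "m / 2 \<le> a (2*\<epsilon>) 0" "a (2*\<epsilon>) 0 \<le> 6 * B"
      using a1[of 0 \<epsilon>] a1[of \<epsilon> "2*\<epsilon>"] a2 v \<epsilon> Be m0 by auto
    have Lip: "\<bar>x powr \<alpha> - y powr \<alpha>\<bar> \<le> L * \<bar>x - y\<bar>" if "m/2 \<le> x" "x \<le> 6*B" "m/2 \<le> y" "y \<le> 6*B" for x y
      unfolding L_def using that m0 \<alpha> by (intro powr_Lipschitz) auto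
    have v6: "m/2 \<le> ?v" "?v \<le> 6*B" "m/2 \<le> 2 * ?v" "2 * ?v \<le> 6*B" using v m0 B0 by auto
    have l01: "\<bar>a \<epsilon> 0 powr \<alpha> - ?v powr \<alpha>\<bar> \<le> L * (2 * B * \<epsilon>)"
      using Lip[OF a01 v6(1,2)] mult_left_mono[OF a1[of 0 \<epsilon>] L] \<epsilon> by simp
    have l12: "\<bar>a (2*\<epsilon>) \<epsilon> powr \<alpha> - ?v powr \<alpha>\<bar> \<le> L * (2 * B * \<epsilon>)"
      using Lip[OF a12 v6(1,2)] mult_left_mono[OF a1[of \<epsilon> "2*\<epsilon>"] L] \<epsilon> by simp
    have l02: "\<bar>a (2*\<epsilon>) 0 powr \<alpha> - (2 * ?v) powr \<alpha>\<bar> \<le> L * (4 * B * \<epsilon>)"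
      using Lip[OF a02 v6(3,4)] mult_left_mono[OF a2 L] by simp
    define E where "E t = R t - (R 0 - t powr \<alpha>)" for t
    have E: "\<bar>\<epsilon> powr (-\<alpha>) * E (d s r)\<bar> \<le> (6 * B) powr (\<alpha> + \<gamma>) * \<epsilon> powr \<gamma>"
      and asc: "\<epsilon> powr (-\<alpha>) * d s r powr \<alpha> = a s r powr \<alpha>" if "a s r \<le> 6 * B" for s r
    proof -
      have dle: "d s r \<le> 6 * B * \<epsilon>" using that \<epsilon> by (simp add: a_def divide_simps)
      have d0: "0 \<le> d s r" by (simp add: d_def)
      have "\<bar>E (d s r)\<bar> \<le> d s r powr (\<alpha> + \<gamma>)" unfolding E_def by (rule R0) (use dle d0 \<epsilon> in auto)
      also have "\<dots> \<le> (6 * B * \<epsilon>) powr (\<alpha> + \<gamma>)" using dle d0 assms by (intro powr_mono2) auto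
      also have "\<dots> = (6 * B) powr (\<alpha> + \<gamma>) * (\<epsilon> powr \<alpha> * \<epsilon> powr \<gamma>)"
        by (simp add: powr_mult powr_add)
      finally have "\<epsilon> powr (-\<alpha>) * \<bar>E (d s r)\<bar> \<le> \<epsilon> powr (-\<alpha>) * ((6 * B) powr (\<alpha> + \<gamma>) * (\<epsilon> powr \<alpha> * \<epsilon> powr \<gamma>))"
        by (intro mult_left_mono) auto
      also have "\<dots> = (6 * B) powr (\<alpha> + \<gamma>) * \<epsilon> powr \<gamma>" using \<epsilon> by (simp add: powr_minus)
      finally show "\<bar>\<epsilon> powr (-\<alpha>) * E (d s r)\<bar> \<le> (6 * B) powr (\<alpha> + \<gamma>) * \<epsilon> powr \<gamma>" by (simp add: abs_mult)
      show "\<epsilon> powr (-\<alpha>) * d s r powr \<alpha> = a s r powr \<alpha>"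
        using \<epsilon> d0 by (simp add: a_def powr_divide powr_minus_divide)
    qed
    have "sdiff_cov R f h \<epsilon> w w = 6 * R 0 - 4 * R (d \<epsilon> 0) - 4 * R (d (2*\<epsilon>) \<epsilon>) + 2 * R (d (2*\<epsilon>) 0)"
      unfolding sdiff_cov_def Let_def d_def[symmetric]
      by (simp add: d_sym(2) d_sym(1)[of 0 \<epsilon>] d_sym(1)[of 0 "2*\<epsilon>"] d_sym(1)[of \<epsilon> "2*\<epsilon>"])
    also have "\<dots> = 4 * d \<epsilon> 0 powr \<alpha> + 4 * d (2*\<epsilon>) \<epsilon> powr \<alpha> - 2 * d (2*\<epsilon>) 0 powr \<alpha>
      - 4 * E (d \<epsilon> 0) - 4 * E (d (2*\<epsilon>) \<epsilon>) + 2 * E (d (2*\<epsilon>) 0)" by (simp add: E_def)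
    finally have eq: "sdiff_cov R f h \<epsilon> w w = \<dots>" .
    have "\<epsilon> powr (-\<alpha>) * sdiff_cov R f h \<epsilon> w w =
       4 * (\<epsilon> powr (-\<alpha>) * d \<epsilon> 0 powr \<alpha>) + 4 * (\<epsilon> powr (-\<alpha>) * d (2*\<epsilon>) \<epsilon> powr \<alpha>) - 2 * (\<epsilon> powr (-\<alpha>) * d (2*\<epsilon>) 0 powr \<alpha>)
      - 4 * (\<epsilon> powr (-\<alpha>) * E (d \<epsilon> 0)) - 4 * (\<epsilon> powr (-\<alpha>) * E (d (2*\<epsilon>) \<epsilon>)) + 2 * (\<epsilon> powr (-\<alpha>) * E (d (2*\<epsilon>) 0))"
      unfolding eq by (simp add: algebra_simps)
    moreover have "(8 - 2 powr (\<alpha> + 1)) * ?v powr \<alpha> = 8 * ?v powr \<alpha> - 2 * (2 * ?v) powr \<alpha>"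
      by (simp add: powr_mult powr_add algebra_simps)
    \<comment> \<open>Here 24 = 4 * 2 + 4 * 2 + 2 * 4 collects the errors of the distances, and 10 =
      4 + 4 + 2 those of the expansion of \<open>R\<close>.\<close>
    moreover have "\<bar>4 * x1 + 4 * x2 - 2 * x3 - 4 * e1 - 4 * e2 + 2 * e3 - (8 * v1 - 2 * v2)\<bar> \<le> 24 * p + 10 * q"
      if "\<bar>x1 - v1\<bar> \<le> 2 * p" "\<bar>x2 - v1\<bar> \<le> 2 * p" "\<bar>x3 - v2\<bar> \<le> 4 * p"
        "\<bar>e1\<bar> \<le> q" "\<bar>e2\<bar> \<le> q" "\<bar>e3\<bar> \<le> q" for x1 x2 x3 e1 e2 e3 v1 v2 p q :: real
      using that by (smt (verit))
    ultimately have "\<bar>\<epsilon> powr (-\<alpha>) * sdiff_cov R f h \<epsilon> w w - (8 - 2 powr (\<alpha> + 1)) * ?v powr \<alpha>\<bar>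
      \<le> 24 * (L * (B * \<epsilon>)) + 10 * ((6 * B) powr (\<alpha> + \<gamma>) * \<epsilon> powr \<gamma>)"
      using l01 l12 l02 E[OF a01(2)] E[OF a12(2)] E[OF a02(2)]
      unfolding asc[OF a01(2)] asc[OF a12(2)] asc[OF a02(2)] by (simp only: mult_ac)
    also have "\<dots> = (24 * L * B) * \<epsilon> + (10 * (6 * B) powr (\<alpha> + \<gamma>)) * \<epsilon> powr \<gamma>" by simp
    also have "\<dots> \<le> K * \<epsilon> + K * \<epsilon> powr \<gamma>"
      unfolding K_def using \<epsilon> by (intro add_mono mult_right_mono) auto
    finally show "\<bar>\<epsilon> powr (-\<alpha>) * sdiff_cov R f h \<epsilon> w w - (8 - 2 powr (\<alpha> + 1)) * ?v powr \<alpha>\<bar> \<le> K * (\<epsilon> + \<epsilon> powr \<gamma>)"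
      by (simp add: algebra_simps)
  qed
qed

end

lemma diffeo_line_exists:
  assumes "Cr_diffeo 3 f" "h \<noteq> 0" "0 \<le> \<rho>"
  obtains B m where "diffeo_line f h \<rho> B m"
proof -
  have Cr: "Cr_on (Suc (Suc (Suc 0))) UNIV f"
    using assms by (simp add: Cr_diffeo_def numeral_3_eq_3)
  let ?D = "cball 0 (\<rho> + 2 * norm h) :: (real^2) set"
  obtain B1 where B1: "0 < B1" "\<And>x. x \<in> ?D \<Longrightarrow> norm (dirD h f x) \<le> B1"
    by (rule continuous_bounded_on_cball[OF continuous_on_dirD[OF Cr]]) auto
  obtain B2 where B2: "0 < B2" "\<And>x. x \<in> ?D \<Longrightarrow> norm (dirD2 h f x) \<le> B2"
    by (rule continuous_bounded_on_cball[OF continuous_on_dirD2[OF Cr]]) (auto simp: dirD2_def)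
  have "continuous_on UNIV (\<lambda>x. norm (dirD h f x))"
    by (intro continuous_intros continuous_on_dirD[OF Cr])
  then have "continuous_on ?D (\<lambda>x. norm (dirD h f x))" by (rule continuous_on_subset) auto
  moreover have "?D \<noteq> {}" using assms(3) by (simp add: not_less)
  ultimately have "\<exists>x0\<in>?D. \<forall>x\<in>?D. norm (dirD h f x0) \<le> norm (dirD h f x)"
    by (intro continuous_attains_inf) auto
  then obtain x0 where x0: "\<And>x. x \<in> ?D \<Longrightarrow> norm (dirD h f x0) \<le> norm (dirD h f x)"
    by blast
  have "diffeo_line f h \<rho> (max B1 B2) (norm (dirD h f x0))"
    using assms B1 B2 x0 Cr_diffeo_dirD_nonzero[of 2 f h x0]
    by unfold_locales (auto simp: le_max_iff_disj numeral_3_eq_3 numeral_2_eq_2)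
  then show thesis by (rule that)
qed

subsection \<open>Lattice sums\<close>

text \<open>The mesh is an arbitrary real, since the same lattice serves as the observation grid, as
  that grid rescaled by the bandwidth, and as the net for the union bound.\<close>

definition lattice :: "real \<Rightarrow> (real^2) set" where
  "lattice \<epsilon> = (\<lambda>z. \<epsilon> *\<^sub>R z) ` {z. \<forall>i. z $ i \<in> \<int>}"

lemma grid_eq_lattice: "grid \<Omega> n = \<Omega> \<inter> lattice (1 / real n)"
  by (simp add: grid_def lattice_def divide_inverse)

text \<open>On a lattice point these are its integer coordinates; the floor makes the map
  total.\<close>

definition lidx :: "real \<Rightarrow> real^2 \<Rightarrow> int \<times> int" where
  "lidx \<epsilon> w = (\<lfloor>w $ 1 / \<epsilon>\<rfloor>, \<lfloor>w $ 2 / \<epsilon>\<rfloor>)"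

lemma lattice_idx:
  assumes "w \<in> lattice \<epsilon>" "0 < \<epsilon>"
  shows "w $ 1 = \<epsilon> * of_int (fst (lidx \<epsilon> w))" "w $ 2 = \<epsilon> * of_int (snd (lidx \<epsilon> w))"
proof -
  obtain z where z: "w = \<epsilon> *\<^sub>R z" "\<forall>i. z $ i \<in> \<int>" using assms by (auto simp: lattice_def)
  obtain a b where "z $ 1 = of_int a" "z $ 2 = of_int b" using z(2) by (metis Ints_cases)
  then show "w $ 1 = \<epsilon> * of_int (fst (lidx \<epsilon> w))" "w $ 2 = \<epsilon> * of_int (snd (lidx \<epsilon> w))"
    using assms by (auto simp: lidx_def z)
qed

lemma lattice_idx_inj:
  assumes "0 < \<epsilon>"
  shows "inj_on (lidx \<epsilon>) (lattice \<epsilon>)"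
proof (rule inj_onI)
  fix v w assume "v \<in> lattice \<epsilon>" "w \<in> lattice \<epsilon>" "lidx \<epsilon> v = lidx \<epsilon> w"
  then have "v $ 1 = w $ 1" "v $ 2 = w $ 2" using lattice_idx[OF _ assms] by metis+
  then show "v = w" by (simp add: vec_eq_iff forall_2)
qed

lemma norm_component_le: "\<bar>(x :: real^2) $ i\<bar> \<le> norm x"
  by (rule component_le_norm_cart)

lemma norm_le_2: "norm (x :: real^2) \<le> \<bar>x $ 1\<bar> + \<bar>x $ 2\<bar>"
  using norm_le_l1_cart[of x] by (simp add: sum_2)

lemma card_int_interval_le:
  assumes "0 \<le> (r::real)"
  shows "real (card {k::int. \<bar>of_int k - c\<bar> \<le> r}) \<le> 2 * r + 1" "finite {k::int. \<bar>of_int k - c\<bar> \<le> r}"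
proof -
  have eq: "{k::int. \<bar>of_int k - c\<bar> \<le> r} = {\<lceil>c - r\<rceil>..\<lfloor>c + r\<rfloor>}"
    by (auto simp: abs_le_iff ceiling_le_iff le_floor_iff)
  show "finite {k::int. \<bar>of_int k - c\<bar> \<le> r}" unfolding eq by simp
  have "real_of_int (\<lfloor>c + r\<rfloor> - \<lceil>c - r\<rceil> + 1) \<le> (c + r) - (c - r) + 1"
    by (simp add: algebra_simps) linarith
  then show "real (card {k::int. \<bar>of_int k - c\<bar> \<le> r}) \<le> 2 * r + 1"
    unfolding eq card_atLeastAtMost_int using assms by (cases "0 \<le> \<lfloor>c + r\<rfloor> - \<lceil>c - r\<rceil> + 1") auto
qed

lemma lattice_ball_card:
  assumes "0 < \<epsilon>" "0 \<le> r"
  shows "finite {w \<in> lattice \<epsilon>. norm (w - t) \<le> r}"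
    "real (card {w \<in> lattice \<epsilon>. norm (w - t) \<le> r}) \<le> (2 * (r / \<epsilon>) + 1)\<^sup>2"
proof -
  let ?S = "{w \<in> lattice \<epsilon>. norm (w - t) \<le> r}"
  let ?A = "\<lambda>c. {k::int. \<bar>of_int k - c / \<epsilon>\<bar> \<le> r / \<epsilon>}"
  have sub: "lidx \<epsilon> ` ?S \<subseteq> ?A (t $ 1) \<times> ?A (t $ 2)"
  proof
    fix p assume "p \<in> lidx \<epsilon> ` ?S"
    then obtain w where w: "w \<in> lattice \<epsilon>" "norm (w - t) \<le> r" "p = lidx \<epsilon> w" by auto
    have *: "\<bar>of_int k - t $ i / \<epsilon>\<bar> \<le> r / \<epsilon>" if "w $ i = \<epsilon> * of_int k" for i and k :: int
    proof -
      have "\<bar>\<epsilon> * of_int k - t $ i\<bar> \<le> r"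
        using norm_component_le[of "w - t" i] w(2) that by simp
      moreover have "\<epsilon> * of_int k - t $ i = \<epsilon> * (of_int k - t $ i / \<epsilon>)" using assms by (simp add: field_simps)
      ultimately have "\<epsilon> * \<bar>of_int k - t $ i / \<epsilon>\<bar> \<le> r" using assms by (simp add: abs_mult)
      then show ?thesis using assms by (simp add: pos_le_divide_eq mult.commute)
    qed
    show "p \<in> ?A (t $ 1) \<times> ?A (t $ 2)"
      using *[OF lattice_idx(1)[OF w(1) assms(1)]] *[OF lattice_idx(2)[OF w(1) assms(1)]] w(3)
      by (simp add: mem_Times_iff)
  qed
  have r: "0 \<le> r / \<epsilon>" using assms by simp
  have fin: "finite (?A (t $ 1) \<times> ?A (t $ 2))" using card_int_interval_le(2)[OF r] by auto
  have inj: "inj_on (lidx \<epsilon>) ?S" using lattice_idx_inj[OF assms(1)] by (rule inj_on_subset) auto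
  show "finite ?S" using finite_subset[OF sub fin] inj by (simp add: finite_image_iff)
  have "card ?S = card (lidx \<epsilon> ` ?S)" using inj by (simp add: card_image)
  also have "\<dots> \<le> card (?A (t $ 1) \<times> ?A (t $ 2))" by (rule card_mono[OF fin sub])
  also have "\<dots> = card (?A (t $ 1)) * card (?A (t $ 2))" by (rule card_cartesian_product)
  finally have "real (card ?S) \<le> real (card (?A (t $ 1))) * real (card (?A (t $ 2)))"
    unfolding of_nat_mult[symmetric] of_nat_le_iff .
  also have "\<dots> \<le> (2 * (r / \<epsilon>) + 1) * (2 * (r / \<epsilon>) + 1)"
    using card_int_interval_le(1)[OF r] r by (intro mult_mono) auto
  finally show "real (card ?S) \<le> (2 * (r / \<epsilon>) + 1)\<^sup>2" by (simp add: power2_eq_square)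
qed

text \<open>On either side of \<open>k0\<close> the distance to \<open>k0\<close> is an injection
  into the natural numbers, so each half is dominated by the convergent series. The factor 2 counts
  the halves.\<close>

lemma int_powr_sum_le:
  fixes q :: real
  assumes "1 < q" "finite A"
  shows "(\<Sum>k\<in>A. (1 + real_of_int \<bar>k0 - k\<bar>) powr (-q)) \<le> 2 * (\<Sum>n. real (Suc n) powr (-q))"
proof -
  let ?f = "\<lambda>n. real (Suc n) powr (-q)"
  have "summable (\<lambda>n. real n powr (-q))" using assms by (simp add: summable_real_powr_iff)
  then have sm: "summable ?f" by (subst summable_Suc_iff)
  have half: "(\<Sum>k\<in>B. (1 + real_of_int \<bar>k0 - k\<bar>) powr (-q)) \<le> suminf ?f"
    if "finite B" "inj_on (\<lambda>k. nat \<bar>k0 - k\<bar>) B" for B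
  proof -
    have "(\<Sum>k\<in>B. (1 + real_of_int \<bar>k0 - k\<bar>) powr (-q)) = (\<Sum>k\<in>B. ?f (nat \<bar>k0 - k\<bar>))"
      by (intro sum.cong refl) (simp add: algebra_simps)
    also have "\<dots> = sum ?f ((\<lambda>k. nat \<bar>k0 - k\<bar>) ` B)" using that by (simp add: sum.reindex)
    also have "\<dots> \<le> suminf ?f" using that sm by (intro sum_le_suminf) auto
    finally show ?thesis .
  qed
  have "A = {k\<in>A. k \<le> k0} \<union> {k\<in>A. k0 < k}" by auto
  then have "(\<Sum>k\<in>A. (1 + real_of_int \<bar>k0 - k\<bar>) powr (-q)) =
    (\<Sum>k\<in>{k\<in>A. k \<le> k0}. (1 + real_of_int \<bar>k0 - k\<bar>) powr (-q)) + (\<Sum>k\<in>{k\<in>A. k0 < k}. (1 + real_of_int \<bar>k0 - k\<bar>) powr (-q))"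
    using assms by (subst sum.union_disjoint[symmetric]) auto
  also have "\<dots> \<le> suminf ?f + suminf ?f"
    using assms by (intro add_mono half) (auto simp: inj_on_def)
  finally show ?thesis by simp
qed

text \<open>The norm dominates both coordinate distances, so the square of one power splits into a
  product of two one-dimensional sums. Exponent \<open>q > 1\<close> on the line thus controls
  exponent \<open>2q\<close> in the plane.\<close>

lemma lattice_powr_sum_le:
  fixes q :: real
  assumes "1 < q"
  obtains C where "0 < C" "\<And>\<epsilon> w S. 0 < \<epsilon> \<Longrightarrow> w \<in> lattice \<epsilon> \<Longrightarrow> finite S \<Longrightarrow> S \<subseteq> lattice \<epsilon> \<Longrightarrow>
     (\<Sum>w'\<in>S. ((1 + norm (w - w') / \<epsilon>) powr (-q))\<^sup>2) \<le> C"
proof -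
  let ?C0 = "2 * (\<Sum>n. real (Suc n) powr (-q))"
  have "0 \<le> ?C0" using int_powr_sum_le[OF assms, of "{}"] by simp
  show thesis
  proof (rule that[of "?C0 * ?C0 + 1"])
    show "0 < ?C0 * ?C0 + 1" using \<open>0 \<le> ?C0\<close> by (intro add_nonneg_pos mult_nonneg_nonneg) auto
    fix \<epsilon> and w :: "real^2" and S :: "(real^2) set"
    assume a: "0 < \<epsilon>" "w \<in> lattice \<epsilon>" "finite S" "S \<subseteq> lattice \<epsilon>"
    let ?J = "lidx \<epsilon>"
    let ?g = "\<lambda>k0 k. (1 + real_of_int \<bar>k0 - k\<bar>) powr (-q)"
    have "(\<Sum>w'\<in>S. ((1 + norm (w - w') / \<epsilon>) powr (-q))\<^sup>2)
       \<le> (\<Sum>w'\<in>S. ?g (fst (?J w)) (fst (?J w')) * ?g (snd (?J w)) (snd (?J w')))"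
    proof (rule sum_mono)
      fix w' assume "w' \<in> S"
      then have w': "w' \<in> lattice \<epsilon>" using a by auto
      have comp: "real_of_int \<bar>k - k'\<bar> \<le> norm (w - w') / \<epsilon>"
        if "w $ i = \<epsilon> * of_int k" "w' $ i = \<epsilon> * of_int k'" for i k k'
      proof -
        have "\<epsilon> * real_of_int \<bar>k - k'\<bar> = \<bar>(w - w') $ i\<bar>"
          using that a(1) by (simp add: abs_mult right_diff_distrib[symmetric])
        also have "\<dots> \<le> norm (w - w')" by (rule norm_component_le)
        finally show ?thesis using a(1) by (simp add: pos_le_divide_eq mult.commute)
      qed
      have "(1 + norm (w - w') / \<epsilon>) powr (-q) \<le> ?g (fst (?J w)) (fst (?J w'))"
        using comp[OF lattice_idx(1)[OF a(2,1)] lattice_idx(1)[OF w' a(1)]] assms by (intro powr_mono2') auto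
      moreover have "(1 + norm (w - w') / \<epsilon>) powr (-q) \<le> ?g (snd (?J w)) (snd (?J w'))"
        using comp[OF lattice_idx(2)[OF a(2,1)] lattice_idx(2)[OF w' a(1)]] assms by (intro powr_mono2') auto
      ultimately show "((1 + norm (w - w') / \<epsilon>) powr (-q))\<^sup>2 \<le> ?g (fst (?J w)) (fst (?J w')) * ?g (snd (?J w)) (snd (?J w'))"
        unfolding power2_eq_square by (intro mult_mono) auto
    qed
    also have "\<dots> = (\<Sum>p\<in>?J ` S. ?g (fst (?J w)) (fst p) * ?g (snd (?J w)) (snd p))"
      using inj_on_subset[OF lattice_idx_inj[OF a(1)] a(4)] by (simp add: sum.reindex)
    also have "\<dots> \<le> (\<Sum>p\<in>(fst ` ?J ` S) \<times> (snd ` ?J ` S). ?g (fst (?J w)) (fst p) * ?g (snd (?J w)) (snd p))"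
    proof (rule sum_mono2)
      show "?J ` S \<subseteq> (fst ` ?J ` S) \<times> (snd ` ?J ` S)"
        unfolding subset_iff mem_Times_iff by blast
    qed (use a(3) in auto)
    also have "\<dots> = (\<Sum>k\<in>fst ` ?J ` S. ?g (fst (?J w)) k) * (\<Sum>k\<in>snd ` ?J ` S. ?g (snd (?J w)) k)"
      by (simp add: sum_product sum.cartesian_product split_beta)
    also have "\<dots> \<le> ?C0 * ?C0"
      using a(3) \<open>0 \<le> ?C0\<close> by (intro mult_mono int_powr_sum_le[OF assms] sum_nonneg) auto
    finally show "(\<Sum>w'\<in>S. ((1 + norm (w - w') / \<epsilon>) powr (-q))\<^sup>2) \<le> ?C0 * ?C0 + 1" by simp
  qed
qed

section \<open>Half-open cells tiling the plane, and Riemann sums\<close>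

definition cell :: "real \<Rightarrow> real^2 \<Rightarrow> (real^2) set" where
  "cell \<epsilon> w = {x. w $ 1 \<le> x $ 1 \<and> x $ 1 < w $ 1 + \<epsilon> \<and> w $ 2 \<le> x $ 2 \<and> x $ 2 < w $ 2 + \<epsilon>}"

lemma cell_measure:
  assumes "0 < \<epsilon>"
  shows "cell \<epsilon> w \<in> sets lborel" "emeasure lborel (cell \<epsilon> w) = ennreal (\<epsilon>\<^sup>2)"
proof -
  show m: "cell \<epsilon> w \<in> sets lborel"
    unfolding cell_def by measurable
  let ?u = "w + vec \<epsilon>"
  have l: "\<forall>b\<in>Basis. w \<bullet> b \<le> ?u \<bullet> b"
    using assms by (auto simp: Basis_real2 inner_axis)
  have p: "(\<Prod>b\<in>Basis. (?u - w) \<bullet> b) = \<epsilon>\<^sup>2"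
    using axis_neq_2 by (simp add: Basis_real2 inner_axis power2_eq_square)
  have "emeasure lborel (box w ?u) \<le> emeasure lborel (cell \<epsilon> w)"
    using m by (intro emeasure_mono) (auto simp: cell_def mem_box_cart forall_2)
  moreover have "emeasure lborel (cell \<epsilon> w) \<le> emeasure lborel (cbox w ?u)"
    by (intro emeasure_mono) (auto simp: cell_def mem_box_cart forall_2 intro: less_imp_le)
  ultimately show "emeasure lborel (cell \<epsilon> w) = ennreal (\<epsilon>\<^sup>2)"
    using l p by (simp add: emeasure_lborel_box emeasure_lborel_cbox)
qed

lemma lborel_integral_translate:
  fixes \<phi> :: "real^2 \<Rightarrow> real"
  assumes "\<phi> \<in> borel_measurable borel"
  shows "(\<integral>x. \<phi> (c + x) \<partial>lborel) = (\<integral>x. \<phi> x \<partial>lborel)"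
  using assms by (subst (2) lborel_distr_plus[symmetric, of c]) (simp add: integral_distr)

lemma Lipschitz_compact_support_integrable:
  fixes \<phi> :: "real^2 \<Rightarrow> real"
  assumes "continuous_on UNIV \<phi>" "\<And>x. r < norm x \<Longrightarrow> \<phi> x = 0"
  shows "integrable lborel \<phi>"
proof -
  have "integrable lborel (\<lambda>x. indicator (cball 0 r) x *\<^sub>R \<phi> x)"
    by (rule borel_integrable_compact) (auto intro: continuous_on_subset[OF assms(1)])
  moreover have "(\<lambda>x. indicator (cball 0 r) x *\<^sub>R \<phi> x) = \<phi>"
    using assms(2) by (auto simp: indicator_def fun_eq_iff not_le)
  ultimately show ?thesis by simp
qed

lemma emeasure_cball_less_top: "emeasure lborel (cball (c :: real^2) r) < \<top>"
  using emeasure_lborel_cball_finite[of c r] by simp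

text \<open>The sum is the integral of a function constant on the cells, which differs from the
  translated \<phi> by at most \<open>2 L \<epsilon>\<close>. Translation invariance makes the
  constant independent of \<tau>. Letting \<open>S\<close> be any set that contains the support
  points allows for grids cut off by a domain.\<close>

lemma lattice_Riemann_sum:
  fixes \<phi> :: "real^2 \<Rightarrow> real"
  assumes Lip: "\<And>x y. \<bar>\<phi> x - \<phi> y\<bar> \<le> L * norm (x - y)" and L: "0 \<le> L" and r: "0 \<le> r"
    and supp: "\<And>x. r < norm x \<Longrightarrow> \<phi> x = 0"
  obtains C where "0 \<le> C" "\<And>\<epsilon> \<tau> S. 0 < \<epsilon> \<Longrightarrow> \<epsilon> \<le> 1 \<Longrightarrow> finite S \<Longrightarrow> S \<subseteq> lattice \<epsilon> \<Longrightarrow>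
     {w \<in> lattice \<epsilon>. norm (w - \<tau>) \<le> r} \<subseteq> S \<Longrightarrow>
     \<bar>\<epsilon>\<^sup>2 * (\<Sum>w\<in>S. \<phi> (w - \<tau>)) - (\<integral>x. \<phi> x \<partial>lborel)\<bar> \<le> C * \<epsilon>"
proof -
  define v where "v = measure lborel (cball (0::real^2) (r + 2))"
  have v: "measure lborel (cball \<tau> (r + 2)) = v" for \<tau> :: "real^2"
    using r emeasure_cball[of "r + 2" \<tau>] emeasure_cball[of "r + 2" "0 :: real^2"] by (simp add: v_def measure_def)
  show thesis
  proof (rule that[of "2 * L * v"])
    show "0 \<le> 2 * L * v" using L by (simp add: v_def)
    fix \<epsilon> :: real and \<tau> :: "real^2" and S :: "(real^2) set"
    assume \<epsilon>: "0 < \<epsilon>" "\<epsilon> \<le> 1" and S: "finite S" "S \<subseteq> lattice \<epsilon>" "{w \<in> lattice \<epsilon>. norm (w - \<tau>) \<le> r} \<subseteq> S"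
    define s where "s x = (\<Sum>w\<in>S. \<phi> (w - \<tau>) * indicator (cell \<epsilon> w) x)" for x
    have cont: "continuous_on UNIV \<phi>"
    proof (rule lipschitz_on_continuous_on)
      show "L-lipschitz_on UNIV \<phi>"
        using Lip L by (intro lipschitz_onI) (auto simp: dist_norm)
    qed
    have [measurable]: "\<phi> \<in> borel_measurable borel" using cont by (rule borel_measurable_continuous_onI)
    have fl: "\<exists>w0\<in>lattice \<epsilon>. x \<in> cell \<epsilon> w0 \<and> (\<forall>w\<in>lattice \<epsilon>. x \<in> cell \<epsilon> w \<longrightarrow> w = w0) \<and> norm (x - w0) \<le> 2 * \<epsilon>" for x
    proof -
      define z :: "real^2" where "z = (\<chi> i. of_int \<lfloor>x $ i / \<epsilon>\<rfloor>)"
      have z: "\<epsilon> *\<^sub>R z \<in> lattice \<epsilon>" by (auto simp: lattice_def z_def)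
      have b: "\<epsilon> * of_int \<lfloor>y / \<epsilon>\<rfloor> \<le> y" "y < \<epsilon> * of_int \<lfloor>y / \<epsilon>\<rfloor> + \<epsilon>" for y
      proof -
        define k where "k = \<lfloor>y / \<epsilon>\<rfloor>"
        have "of_int k \<le> y / \<epsilon>" "y / \<epsilon> < of_int k + 1" unfolding k_def by linarith+
        then show "\<epsilon> * of_int \<lfloor>y / \<epsilon>\<rfloor> \<le> y" "y < \<epsilon> * of_int \<lfloor>y / \<epsilon>\<rfloor> + \<epsilon>"
          unfolding k_def[symmetric] using \<epsilon> by (simp_all add: field_simps)
      qed
      have c: "x \<in> cell \<epsilon> (\<epsilon> *\<^sub>R z)" using b by (simp add: cell_def z_def)
      have u: "w = \<epsilon> *\<^sub>R z" if w: "w \<in> lattice \<epsilon>" "x \<in> cell \<epsilon> w" for w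
      proof -
        obtain y where y: "w = \<epsilon> *\<^sub>R y" "\<forall>i. y $ i \<in> \<int>" using w by (auto simp: lattice_def)
        have "y $ i = of_int \<lfloor>x $ i / \<epsilon>\<rfloor>" if "\<epsilon> * y $ i \<le> x $ i" "x $ i < \<epsilon> * y $ i + \<epsilon>" for i
        proof -
          obtain k where k: "y $ i = of_int k" using y(2) by (metis Ints_cases)
          have "of_int k \<le> x $ i / \<epsilon>" "x $ i / \<epsilon> < of_int k + 1"
            using that \<epsilon> by (simp_all add: k field_simps)
          then show ?thesis unfolding k by (metis floor_unique)
        qed
        then show ?thesis using w(2) by (simp add: y(1) z_def vec_eq_iff forall_2 cell_def)
      qed
      have "norm (x - \<epsilon> *\<^sub>R z) \<le> \<bar>(x - \<epsilon> *\<^sub>R z) $ 1\<bar> + \<bar>(x - \<epsilon> *\<^sub>R z) $ 2\<bar>" by (rule norm_le_2)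
      also have "\<dots> \<le> 2 * \<epsilon>" using c by (simp add: cell_def)
      finally show ?thesis using z c u by blast
    qed
    have s_eq: "\<exists>w0. s x = \<phi> (w0 - \<tau>) \<and> norm (x - w0) \<le> 2 * \<epsilon>" for x
    proof -
      obtain w0 where w0: "w0 \<in> lattice \<epsilon>" "x \<in> cell \<epsilon> w0" "\<And>w. w \<in> lattice \<epsilon> \<Longrightarrow> x \<in> cell \<epsilon> w \<Longrightarrow> w = w0"
        "norm (x - w0) \<le> 2 * \<epsilon>" using fl by metis
      have "s x = (\<Sum>w\<in>S. if w = w0 then \<phi> (w0 - \<tau>) else 0)"
        unfolding s_def
      proof (intro sum.cong refl)
        fix w assume "w \<in> S"
        show "\<phi> (w - \<tau>) * indicator (cell \<epsilon> w) x = (if w = w0 then \<phi> (w0 - \<tau>) else 0)"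
        proof (cases "w = w0")
          case False
          then have "x \<notin> cell \<epsilon> w" using w0(3) \<open>w \<in> S\<close> S(2) by blast
          then show ?thesis using False by simp
        qed (use w0(2) in simp)
      qed
      also have "\<dots> = (if w0 \<in> S then \<phi> (w0 - \<tau>) else 0)" using S(1) by (simp add: sum.delta)
      \<comment> \<open>A corner \<open>w0\<close> outside \<open>S\<close> lies outside the
        support, so the value 0 of the sum is still the right one.\<close>
      also have "\<dots> = \<phi> (w0 - \<tau>)"
        using S(3) w0(1) supp[of "w0 - \<tau>"] by (auto simp: not_le[symmetric])
      finally show ?thesis using w0(4) by auto
    qed
    \<comment> \<open>A point lies within \<open>2 \<epsilon> \<le> 2\<close> of the corner of its
      cell, so both functions vanish beyond radius \<open>r + 2\<close> around \<tau>.\<close>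
    have bd: "\<bar>s x - \<phi> (-\<tau> + x)\<bar> \<le> 2 * L * \<epsilon> * indicator (cball \<tau> (r + 2)) x" for x
    proof -
      obtain w0 where w0: "s x = \<phi> (w0 - \<tau>)" "norm (x - w0) \<le> 2 * \<epsilon>" using s_eq by blast
      have "\<bar>s x - \<phi> (-\<tau> + x)\<bar> \<le> L * norm ((w0 - \<tau>) - (-\<tau> + x))" unfolding w0(1) by (rule Lip)
      also have "(w0 - \<tau>) - (-\<tau> + x) = w0 - x" by simp
      also have "L * norm (w0 - x) \<le> L * (2 * \<epsilon>)" using w0(2) L by (intro mult_left_mono) (auto simp: norm_minus_commute)
      finally have 1: "\<bar>s x - \<phi> (-\<tau> + x)\<bar> \<le> 2 * L * \<epsilon>" by simp
      show ?thesis
      proof (cases "x \<in> cball \<tau> (r + 2)")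
        case False
        then have f: "r + 2 < norm (-\<tau> + x)" by (simp add: dist_norm norm_minus_commute)
        have "norm (-\<tau> + x) \<le> norm (x - w0) + norm (w0 - \<tau>)"
          using norm_triangle_ineq[of "x - w0" "w0 - \<tau>"] by simp
        then have "r < norm (w0 - \<tau>)" "r < norm (-\<tau> + x)" using f w0(2) \<epsilon> by auto
        then show ?thesis using supp w0(1) L \<epsilon> by simp
      qed (use 1 in simp)
    qed
    have int\<phi>: "integrable lborel (\<lambda>x. \<phi> (-\<tau> + x))"
      using cont supp
      by (intro Lipschitz_compact_support_integrable[of _ "r + norm \<tau>"])
         (auto intro!: continuous_on_compose2[OF cont] continuous_intros supp
            simp: order_less_le_trans[OF _ norm_triangle_ineq2[of _ \<tau>, simplified]])
    have ints: "integrable lborel (\<lambda>x. \<phi> (w - \<tau>) * indicator (cell \<epsilon> w) x)" for w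
      using cell_measure[OF \<epsilon>(1), of w] by (intro integrable_mult_right integrable_real_indicator) auto
    have "(\<integral>x. s x \<partial>lborel) = (\<Sum>w\<in>S. \<phi> (w - \<tau>) * measure lborel (cell \<epsilon> w))"
      unfolding s_def using ints cell_measure(1)[OF \<epsilon>(1)] by (subst Bochner_Integration.integral_sum) auto
    also have "\<dots> = \<epsilon>\<^sup>2 * (\<Sum>w\<in>S. \<phi> (w - \<tau>))"
      using cell_measure(2)[OF \<epsilon>(1)] by (simp add: measure_def sum_distrib_left mult.commute)
    finally have Is: "(\<integral>x. s x \<partial>lborel) = \<epsilon>\<^sup>2 * (\<Sum>w\<in>S. \<phi> (w - \<tau>))" .
    have int_s: "integrable lborel s" unfolding s_def by (intro Bochner_Integration.integrable_sum ints)
    have "\<epsilon>\<^sup>2 * (\<Sum>w\<in>S. \<phi> (w - \<tau>)) - (\<integral>x. \<phi> x \<partial>lborel) = (\<integral>x. s x - \<phi> (-\<tau> + x) \<partial>lborel)"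
      using int_s int\<phi> lborel_integral_translate[of \<phi> "-\<tau>"] by (simp add: Is)
    also have "\<bar>\<dots>\<bar> \<le> (\<integral>x. \<bar>s x - \<phi> (-\<tau> + x)\<bar> \<partial>lborel)" by (rule integral_abs_bound)
    also have "\<dots> \<le> (\<integral>x. 2 * L * \<epsilon> * indicator (cball \<tau> (r + 2)) x \<partial>lborel)"
      using int_s int\<phi> bd by (intro integral_mono integrable_abs Bochner_Integration.integrable_diff
         integrable_mult_right integrable_real_indicator) (auto simp: emeasure_cball_less_top)
    also have "\<dots> = 2 * L * v * \<epsilon>" by (simp add: v)
    finally show "\<bar>\<epsilon>\<^sup>2 * (\<Sum>w\<in>S. \<phi> (w - \<tau>)) - (\<integral>x. \<phi> x \<partial>lborel)\<bar> \<le> 2 * L * v * \<epsilon>" .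
  qed
qed

subsection \<open>The differentiated kernel\<close>

lemma dirD_eqI:
  fixes F :: "real^2 \<Rightarrow> 'b::real_normed_vector"
  assumes "(F has_derivative F') (at x)"
  shows "dirD k F x = F' k"
proof -
  have lin: "linear F'" by (rule has_derivative_linear[OF assms])
  have "dirD k F x = F' (\<Sum>e\<in>Basis. (k \<bullet> e) *\<^sub>R e)"
    by (simp add: dirD_def partial_deriv_eqI[OF assms] linear_sum[OF lin] linear_cmul[OF lin])
  then show ?thesis by (simp add: euclidean_representation)
qed

lemma dir_deriv_B_est:
  assumes "Cr_on (Suc r) UNIV K" "0 < b"
  shows "dir_deriv u (B_est \<Omega> K \<alpha> h n b Y) t = - (1 / ((real n)\<^sup>2 * b ^ 3)) *
    (\<Sum>w\<in>grid \<Omega> n. dirD u K ((w - t) /\<^sub>R b) *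
        ((incr (h /\<^sub>R real n) (incr (h /\<^sub>R real n) Y) w)\<^sup>2 / real n powr (- \<alpha>)))"
proof -
  let ?c = "\<lambda>w. (incr (h /\<^sub>R real n) (incr (h /\<^sub>R real n) Y) w)\<^sup>2 / real n powr (- \<alpha>)"
  have "((\<lambda>t. K ((w - t) /\<^sub>R b)) has_derivative (\<lambda>k. dirD ((- k) /\<^sub>R b) K ((w - t) /\<^sub>R b))) (at t)" for w
  proof -
    have "((\<lambda>t. (w - t) /\<^sub>R b) has_derivative (\<lambda>k. (- k) /\<^sub>R b)) (at t)"
      by (auto intro!: derivative_eq_intros)
    from has_derivative_compose[OF this Cr_on_1_has_derivative[OF assms(1)]] show ?thesis .
  qed
  then have "((\<lambda>t. 1 / ((real n)\<^sup>2 * b\<^sup>2) * (\<Sum>w\<in>grid \<Omega> n. K ((w - t) /\<^sub>R b) * ?c w)) has_derivative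
      (\<lambda>k. 1 / ((real n)\<^sup>2 * b\<^sup>2) * (\<Sum>w\<in>grid \<Omega> n. dirD ((- k) /\<^sub>R b) K ((w - t) /\<^sub>R b) * ?c w))) (at t)"
    by (intro has_derivative_mult_right has_derivative_sum has_derivative_mult_left)
  then have "dirD u (B_est \<Omega> K \<alpha> h n b Y) t =
      1 / ((real n)\<^sup>2 * b\<^sup>2) * (\<Sum>w\<in>grid \<Omega> n. dirD ((- u) /\<^sub>R b) K ((w - t) /\<^sub>R b) * ?c w)"
    unfolding B_est_def by (rule dirD_eqI)
  moreover have "dirD ((- u) /\<^sub>R b) K x = - (1 / b) * dirD u K x" for x
    by (simp add: dirD_def sum_distrib_left sum_negf divide_inverse mult_ac)
  moreover have "(\<Sum>w\<in>grid \<Omega> n. - (1 / b) * dirD u K ((w - t) /\<^sub>R b) * ?c w) =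
      - (1 / b) * (\<Sum>w\<in>grid \<Omega> n. dirD u K ((w - t) /\<^sub>R b) * ?c w)"
    by (simp only: sum_distrib_left mult.assoc)
  ultimately show ?thesis
    unfolding dir_deriv_eq_dirD by (simp add: power2_eq_square power3_eq_cube)
qed

lemma dirD_bound:
  fixes F :: "real^2 \<Rightarrow> real"
  assumes "\<And>e. e \<in> Basis \<Longrightarrow> \<bar>partial_deriv e F x\<bar> \<le> B" "0 \<le> B"
  shows "\<bar>dirD k F x\<bar> \<le> 2 * B * norm k"
proof -
  have B: "axis 1 1 \<in> (Basis :: (real^2) set)" "axis 2 1 \<in> (Basis :: (real^2) set)" by (auto simp: Basis_real2)
  have "\<bar>dirD k F x\<bar> \<le> \<bar>k $ 1\<bar> * \<bar>partial_deriv (axis 1 1) F x\<bar> + \<bar>k $ 2\<bar> * \<bar>partial_deriv (axis 2 1) F x\<bar>"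
    unfolding dirD_2 by (metis abs_mult abs_triangle_ineq real_scaleR_def)
  also have "\<dots> \<le> norm k * B + norm k * B"
    using assms B by (intro add_mono mult_mono norm_component_le) auto
  finally show ?thesis by (simp add: algebra_simps)
qed

section \<open>Moments of the differentiated kernel\<close>

lemma Lipschitz_from_derivative:
  fixes F :: "real^2 \<Rightarrow> real"
  assumes "\<And>x. (F has_derivative F' x) (at x)" "\<And>x k. \<bar>F' x k\<bar> \<le> L * norm k" "0 \<le> L"
  shows "\<bar>F x - F y\<bar> \<le> L * norm (x - y)"
proof -
  have "norm (F x - F y) \<le> L * norm (x - y)"
    by (rule differentiable_bound[of UNIV F F']) (use assms in \<open>auto intro!: onorm_bound\<close>)
  then show ?thesis by simp
qed

text \<open>Each difference quotient has integral 0 by translation invariance. The quotients are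
  dominated, being bounded by the Lipschitz constant and supported in one common ball, so the limit
  has integral 0 as well.\<close>

lemma integral_derivative_zero:
  fixes F :: "real^2 \<Rightarrow> real"
  assumes der: "\<And>x. (F has_derivative F' x) (at x)" and bd: "\<And>x k. \<bar>F' x k\<bar> \<le> L * norm k" "0 \<le> L"
    and cont': "continuous_on UNIV (\<lambda>x. F' x e)" and supp: "\<And>x. r < norm x \<Longrightarrow> F x = 0"
  shows "(\<integral>x. F' x e \<partial>lborel) = 0"
proof -
  let ?s = "\<lambda>n. inverse (real (Suc n))"
  let ?q = "\<lambda>n x. (F (?s n *\<^sub>R e + x) - F x) / ?s n"
  have cont: "continuous_on UNIV F"
    using der by (meson continuous_at_imp_continuous_on has_derivative_continuous)
  have [measurable]: "F \<in> borel_measurable borel" using cont by (rule borel_measurable_continuous_onI)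
  have [measurable]: "(\<lambda>x. F' x e) \<in> borel_measurable borel" using cont' by (rule borel_measurable_continuous_onI)
  have intF: "integrable lborel F" by (rule Lipschitz_compact_support_integrable[OF cont supp])
  have intFt: "integrable lborel (\<lambda>x. F (c + x))" for c
  proof (rule Lipschitz_compact_support_integrable[of _ "r + norm c"])
    show "continuous_on UNIV (\<lambda>x. F (c + x))"
      by (rule continuous_on_compose2[OF cont]) (auto intro!: continuous_intros)
    show "F (c + x) = 0" if "r + norm c < norm x" for x
      using that norm_triangle_ineq[of "c + x" "- c"] by (intro supp) auto
  qed
  have zero: "(\<integral>x. ?q n x \<partial>lborel) = 0" for n
    using intF intFt by (simp add: lborel_integral_translate)
  have "(\<lambda>n. \<integral>x. ?q n x \<partial>lborel) \<longlonglongrightarrow> (\<integral>x. F' x e \<partial>lborel)"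
  proof (rule integral_dominated_convergence)
    show "integrable lborel (\<lambda>x::real^2. L * norm e * indicator (cball 0 (r + norm e)) x)"
      by (intro integrable_mult_right integrable_real_indicator) (auto simp: emeasure_cball_less_top)
    have "(\<lambda>n. ?q n x) \<longlonglongrightarrow> F' x e" for x
    proof -
      have "((\<lambda>s. F (x + s *\<^sub>R e)) has_derivative (\<lambda>s. F' x (s *\<^sub>R e))) (at 0)"
      proof -
        have "((\<lambda>s::real. x + s *\<^sub>R e) has_derivative (\<lambda>s. s *\<^sub>R e)) (at 0)"
          by (auto intro!: derivative_eq_intros)
        from has_derivative_compose[OF this, of F "F' x"] der show ?thesis by simp
      qed
      then have "((\<lambda>s. F (x + s *\<^sub>R e)) has_real_derivative F' x e) (at 0)"
        using has_derivative_linear[OF der, of x]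
        by (simp add: has_field_derivative_def linear_cmul mult.commute[of _ "F' x e"])
      then have "(\<lambda>s. (F (x + s *\<^sub>R e) - F x) / s) \<midarrow>0\<rightarrow> F' x e"
        by (simp add: DERIV_def)
      moreover have "filterlim ?s (at 0) sequentially"
        unfolding filterlim_at using LIMSEQ_inverse_real_of_nat by auto
      ultimately have "(\<lambda>n. (F (x + ?s n *\<^sub>R e) - F x) / ?s n) \<longlonglongrightarrow> F' x e"
        by (rule filterlim_compose)
      then show ?thesis by (simp add: add.commute)
    qed
    then show "AE x in lborel. (\<lambda>n. ?q n x) \<longlonglongrightarrow> F' x e" by simp
    have "norm (?q n x) \<le> L * norm e * indicator (cball 0 (r + norm e)) x" for n x
    proof (cases "x \<in> cball 0 (r + norm e)")
      case True
      have "\<bar>F (?s n *\<^sub>R e + x) - F x\<bar> \<le> L * norm (?s n *\<^sub>R e)"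
        using Lipschitz_from_derivative[OF der bd, of "?s n *\<^sub>R e + x" x] by simp
      then show ?thesis using True by (simp add: abs_divide abs_mult divide_simps mult_ac)
    next
      case False
      have "norm (?s n *\<^sub>R e) \<le> norm e" by (simp add: divide_simps mult_le_cancel_left1)
      then have "r < norm (?s n *\<^sub>R e + x)" "r < norm x"
        using False norm_triangle_ineq[of "?s n *\<^sub>R e + x" "- (?s n *\<^sub>R e)"] norm_ge_zero[of e]
        by (auto simp del: norm_ge_zero)
      then show ?thesis using False supp by simp
    qed
    then show "AE x in lborel. norm (?q n x) \<le> L * norm e * indicator (cball 0 (r + norm e)) x" for n by simp
  qed measurable
  then show ?thesis unfolding zero using LIMSEQ_unique tendsto_const by metis
qed

text \<open>The product rule needs a bound on \<open>x $ i\<close>, available when one of the points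
  lies in the ball of radius \<open>r\<close>; if neither does, both values are 0.\<close>

lemma Lipschitz_mult_component:
  fixes \<kappa> :: "real^2 \<Rightarrow> real"
  assumes "\<And>x y. \<bar>\<kappa> x - \<kappa> y\<bar> \<le> L * norm (x - y)" "\<And>x. \<bar>\<kappa> x\<bar> \<le> B" "\<And>x. r < norm x \<Longrightarrow> \<kappa> x = 0" "0 \<le> L" "0 \<le> B" "0 \<le> r"
  shows "\<bar>\<kappa> x * x $ i - \<kappa> y * y $ i\<bar> \<le> (L * r + B) * norm (x - y)"
proof -
  have main: "\<bar>\<kappa> x * x $ i - \<kappa> y * y $ i\<bar> \<le> (L * r + B) * norm (x - y)" if "norm x \<le> r" for x y
  proof -
    have "\<kappa> x * x $ i - \<kappa> y * y $ i = (\<kappa> x - \<kappa> y) * x $ i + \<kappa> y * (x - y) $ i" by (simp add: algebra_simps)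
    also have "\<bar>\<dots>\<bar> \<le> \<bar>\<kappa> x - \<kappa> y\<bar> * \<bar>x $ i\<bar> + \<bar>\<kappa> y\<bar> * \<bar>(x - y) $ i\<bar>"
      by (metis abs_mult abs_triangle_ineq)
    also have "\<dots> \<le> (L * norm (x - y)) * r + B * norm (x - y)"
      using assms that norm_component_le[of x i] by (intro add_mono mult_mono norm_component_le) auto
    finally show ?thesis by (simp add: algebra_simps)
  qed
  consider "norm x \<le> r" | "norm y \<le> r" | "r < norm x" "r < norm y" by linarith
  then show ?thesis
  proof cases
    case 2
    then show ?thesis using main[of y x] by (simp add: abs_minus_commute norm_minus_commute)
  qed (use main assms in auto)
qed

text \<open>The vanishing integral and the first moments express integration by parts against 1 and
  against \<open>x $ i\<close>. The Lipschitz constant of the differentiated kernel comes from the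
  bounded second order derivatives of \<open>K\<close>.\<close>

lemma kernel_derivative:
  fixes K :: "real^2 \<Rightarrow> real"
  assumes K: "compact (closure {x. K x \<noteq> 0})" "Cr_on 2 UNIV K"
    "\<And>e. e \<in> Basis \<Longrightarrow> bounded (range (partial_deriv e K))"
    "\<And>e e'. e \<in> Basis \<Longrightarrow> e' \<in> Basis \<Longrightarrow> bounded (range (partial_deriv e' (partial_deriv e K)))"
    "has_bochner_integral lborel K 1"
  obtains r L B where "0 < r" "0 < L" "0 < B" "\<And>x. r < norm x \<Longrightarrow> dirD u K x = 0"
    "\<And>x y. \<bar>dirD u K x - dirD u K y\<bar> \<le> L * norm (x - y)" "\<And>x. \<bar>dirD u K x\<bar> \<le> B"
    "(\<integral>x. dirD u K x \<partial>lborel) = 0" "\<And>i. (\<integral>x. dirD u K x * x $ i \<partial>lborel) = - u $ i"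
proof -
  have C2: "Cr_on (Suc (Suc 0)) UNIV K" using K(2) by (simp add: numeral_2_eq_2)
  note derK = Cr_on_1_has_derivative[OF C2]
  have contK: "continuous_on UNIV K" using C2 by (rule Cr_on_continuous)
  obtain r where r: "0 < r" "\<And>x. x \<in> closure {x. K x \<noteq> 0} \<Longrightarrow> norm x \<le> r"
    using compact_imp_bounded[OF K(1)] by (auto simp: bounded_pos)
  have K0: "K x = 0" if "r < norm x" for x
    using r(2)[of x] closure_subset[of "{x. K x \<noteq> 0}"] that by force
  have \<kappa>0: "dirD k K x = 0" if "r < norm x" for k x
  proof -
    have "open (- cball 0 r :: (real^2) set)" by (simp add: open_Compl)
    moreover have "x \<in> - cball 0 r" using that by simp
    ultimately have "partial_deriv e K x = partial_deriv e (\<lambda>_. 0) x" for e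
      by (rule partial_deriv_cong_open) (simp add: K0)
    then show ?thesis by (simp add: dirD_def partial_deriv_def)
  qed
  have "\<exists>B. \<forall>e\<in>Basis. \<forall>x. \<bar>partial_deriv e K x\<bar> \<le> B"
  proof -
    obtain B1 B2 where "\<And>x. \<bar>partial_deriv (axis 1 1) K x\<bar> \<le> B1" "\<And>x. \<bar>partial_deriv (axis 2 1) K x\<bar> \<le> B2"
      using K(3)[of "axis 1 1"] K(3)[of "axis 2 1"] by (auto simp: Basis_real2 bounded_iff)
    then show ?thesis by (intro exI[of _ "max B1 B2"]) (auto simp: Basis_real2 le_max_iff_disj)
  qed
  then obtain B0 where B0: "\<And>e x. e \<in> Basis \<Longrightarrow> \<bar>partial_deriv e K x\<bar> \<le> B0" by blast
  then have B0n: "0 \<le> B0" using abs_ge_zero order_trans Basis_real2 by blast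
  have "\<exists>B. \<forall>e\<in>Basis. \<forall>e'\<in>Basis. \<forall>x. \<bar>partial_deriv e' (partial_deriv e K) x\<bar> \<le> B"
  proof -
    have "\<forall>e\<in>Basis. \<forall>e'\<in>Basis. \<exists>B. \<forall>x. \<bar>partial_deriv e' (partial_deriv e K) x\<bar> \<le> B"
      using K(4) by (auto simp: bounded_iff)
    then obtain b where b: "\<And>e e' x. e \<in> Basis \<Longrightarrow> e' \<in> Basis \<Longrightarrow> \<bar>partial_deriv e' (partial_deriv e K) x\<bar> \<le> b e e'"
      by metis
    show ?thesis
    proof (intro exI ballI allI)
      fix e e' :: "real^2" and x assume e: "e \<in> Basis" "e' \<in> Basis"
      have "b e e' \<le> (\<Sum>e\<in>Basis. \<Sum>e'\<in>Basis. b e e')"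
      proof -
        have nn: "0 \<le> b e e'" if "e \<in> Basis" "e' \<in> Basis" for e e' using b[OF that, of 0] by linarith
        have "b e e' \<le> (\<Sum>e'\<in>Basis. b e e')" by (rule member_le_sum) (use e nn in auto)
        also have "\<dots> \<le> (\<Sum>e\<in>Basis. \<Sum>e'\<in>Basis. b e e')"
          by (rule member_le_sum[of e _ "\<lambda>e. \<Sum>e'\<in>Basis. b e e'"]) (use e nn in \<open>auto intro!: sum_nonneg\<close>)
        finally show ?thesis .
      qed
      then show "\<bar>partial_deriv e' (partial_deriv e K) x\<bar> \<le> (\<Sum>e\<in>Basis. \<Sum>e'\<in>Basis. b e e')"
        using b[OF e, of x] by linarith
    qed
  qed
  then obtain B1 where B1: "\<And>e e' x. e \<in> Basis \<Longrightarrow> e' \<in> Basis \<Longrightarrow> \<bar>partial_deriv e' (partial_deriv e K) x\<bar> \<le> B1" by blast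
  then have B1n: "0 \<le> B1" using abs_ge_zero order_trans Basis_real2 by blast
  have Bd: "\<bar>dirD k K x\<bar> \<le> 2 * B0 * norm k" for k x by (rule dirD_bound[OF B0 B0n])
  let ?L = "2 * norm u * (2 * B1)"
  have Lip: "\<bar>dirD u K x - dirD u K y\<bar> \<le> ?L * norm (x - y)" for x y
  proof (rule Lipschitz_from_derivative[OF dirD_has_derivative[OF C2]])
    fix x k
    have "\<bar>\<Sum>e\<in>Basis. (u \<bullet> e) *\<^sub>R dirD k (partial_deriv e K) x\<bar> \<le> (\<Sum>e\<in>Basis. \<bar>(u \<bullet> e) *\<^sub>R dirD k (partial_deriv e K) x\<bar>)"
      by (rule sum_abs)
    also have "\<dots> \<le> (\<Sum>e\<in>(Basis :: (real^2) set). norm u * (2 * B1 * norm k))"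
      using B1n by (intro sum_mono) (auto simp: abs_mult intro!: mult_mono Basis_le_norm dirD_bound B1)
    also have "\<dots> = ?L * norm k" by simp
    finally show "\<bar>\<Sum>e\<in>Basis. (u \<bullet> e) *\<^sub>R dirD k (partial_deriv e K) x\<bar> \<le> ?L * norm k" .
  qed (use B1n in auto)
  have cont\<kappa>: "continuous_on UNIV (dirD k K)" for k by (rule continuous_on_dirD[OF C2])
  have i0: "(\<integral>x. dirD u K x \<partial>lborel) = 0"
    by (rule integral_derivative_zero[OF derK Bd _ cont\<kappa> K0]) (use B0n in auto)
  have i1: "(\<integral>x. dirD u K x * x $ i \<partial>lborel) = - u $ i" for i
  proof -
    have intK: "integrable lborel K" "(\<integral>x. K x \<partial>lborel) = 1"
      using K(5) by (auto simp: has_bochner_integral_iff)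
    have "bounded (K ` cball 0 r)"
      by (intro compact_imp_bounded compact_continuous_image continuous_on_subset[OF contK]) auto
    then obtain BK where "\<forall>y\<in>K ` cball 0 r. norm y \<le> BK" unfolding bounded_iff by blast
    then have BK: "\<bar>K x\<bar> \<le> BK" if "x \<in> cball 0 r" for x using that by auto
    have BK': "\<bar>K x\<bar> \<le> max 0 BK" for x using BK[of x] K0[of x] by (cases "norm x \<le> r") (auto simp: le_max_iff_disj)
    have der: "((\<lambda>x. K x * x $ i) has_derivative (\<lambda>k. dirD k K x * x $ i + K x * k $ i)) (at x)" for x
      by (rule has_derivative_eq_rhs[OF has_derivative_mult[OF derK bounded_linear.has_derivative[OF bounded_linear_vec_nth has_derivative_ident]]])
         (simp add: algebra_simps)
    have bd: "\<bar>dirD k K x * x $ i + K x * k $ i\<bar> \<le> (2 * B0 * r + max 0 BK) * norm k" for x k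
    proof -
      have "\<bar>dirD k K x * x $ i\<bar> \<le> (2 * B0 * norm k) * r"
      proof (cases "norm x \<le> r")
        case True
        then show ?thesis unfolding abs_mult using Bd[of k x] norm_component_le[of x i] B0n
          by (intro mult_mono) auto
      qed (use \<kappa>0 B0n r in auto)
      moreover have "\<bar>K x * k $ i\<bar> \<le> max 0 BK * norm k"
        unfolding abs_mult by (intro mult_mono BK' norm_component_le) auto
      ultimately show ?thesis by (simp add: algebra_simps)
    qed
    have cont2: "continuous_on UNIV (\<lambda>x. dirD u K x * x $ i)"
      by (intro continuous_intros cont\<kappa>)
    \<comment> \<open>The integrand is the derivative along \<open>u\<close> of the compactly
      supported function \<open>K x * x $ i\<close>; since \<open>K\<close> has integral 1, the
      first moment is \<open>- u $ i\<close>.\<close>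
    have "(\<integral>x. dirD u K x * x $ i + K x * u $ i \<partial>lborel) = 0"
      by (rule integral_derivative_zero[OF der bd, where r=r])
         (use B0n r K0 in \<open>auto intro!: continuous_intros cont\<kappa> contK\<close>)
    moreover have "integrable lborel (\<lambda>x. dirD u K x * x $ i)"
      by (rule Lipschitz_compact_support_integrable[OF cont2, where r=r]) (simp add: \<kappa>0)
    ultimately show ?thesis using intK by (simp add: algebra_simps)
  qed
  show thesis
  \<comment> \<open>Adding 1 makes the constants strictly positive even if the derivatives
    vanish.\<close>
  proof (rule that[of r "?L + 1" "2 * B0 * norm u + 1"])
    show "\<bar>dirD u K x - dirD u K y\<bar> \<le> (?L + 1) * norm (x - y)" for x y
      unfolding distrib_right using Lip[of x y] norm_ge_zero[of "x - y"] by linarith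
    show "\<bar>dirD u K x\<bar> \<le> 2 * B0 * norm u + 1" for x using Bd[of u x] by simp
    show "0 < ?L + 1" "0 < 2 * B0 * norm u + 1" using B0n B1n by (auto intro!: add_nonneg_pos)
  qed (use r \<kappa>0 i0 i1 in auto)
qed

subsection \<open>Uniform bounds on the fluctuation\<close>

lemma lattice_near:
  assumes "0 < \<epsilon>"
  shows "\<exists>w\<in>lattice \<epsilon>. norm (x - w) \<le> 2 * \<epsilon>"
proof -
  define z :: "real^2" where "z = (\<chi> i. of_int \<lfloor>x $ i / \<epsilon>\<rfloor>)"
  have z: "\<epsilon> *\<^sub>R z \<in> lattice \<epsilon>" by (auto simp: lattice_def z_def)
  have b: "\<bar>y - \<epsilon> * of_int \<lfloor>y / \<epsilon>\<rfloor>\<bar> \<le> \<epsilon>" for y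
  proof -
    have "\<bar>y / \<epsilon> - of_int \<lfloor>y / \<epsilon>\<rfloor>\<bar> \<le> 1" by linarith
    then have "\<epsilon> * \<bar>y / \<epsilon> - of_int \<lfloor>y / \<epsilon>\<rfloor>\<bar> \<le> \<epsilon>" using assms by (simp add: mult_left_le)
    also have "\<epsilon> * \<bar>y / \<epsilon> - of_int \<lfloor>y / \<epsilon>\<rfloor>\<bar> = \<bar>\<epsilon> * (y / \<epsilon> - of_int \<lfloor>y / \<epsilon>\<rfloor>)\<bar>" using assms by (simp add: abs_mult)
    finally show ?thesis using assms by (simp add: right_diff_distrib)
  qed
  have "norm (x - \<epsilon> *\<^sub>R z) \<le> \<bar>(x - \<epsilon> *\<^sub>R z) $ 1\<bar> + \<bar>(x - \<epsilon> *\<^sub>R z) $ 2\<bar>" by (rule norm_le_2)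
  also have "\<dots> \<le> 2 * \<epsilon>" using b[of "x $ 1"] b[of "x $ 2"] by (simp add: z_def)
  finally show ?thesis using z by blast
qed

text \<open>The hypothesis \<open>1 \<le> n b\<close> absorbs the additive 1 of the counting bound,
  leaving a pure multiple of \<open>(n b)^2\<close>.\<close>

lemma lattice_scaled_card:
  assumes "1 \<le> n" "0 \<le> r" "1 \<le> real n * b"
  shows "finite {w \<in> lattice (1 / real n). norm (w - t) \<le> r * b}"
    "real (card {w \<in> lattice (1 / real n). norm (w - t) \<le> r * b}) \<le> (2 * r + 1)\<^sup>2 * (real n * b)\<^sup>2"
proof -
  have "0 < b" using assms by (metis less_le_trans mult_le_0_iff not_less of_nat_0_le_iff zero_less_one)
  then have n: "0 < 1 / real n" and rb: "0 \<le> r * b" using assms by simp_all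
  show "finite {w \<in> lattice (1 / real n). norm (w - t) \<le> r * b}" by (rule lattice_ball_card(1)[OF n rb])
  have "real (card {w \<in> lattice (1 / real n). norm (w - t) \<le> r * b}) \<le> (2 * ((r * b) / (1 / real n)) + 1)\<^sup>2"
    by (rule lattice_ball_card(2)[OF n rb])
  also have "\<dots> \<le> ((2 * r + 1) * (real n * b))\<^sup>2"
    using assms \<open>0 < b\<close> by (intro power_mono) (auto simp: algebra_simps)
  finally show "real (card {w \<in> lattice (1 / real n). norm (w - t) \<le> r * b}) \<le> (2 * r + 1)\<^sup>2 * (real n * b)\<^sup>2"
    by (simp add: power_mult_distrib)
qed

text \<open>All that the stochastic part retains of the field: a Gaussian array whose covariances
  decay in the distance counted in grid steps. The summand 1 includes the diagonal, so
  \<open>C\<close> also bounds the variances.\<close>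

locale gaussian_lattice = gaussian_space M V for M :: "'w measure" and V +
  fixes X :: "nat \<Rightarrow> real^2 \<Rightarrow> 'w \<Rightarrow> real" and G :: "nat \<Rightarrow> (real^2) set" and \<kappa> :: "real^2 \<Rightarrow> real"
    and b :: "nat \<Rightarrow> real" and \<rho> C q r L B \<beta> Cb :: real and N :: nat
  assumes G: "\<And>n. n \<ge> N \<Longrightarrow> G n \<subseteq> {w \<in> lattice (1 / real n). norm w \<le> \<rho>}"
    and XV: "\<And>n w. n \<ge> N \<Longrightarrow> w \<in> G n \<Longrightarrow> X n w \<in> V"
    and cov: "\<And>n w w'. n \<ge> N \<Longrightarrow> w \<in> G n \<Longrightarrow> w' \<in> G n \<Longrightarrow>
        \<bar>cv (X n w) (X n w')\<bar> \<le> C * (1 + norm (w - w') / (1 / real n)) powr (-q)"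
    and pos: "0 \<le> C" "1 < q" "0 < r" "0 < L" "0 < B" "0 < \<beta>" "0 < Cb" "0 \<le> \<rho>"
    and \<kappa>_supp: "\<And>x. r < norm x \<Longrightarrow> \<kappa> x = 0" and \<kappa>_Lip: "\<And>x y. \<bar>\<kappa> x - \<kappa> y\<bar> \<le> L * norm (x - y)"
    and \<kappa>_bound: "\<And>x. \<bar>\<kappa> x\<bar> \<le> B"
    and b: "\<And>n. n \<ge> N \<Longrightarrow> 0 < b n \<and> b n \<le> 1 \<and> 1 \<le> real n * b n"
    and b4: "\<And>n. n \<ge> N \<Longrightarrow> 1 / (real n * b n ^ 4) \<le> Cb * real n powr (-\<beta>)"
    and N: "1 \<le> N"
begin

text \<open>The minus sign from differentiating \<open>(w - t) / b\<close> is left out here; it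
  reappears when the derivative of the estimator is split into mean and fluctuation.\<close>

definition coef :: "nat \<Rightarrow> real^2 \<Rightarrow> real^2 \<Rightarrow> real" where
  "coef n t w = 1 / ((real n)\<^sup>2 * b n ^ 3) * \<kappa> ((w - t) /\<^sub>R b n)"

definition fluct :: "nat \<Rightarrow> real^2 \<Rightarrow> 'w \<Rightarrow> real" where
  "fluct n t \<omega> = (\<Sum>w\<in>G n. coef n t w * csq (X n w) \<omega>)"

definition near :: "nat \<Rightarrow> real^2 \<Rightarrow> (real^2) set" where
  "near n t = {w \<in> G n. norm (w - t) \<le> r * b n}"

lemma finite_G: assumes "n \<ge> N" shows "finite (G n)"
proof -
  have "0 < 1 / real n" using assms N by simp
  from lattice_ball_card(1)[OF this pos(8), of 0] show ?thesis
    using G[OF assms] by (simp add: finite_subset)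
qed

lemma card_G: assumes "n \<ge> N" shows "real (card (G n)) \<le> (2 * \<rho> + 1)\<^sup>2 * (real n)\<^sup>2"
proof -
  have n: "0 < 1 / real n" "1 \<le> real n" using assms N by simp_all
  have "real (card (G n)) \<le> real (card {w \<in> lattice (1 / real n). norm (w - 0) \<le> \<rho>})"
    using G[OF assms] lattice_ball_card(1)[OF n(1) pos(8), of 0] by (auto intro!: card_mono)
  also have "\<dots> \<le> (2 * (\<rho> / (1 / real n)) + 1)\<^sup>2" by (rule lattice_ball_card(2)[OF n(1) pos(8)])
  also have "\<dots> \<le> ((2 * \<rho> + 1) * real n)\<^sup>2"
    using n pos by (intro power_mono) (auto simp: algebra_simps)
  finally show ?thesis by (simp add: power_mult_distrib)
qed

lemma card_near: assumes "n \<ge> N" shows "finite (near n t)" "real (card (near n t)) \<le> (2 * r + 1)\<^sup>2 * (real n * b n)\<^sup>2"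
proof -
  have sub: "near n t \<subseteq> {w \<in> lattice (1 / real n). norm (w - t) \<le> r * b n}"
    using G[OF assms] by (auto simp: near_def)
  have n: "1 \<le> n" "0 \<le> r" "1 \<le> real n * b n" using assms N b[OF assms] pos by simp_all
  show "finite (near n t)" using finite_G[OF assms] by (simp add: near_def)
  have "real (card (near n t)) \<le> real (card {w \<in> lattice (1 / real n). norm (w - t) \<le> r * b n})"
    using card_mono[OF lattice_scaled_card(1)[OF n] sub] by simp
  also have "\<dots> \<le> (2 * r + 1)\<^sup>2 * (real n * b n)\<^sup>2" by (rule lattice_scaled_card(2)[OF n])
  finally show "real (card (near n t)) \<le> (2 * r + 1)\<^sup>2 * (real n * b n)\<^sup>2" .
qed

lemma coef_zero: assumes "n \<ge> N" "r * b n < norm (w - t)" shows "coef n t w = 0"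
proof -
  have "0 < b n" using b[OF assms(1)] by simp
  moreover from this have "norm ((w - t) /\<^sub>R b n) = norm (w - t) / b n"
    by (simp add: divide_inverse mult.commute)
  ultimately have "r < norm ((w - t) /\<^sub>R b n)" using assms(2) by (simp only: pos_less_divide_eq)
  then show ?thesis using \<kappa>_supp by (simp add: coef_def)
qed

lemma coef_bound: assumes "n \<ge> N" shows "\<bar>coef n t w\<bar> \<le> B / ((real n)\<^sup>2 * b n ^ 3)"
proof -
  have "0 < (real n)\<^sup>2 * b n ^ 3" using b[OF assms] assms N by simp
  then show ?thesis unfolding coef_def abs_mult
    using mult_left_mono[OF \<kappa>_bound, of "1 / ((real n)\<^sup>2 * b n ^ 3)"] by simp
qed

lemma fluct_near: assumes "n \<ge> N" shows "fluct n t \<omega> = (\<Sum>w\<in>near n t. coef n t w * csq (X n w) \<omega>)"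
  unfolding fluct_def near_def using finite_G[OF assms] coef_zero[OF assms]
  by (intro sum.mono_neutral_right) (auto simp: not_le)

lemma fluct_moments: assumes "n \<ge> N" shows "all_moments M (fluct n t)"
  unfolding fluct_def[abs_def] by (intro all_moments_intros csq_moments XV assms)

text \<open>Row sums of squared covariances are bounded, so their double sum is of the order of the
  number \<open>(n b)^2\<close> of active points. Squaring this and multiplying by the fourth power
  of the coefficient size \<open>1 / (n^2 b^3)\<close> gives \<open>n^-4 b^-8\<close>.\<close>

lemma fourth_moment:
  obtains C1 where "0 \<le> C1" "\<And>n t. n \<ge> N \<Longrightarrow> (\<integral>\<omega>. fluct n t \<omega> ^ 4 \<partial>M) \<le> C1 / ((real n) ^ 4 * b n ^ 8)"
proof -
  obtain Cs where Cs: "0 < Cs" "\<And>\<epsilon> w S. 0 < \<epsilon> \<Longrightarrow> w \<in> lattice \<epsilon> \<Longrightarrow> finite S \<Longrightarrow> S \<subseteq> lattice \<epsilon> \<Longrightarrow>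
     (\<Sum>w'\<in>S. ((1 + norm (w - w') / \<epsilon>) powr (-q))\<^sup>2) \<le> Cs"
    by (rule lattice_powr_sum_le[OF pos(2)]) blast
  let ?C1 = "60 * B ^ 4 * (C\<^sup>2 * Cs * (2 * r + 1)\<^sup>2)\<^sup>2"
  show thesis
  proof (rule that[of ?C1])
    show "0 \<le> ?C1" using pos by simp
    fix n t assume n: "n \<ge> N"
    let ?x = "real n" and ?S = "near n t"
    have x: "0 < ?x" "0 < b n" using n N b[OF n] by auto
    have S: "?S \<subseteq> lattice (1 / ?x)" "?S \<subseteq> G n" using G[OF n] by (auto simp: near_def)
    have "(\<integral>\<omega>. fluct n t \<omega> ^ 4 \<partial>M) = (\<integral>\<omega>. (\<Sum>w\<in>?S. coef n t w * csq (X n w) \<omega>) ^ 4 \<partial>M)"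
      by (simp add: fluct_near[OF n])
    also have "\<dots> \<le> 60 * (B / (?x\<^sup>2 * b n ^ 3)) ^ 4 * (\<Sum>w\<in>?S. \<Sum>w'\<in>?S. (cv (X n w) (X n w'))\<^sup>2)\<^sup>2"
      using S(2) by (intro fourth_moment_quadratic_form card_near(1) n XV coef_bound) auto
    also have "\<dots> \<le> 60 * (B / (?x\<^sup>2 * b n ^ 3)) ^ 4 * (C\<^sup>2 * Cs * ((2 * r + 1)\<^sup>2 * (?x * b n)\<^sup>2))\<^sup>2"
    proof (intro mult_left_mono power_mono)
      have "(\<Sum>w\<in>?S. \<Sum>w'\<in>?S. (cv (X n w) (X n w'))\<^sup>2) \<le> (\<Sum>w\<in>?S. C\<^sup>2 * Cs)"
      proof (rule sum_mono)
        fix w assume w: "w \<in> ?S"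
        have "(\<Sum>w'\<in>?S. (cv (X n w) (X n w'))\<^sup>2) \<le> (\<Sum>w'\<in>?S. C\<^sup>2 * ((1 + norm (w - w') / (1 / ?x)) powr (-q))\<^sup>2)"
        proof (rule sum_mono)
          fix w' assume "w' \<in> ?S"
          then have "\<bar>cv (X n w) (X n w')\<bar> \<le> C * (1 + norm (w - w') / (1 / ?x)) powr (-q)"
            using w S by (intro cov n) auto
          from power_mono[OF this abs_ge_zero, of 2]
          show "(cv (X n w) (X n w'))\<^sup>2 \<le> C\<^sup>2 * ((1 + norm (w - w') / (1 / ?x)) powr (-q))\<^sup>2"
            by (simp only: power2_abs power_mult_distrib)
        qed
        also have "\<dots> = C\<^sup>2 * (\<Sum>w'\<in>?S. ((1 + norm (w - w') / (1 / ?x)) powr (-q))\<^sup>2)"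
          by (simp only: sum_distrib_left)
        also have "\<dots> \<le> C\<^sup>2 * Cs"
          using w S x by (intro mult_left_mono Cs(2) card_near(1) n) auto
        finally show "(\<Sum>w'\<in>?S. (cv (X n w) (X n w'))\<^sup>2) \<le> C\<^sup>2 * Cs" .
      qed
      also have "\<dots> = C\<^sup>2 * Cs * real (card ?S)" by simp
      also have "\<dots> \<le> C\<^sup>2 * Cs * ((2 * r + 1)\<^sup>2 * (?x * b n)\<^sup>2)"
        using Cs(1) by (intro mult_left_mono card_near(2) n) auto
      finally show "(\<Sum>w\<in>?S. \<Sum>w'\<in>?S. (cv (X n w) (X n w'))\<^sup>2) \<le> C\<^sup>2 * Cs * ((2 * r + 1)\<^sup>2 * (?x * b n)\<^sup>2)" .
    qed (auto intro!: sum_nonneg)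
    also have "\<dots> = ?C1 / (?x ^ 4 * b n ^ 8)"
      using x by (simp add: field_simps eval_nat_numeral)
    finally show "(\<integral>\<omega>. fluct n t \<omega> ^ 4 \<partial>M) \<le> ?C1 / (?x ^ 4 * b n ^ 8)" .
  qed
qed

text \<open>The net, the threshold for the fluctuation and the bound on \<open>X\<^sup>2\<close> all spend powers of the
  amplification factor; \<open>\<beta> / 4\<close> is small enough to leave \<open>n\<^bsup>-1-\<beta>\<^esup>\<close> after the union bound.\<close>
definition amp :: "nat \<Rightarrow> real" where "amp n = real n powr (\<beta> / 4)"

lemma amp: assumes "n \<ge> N"
  shows "1 \<le> amp n" "amp n ^ 4 = real n powr \<beta>" "1 / (real n * b n ^ 4) \<le> Cb / amp n ^ 4"
proof -
  have n: "1 \<le> real n" using assms N by simp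
  show "1 \<le> amp n" using n pos by (simp add: amp_def ge_one_powr_ge_zero)
  show e: "amp n ^ 4 = real n powr \<beta>" using n by (simp add: amp_def powr_power)
  show "1 / (real n * b n ^ 4) \<le> Cb / amp n ^ 4"
    using b4[OF assms] unfolding e by (simp add: powr_minus_divide)
qed

text \<open>Chosen from the Lipschitz step: \<open>(n b)^2\<close> points, coefficient changes of
  order \<open>mesh / (n^2 b^4)\<close> and squares up to \<open>amp\<close> give an error
  \<open>amp * mesh / b^2\<close>, which this choice makes \<open>1 / amp\<close>.\<close>

definition mesh :: "nat \<Rightarrow> real" where "mesh n = (b n)\<^sup>2 / (amp n)\<^sup>2"

lemma mesh: assumes "n \<ge> N" shows "0 < mesh n" "mesh n \<le> 1"
proof -
  have "0 < b n" "b n \<le> 1" "1 \<le> amp n" using b[OF assms] amp[OF assms] by auto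
  then show "0 < mesh n" "mesh n \<le> 1"
    using power_mono[of "b n" 1 2] power_mono[of 1 "amp n" 2] by (auto simp: mesh_def divide_simps)
qed

text \<open>Points of the ball of radius \<rho> have a lattice point within
  \<open>2 mesh \<le> 2\<close>, hence the radius \<open>\<rho> + 2\<close>.\<close>

definition net :: "nat \<Rightarrow> (real^2) set" where "net n = {t \<in> lattice (mesh n). norm (t - 0) \<le> \<rho> + 2}"

lemma net: assumes "n \<ge> N"
  shows "finite (net n)" "real (card (net n)) \<le> (2 * \<rho> + 5)\<^sup>2 * (amp n ^ 4 / b n ^ 4)"
proof -
  note m = mesh[OF assms]
  have \<rho>2: "0 \<le> \<rho> + 2" using pos by simp
  show "finite (net n)" unfolding net_def by (rule lattice_ball_card(1)[OF m(1) \<rho>2])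
  have "real (card (net n)) \<le> (2 * ((\<rho> + 2) / mesh n) + 1)\<^sup>2"
    unfolding net_def by (rule lattice_ball_card(2)[OF m(1) \<rho>2])
  also have "\<dots> \<le> ((2 * \<rho> + 5) / mesh n)\<^sup>2"
    using m pos by (intro power_mono) (auto simp: field_simps)
  also have "\<dots> = (2 * \<rho> + 5)\<^sup>2 * (amp n ^ 4 / b n ^ 4)"
    using b[OF assms] amp(1)[OF assms] by (simp add: mesh_def field_simps eval_nat_numeral)
  finally show "real (card (net n)) \<le> (2 * \<rho> + 5)\<^sup>2 * (amp n ^ 4 / b n ^ 4)" .
qed

section \<open>Exceptional events and the almost sure bound\<close>

definition bad1 :: "nat \<Rightarrow> 'w set" where
  "bad1 n = (\<Union>t\<in>net n. {\<omega>\<in>space M. fluct n t \<omega> ^ 4 \<ge> (1 / amp n) ^ 4})"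

text \<open>Markov's inequality for the fourth power at each net point, multiplied by the number of
  net points.\<close>

lemma bad1_measure:
  obtains C2 where "0 \<le> C2" "\<And>n. n \<ge> N \<Longrightarrow> bad1 n \<in> sets M \<and> measure M (bad1 n) \<le> C2 * real n powr (- 1 - \<beta>)"
proof -
  obtain C1 where C1: "0 \<le> C1" "\<And>n t. n \<ge> N \<Longrightarrow> (\<integral>\<omega>. fluct n t \<omega> ^ 4 \<partial>M) \<le> C1 / ((real n) ^ 4 * b n ^ 8)"
    by (rule fourth_moment) blast
  show thesis
  proof (rule that[of "(2 * \<rho> + 5)\<^sup>2 * C1 * Cb ^ 3"])
    show "0 \<le> (2 * \<rho> + 5)\<^sup>2 * C1 * Cb ^ 3" using C1 pos by simp
    fix n assume n: "n \<ge> N"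
    let ?x = "real n"
    have x: "0 < ?x" "0 < b n" "0 < amp n" using n N b[OF n] amp(1)[OF n] by auto
    have am: "all_moments M (\<lambda>\<omega>. fluct n t \<omega> ^ 4)" for t by (intro all_moments_intros fluct_moments n)
    have [measurable]: "(\<lambda>\<omega>. fluct n t \<omega> ^ 4) \<in> borel_measurable M" for t
      using am by (simp add: all_moments_def)
    have sets1: "{\<omega>\<in>space M. fluct n t \<omega> ^ 4 \<ge> (1 / amp n) ^ 4} \<in> sets M" for t by measurable
    have "measure M (bad1 n) \<le> (\<Sum>t\<in>net n. measure M {\<omega>\<in>space M. fluct n t \<omega> ^ 4 \<ge> (1 / amp n) ^ 4})"
      unfolding bad1_def using sets1 net(1)[OF n] by (intro finite_measure_subadditive_finite) auto
    also have "\<dots> \<le> (\<Sum>t\<in>net n. C1 / (?x ^ 4 * b n ^ 8) * amp n ^ 4)"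
    proof (rule sum_mono)
      fix t
      have "measure M {\<omega>\<in>space M. fluct n t \<omega> ^ 4 \<ge> (1 / amp n) ^ 4} \<le> (\<integral>\<omega>. fluct n t \<omega> ^ 4 \<partial>M) / (1 / amp n) ^ 4"
        using x by (intro integral_Markov_inequality_measure[where A="{}"] all_moments_integrable am) auto
      also have "\<dots> \<le> (C1 / (?x ^ 4 * b n ^ 8)) / (1 / amp n) ^ 4"
        using x by (intro divide_right_mono C1 n) auto
      finally show "measure M {\<omega>\<in>space M. fluct n t \<omega> ^ 4 \<ge> (1 / amp n) ^ 4} \<le> C1 / (?x ^ 4 * b n ^ 8) * amp n ^ 4"
        by (simp add: power_divide)
    qed
    also have "\<dots> = real (card (net n)) * (C1 / (?x ^ 4 * b n ^ 8) * amp n ^ 4)" by simp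
    also have "\<dots> \<le> ((2 * \<rho> + 5)\<^sup>2 * (amp n ^ 4 / b n ^ 4)) * (C1 / (?x ^ 4 * b n ^ 8) * amp n ^ 4)"
      using C1 x by (intro mult_right_mono net n) auto
    \<comment> \<open>One factor \<open>amp^4\<close> stems from the size of the net and one from
      the threshold. The cube of the bandwidth condition supplies \<open>amp^-12\<close>, which
      leaves \<open>amp^-4 = n^(-\<beta>)\<close> besides \<open>1 / n\<close>.\<close>
    also have "\<dots> = (2 * \<rho> + 5)\<^sup>2 * C1 * (amp n ^ 8 / ?x) * (1 / (?x * b n ^ 4)) ^ 3"
      using x by (simp add: field_simps eval_nat_numeral)
    also have "\<dots> \<le> (2 * \<rho> + 5)\<^sup>2 * C1 * (amp n ^ 8 / ?x) * (Cb / amp n ^ 4) ^ 3"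
      using C1 x pos by (intro mult_left_mono power_mono amp n) auto
    also have "\<dots> = (2 * \<rho> + 5)\<^sup>2 * C1 * Cb ^ 3 * (1 / (?x * amp n ^ 4))"
      using x by (simp add: field_simps eval_nat_numeral)
    also have "1 / (?x * amp n ^ 4) = ?x powr (- 1 - \<beta>)"
      using x amp(2)[OF n] by (simp add: powr_diff powr_minus_divide)
    finally have "measure M (bad1 n) \<le> (2 * \<rho> + 5)\<^sup>2 * C1 * Cb ^ 3 * ?x powr (- 1 - \<beta>)" .
    moreover have "bad1 n \<in> sets M" unfolding bad1_def using sets1 net(1)[OF n] by (intro sets.finite_UN) auto
    ultimately show "bad1 n \<in> sets M \<and> measure M (bad1 n) \<le> (2 * \<rho> + 5)\<^sup>2 * C1 * Cb ^ 3 * ?x powr (- 1 - \<beta>)" by blast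
  qed
qed

text \<open>The exponent makes \<open>amp\<close> to that power at least \<open>n\<^sup>4\<close>, which beats the \<open>O(n\<^sup>2)\<close> lattice points.\<close>
definition bad2 :: "nat \<Rightarrow> 'w set" where
  "bad2 n = (\<Union>w\<in>G n. {\<omega>\<in>space M. X n w \<omega> ^ (2 * nat \<lceil>16 / \<beta>\<rceil>) \<ge> amp n ^ nat \<lceil>16 / \<beta>\<rceil>})"

lemma cv_diag_le: assumes "n \<ge> N" "w \<in> G n" shows "0 \<le> cv (X n w) (X n w)" "cv (X n w) (X n w) \<le> C"
  using cov[OF assms(1) assms(2) assms(2)] cv_self_nonneg[OF XV[OF assms]] by auto

text \<open>Variances are at most \<open>C\<close>, so moments of every fixed order are bounded
  uniformly over the grid, and Markov's inequality can be used with an order as high as \<beta>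
  demands.\<close>

lemma bad2_measure:
  obtains C3 where "0 \<le> C3" "\<And>n. n \<ge> N \<Longrightarrow> bad2 n \<in> sets M \<and> measure M (bad2 n) \<le> C3 * real n powr (- 2)"
proof -
  let ?p = "nat \<lceil>16 / \<beta>\<rceil>"
  show thesis
  proof (rule that[of "(2 * \<rho> + 1)\<^sup>2 * (normal_moment (2 * ?p) * C ^ ?p)"])
    show "0 \<le> (2 * \<rho> + 1)\<^sup>2 * (normal_moment (2 * ?p) * C ^ ?p)" using pos by (simp add: normal_moment_nonneg)
    fix n assume n: "n \<ge> N"
    let ?x = "real n"
    have x: "1 \<le> ?x" "0 < amp n" using n N amp(1)[OF n] by auto
    let ?F = "\<lambda>w \<omega>. X n w \<omega> ^ (2 * ?p)"
    have am: "all_moments M (?F w)" if "w \<in> G n" for w by (intro all_moments_intros moments XV n that)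
    have sets2: "{\<omega>\<in>space M. ?F w \<omega> \<ge> amp n ^ ?p} \<in> sets M" if "w \<in> G n" for w
    proof -
      have [measurable]: "?F w \<in> borel_measurable M" using am[OF that] by (simp add: all_moments_def)
      show ?thesis by measurable
    qed
    have "measure M (bad2 n) \<le> (\<Sum>w\<in>G n. measure M {\<omega>\<in>space M. ?F w \<omega> \<ge> amp n ^ ?p})"
      unfolding bad2_def using sets2 finite_G[OF n] by (intro finite_measure_subadditive_finite) auto
    also have "\<dots> \<le> (\<Sum>w\<in>G n. normal_moment (2 * ?p) * C ^ ?p / amp n ^ ?p)"
    proof (rule sum_mono)
      fix w assume w: "w \<in> G n"
      have "measure M {\<omega>\<in>space M. ?F w \<omega> \<ge> amp n ^ ?p} \<le> (\<integral>\<omega>. ?F w \<omega> \<partial>M) / amp n ^ ?p"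
        using x by (intro integral_Markov_inequality_measure[where A="{}"] all_moments_integrable am w) (auto simp: power_mult)
      also have "(\<integral>\<omega>. ?F w \<omega> \<partial>M) = normal_moment (2 * ?p) * cv (X n w) (X n w) ^ ?p"
        using moment_eq[OF XV[OF n w], of "2 * ?p"] by (simp add: cv_def power2_eq_square)
      also have "normal_moment (2 * ?p) * cv (X n w) (X n w) ^ ?p / amp n ^ ?p \<le> normal_moment (2 * ?p) * C ^ ?p / amp n ^ ?p"
        using cv_diag_le[OF n w] x by (intro divide_right_mono mult_left_mono power_mono normal_moment_nonneg) auto
      finally show "measure M {\<omega>\<in>space M. ?F w \<omega> \<ge> amp n ^ ?p} \<le> normal_moment (2 * ?p) * C ^ ?p / amp n ^ ?p" .
    qed
    also have "\<dots> = real (card (G n)) * (normal_moment (2 * ?p) * C ^ ?p / amp n ^ ?p)" by simp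
    also have "\<dots> \<le> ((2 * \<rho> + 1)\<^sup>2 * ?x\<^sup>2) * (normal_moment (2 * ?p) * C ^ ?p / amp n ^ ?p)"
      using x pos by (intro mult_right_mono card_G n divide_nonneg_nonneg mult_nonneg_nonneg normal_moment_nonneg) auto
    also have "\<dots> \<le> ((2 * \<rho> + 1)\<^sup>2 * ?x\<^sup>2) * (normal_moment (2 * ?p) * C ^ ?p / ?x ^ 4)"
    proof (intro mult_left_mono divide_left_mono)
      \<comment> \<open>With exponent at least \<open>16 / \<beta>\<close> the threshold is at least
        \<open>n^4\<close>; against the \<open>O(n^2)\<close> grid points this leaves
        \<open>n^-2\<close>.\<close>
      have *: "4 \<le> \<beta> / 4 * y" if "16 / \<beta> \<le> y" for y using pos that by (simp add: field_simps)
      have "4 \<le> \<beta> / 4 * real ?p" by (rule *[OF real_nat_ceiling_ge])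
      then have "?x powr 4 \<le> ?x powr (\<beta> / 4 * real ?p)" using x by (intro powr_mono) auto
      also have "\<dots> = amp n ^ ?p" using x by (simp add: amp_def powr_power mult.commute)
      finally show "?x ^ 4 \<le> amp n ^ ?p" using x by (simp add: powr_numeral)
    qed (use x pos in \<open>auto simp: normal_moment_nonneg\<close>)
    also have "\<dots> = (2 * \<rho> + 1)\<^sup>2 * (normal_moment (2 * ?p) * C ^ ?p) * ?x powr (- 2)"
      using x by (simp add: powr_minus_divide powr_numeral field_simps eval_nat_numeral)
    finally have "measure M (bad2 n) \<le> (2 * \<rho> + 1)\<^sup>2 * (normal_moment (2 * ?p) * C ^ ?p) * ?x powr (- 2)" .
    moreover have "bad2 n \<in> sets M" unfolding bad2_def using sets2 finite_G[OF n] by (intro sets.finite_UN) auto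
    ultimately show "bad2 n \<in> sets M \<and> measure M (bad2 n) \<le> (2 * \<rho> + 1)\<^sup>2 * (normal_moment (2 * ?p) * C ^ ?p) * ?x powr (- 2)" by blast
  qed
qed

lemma AE_eventually_good:
  "AE \<omega> in M. \<forall>\<^sub>F n in sequentially. \<omega> \<in> space M \<and> \<omega> \<notin> bad1 n \<and> \<omega> \<notin> bad2 n"
proof -
  obtain C2 where C2: "0 \<le> C2" "\<And>n. n \<ge> N \<Longrightarrow> bad1 n \<in> sets M \<and> measure M (bad1 n) \<le> C2 * real n powr (- 1 - \<beta>)"
    by (rule bad1_measure) blast
  obtain C3 where C3: "0 \<le> C3" "\<And>n. n \<ge> N \<Longrightarrow> bad2 n \<in> sets M \<and> measure M (bad2 n) \<le> C3 * real n powr (- 2)"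
    by (rule bad2_measure) blast
  \<comment> \<open>Measurability and the bounds are available from \<open>N\<close> on; the earlier
    events are replaced by the empty set.\<close>
  define A where "A n = (if n \<ge> N then bad1 n \<union> bad2 n else {})" for n
  have "AE \<omega> in M. \<forall>\<^sub>F n in sequentially. \<omega> \<in> space M - A n"
  proof (rule borel_cantelli_AE1)
    show "A n \<in> sets M" for n using C2 C3 by (auto simp: A_def)
    show "emeasure M (A n) < \<infinity>" for n by (simp add: emeasure_eq_measure)
    show "summable (\<lambda>n. measure M (A n))"
    proof (rule summable_comparison_test'[where N=N])
      show "summable (\<lambda>n. C2 * real n powr (- 1 - \<beta>) + C3 * real n powr (- 2))"
        using pos by (intro summable_add summable_mult) (auto simp: summable_real_powr_iff)
      fix n assume n: "N \<le> n"
      have "measure M (bad1 n \<union> bad2 n) \<le> measure M (bad1 n) + measure M (bad2 n)"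
        using C2 C3 n by (intro measure_Un_le) auto
      then show "norm (measure M (A n)) \<le> C2 * real n powr (- 1 - \<beta>) + C3 * real n powr (- 2)"
        using C2(2)[OF n] C3(2)[OF n] n by (simp add: A_def)
    qed
  qed
  then show ?thesis
  proof eventually_elim
    case (elim \<omega>)
    with eventually_ge_at_top[of N] show ?case
      by eventually_elim (auto simp: A_def)
  qed
qed

lemma coef_Lipschitz: assumes "n \<ge> N"
  shows "\<bar>coef n t w - coef n t' w\<bar> \<le> L * norm (t - t') / ((real n)\<^sup>2 * b n ^ 4)"
proof -
  have x: "0 < real n" "0 < b n" using b[OF assms] assms N by auto
  have "\<bar>\<kappa> ((w - t) /\<^sub>R b n) - \<kappa> ((w - t') /\<^sub>R b n)\<bar> \<le> L * norm ((w - t) /\<^sub>R b n - (w - t') /\<^sub>R b n)"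
    by (rule \<kappa>_Lip)
  also have "(w - t) /\<^sub>R b n - (w - t') /\<^sub>R b n = (t' - t) /\<^sub>R b n"
    by (simp add: scaleR_diff_right)
  also have "norm ((t' - t) /\<^sub>R b n) = norm (t - t') / b n" using x by (simp add: norm_minus_commute divide_inverse mult.commute)
  finally have "1 / ((real n)\<^sup>2 * b n ^ 3) * \<bar>\<kappa> ((w - t) /\<^sub>R b n) - \<kappa> ((w - t') /\<^sub>R b n)\<bar>
      \<le> 1 / ((real n)\<^sup>2 * b n ^ 3) * (L * (norm (t - t') / b n))"
    using x by (intro mult_left_mono) auto
  moreover have "\<bar>coef n t w - coef n t' w\<bar> = 1 / ((real n)\<^sup>2 * b n ^ 3) * \<bar>\<kappa> ((w - t) /\<^sub>R b n) - \<kappa> ((w - t') /\<^sub>R b n)\<bar>"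
    using x unfolding coef_def right_diff_distrib[symmetric] abs_mult by simp
  ultimately have "\<bar>coef n t w - coef n t' w\<bar> \<le> 1 / ((real n)\<^sup>2 * b n ^ 3) * (L * (norm (t - t') / b n))"
    by linarith
  also have "\<dots> = L * norm (t - t') / ((real n)\<^sup>2 * b n ^ 4)"
    using x by (simp add: field_simps eval_nat_numeral)
  finally show ?thesis .
qed

text \<open>Outside the exceptional events the value at a nearby net point is below
  \<open>1 / amp\<close>, and passing to \<open>t\<close> costs a constant times
  \<open>1 / amp\<close>, since all centred squares are at most a multiple of
  \<open>amp\<close>.\<close>

lemma fluct_good:
  assumes n: "n \<ge> N" and good: "\<omega> \<in> space M" "\<omega> \<notin> bad1 n" "\<omega> \<notin> bad2 n" and t: "norm t \<le> \<rho>"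
  shows "\<bar>fluct n t \<omega>\<bar> \<le> (1 + 4 * L * (2 * r + 1)\<^sup>2 * (1 + C)) / amp n"
proof -
  let ?x = "real n" and ?p = "nat \<lceil>16 / \<beta>\<rceil>"
  have x: "0 < ?x" "0 < b n" "1 \<le> amp n" using n N b[OF n] amp(1)[OF n] by auto
  have p: "0 < ?p" using pos by simp
  have sq: "\<bar>csq (X n w) \<omega>\<bar> \<le> amp n * (1 + C)" if w: "w \<in> G n" for w
  proof -
    have "\<not> X n w \<omega> ^ (2 * ?p) \<ge> amp n ^ ?p" using good w by (auto simp: bad2_def)
    then have "((X n w \<omega>)\<^sup>2) ^ ?p < amp n ^ ?p" unfolding power_mult[symmetric] not_le .
    then have "(X n w \<omega>)\<^sup>2 < amp n" by (rule power_less_imp_less_base) (use x in simp)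
    moreover have "0 \<le> (X n w \<omega>)\<^sup>2" by simp
    moreover have "C \<le> amp n * C" using mult_right_mono[of 1 "amp n" C] pos(1) x by simp
    moreover have "amp n * (1 + C) = amp n + amp n * C" by (simp add: distrib_left)
    ultimately show ?thesis using cv_diag_le[OF n w] x unfolding csq_def by linarith
  qed
  obtain t' where t': "t' \<in> lattice (mesh n)" "norm (t - t') \<le> 2 * mesh n"
    using lattice_near[OF mesh(1)[OF n]] by blast
  have "norm t' \<le> norm t + norm (t - t')" using norm_triangle_ineq[of t "t' - t"] by (simp add: norm_minus_commute)
  then have "t' \<in> net n" using t' t mesh[OF n] by (simp add: net_def)
  then have "\<not> fluct n t' \<omega> ^ 4 \<ge> (1 / amp n) ^ 4" using good by (auto simp: bad1_def)
  then have "\<bar>fluct n t' \<omega>\<bar> ^ 4 < (1 / amp n) ^ 4" by simp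
  then have f': "\<bar>fluct n t' \<omega>\<bar> < 1 / amp n" by (rule power_less_imp_less_base) (use x in simp)
  \<comment> \<open>Two kernels shifted against each other have different supports. The difference
    of their coefficients is summed over the union of both.\<close>
  let ?U = "near n t \<union> near n t'"
  let ?D = "L * (2 * mesh n) / (?x\<^sup>2 * b n ^ 4)"
  have U: "finite ?U" "?U \<subseteq> G n" using card_near(1)[OF n] by (auto simp: near_def)
  have ext: "fluct n s \<omega> = (\<Sum>w\<in>?U. coef n s w * csq (X n w) \<omega>)" if "s = t \<or> s = t'" for s
    unfolding fluct_def
  proof (intro sum.mono_neutral_right ballI)
    fix w assume "w \<in> G n - ?U"
    then have "r * b n < norm (w - s)" using that by (auto simp: near_def not_le)
    then show "coef n s w * csq (X n w) \<omega> = 0" by (simp add: coef_zero[OF n])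
  qed (use U finite_G[OF n] in auto)
  have "\<bar>fluct n t \<omega> - fluct n t' \<omega>\<bar> = \<bar>\<Sum>w\<in>?U. (coef n t w - coef n t' w) * csq (X n w) \<omega>\<bar>"
    by (simp add: ext sum_subtractf[symmetric] left_diff_distrib)
  also have "\<dots> \<le> (\<Sum>w\<in>?U. \<bar>(coef n t w - coef n t' w) * csq (X n w) \<omega>\<bar>)" by (rule sum_abs)
  also have "\<dots> \<le> (\<Sum>w\<in>?U. ?D * (amp n * (1 + C)))"
  proof (rule sum_mono)
    fix w assume "w \<in> ?U"
    have "\<bar>coef n t w - coef n t' w\<bar> \<le> L * norm (t - t') / (?x\<^sup>2 * b n ^ 4)" by (rule coef_Lipschitz[OF n])
    also have "\<dots> \<le> ?D" using t'(2) x pos by (intro divide_right_mono mult_left_mono) auto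
    finally show "\<bar>(coef n t w - coef n t' w) * csq (X n w) \<omega>\<bar> \<le> ?D * (amp n * (1 + C))"
      unfolding abs_mult using sq U \<open>w \<in> ?U\<close> mesh[OF n] pos x by (intro mult_mono) auto
  qed
  also have "\<dots> = real (card ?U) * (?D * (amp n * (1 + C)))" by simp
  also have "\<dots> \<le> (2 * ((2 * r + 1)\<^sup>2 * (?x * b n)\<^sup>2)) * (?D * (amp n * (1 + C)))"
  proof (rule mult_right_mono)
    have "card ?U \<le> card (near n t) + card (near n t')" by (rule card_Un_le)
    then have "real (card ?U) \<le> real (card (near n t)) + real (card (near n t'))" by (metis of_nat_add of_nat_le_iff)
    then show "real (card ?U) \<le> 2 * ((2 * r + 1)\<^sup>2 * (?x * b n)\<^sup>2)"
      using card_near(2)[OF n, of t] card_near(2)[OF n, of t'] by linarith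
    show "0 \<le> ?D * (amp n * (1 + C))" using mesh[OF n] pos x by (intro mult_nonneg_nonneg divide_nonneg_nonneg) auto
  qed
  \<comment> \<open>The powers of \<open>n\<close> and \<open>b\<close> cancel, and one
    \<open>amp\<close> from the squares against the two in the mesh leaves
    \<open>1 / amp\<close>.\<close>
  also have "\<dots> = 4 * L * (2 * r + 1)\<^sup>2 * (1 + C) / amp n"
  proof -
    have "(2 * (K * (y * z)\<^sup>2)) * ((L * (2 * (z\<^sup>2 / a\<^sup>2)) / (y\<^sup>2 * z ^ 4)) * (a * c)) = 4 * L * K * c / a"
      if "0 < y" "0 < z" "0 < a" for K y z a c :: real
      using that by (simp add: field_simps eval_nat_numeral)
    then show ?thesis unfolding mesh_def using x by simp
  qed
  finally show ?thesis using f' by (simp add: add_divide_distrib)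
qed

lemma AE_uniform_limit_fluct:
  "AE \<omega> in M. uniform_limit (cball 0 \<rho>) (\<lambda>n t. fluct n t \<omega>) (\<lambda>_. 0) sequentially"
  using AE_eventually_good
proof eventually_elim
  case (elim \<omega>)
  let ?K = "1 + 4 * L * (2 * r + 1)\<^sup>2 * (1 + C)"
  have "(\<lambda>n. ?K * real n powr (-(\<beta> / 4))) \<longlonglongrightarrow> ?K * 0"
    using pos by (intro tendsto_intros tendsto_neg_powr filterlim_real_sequentially) auto
  then have lim: "(\<lambda>n. ?K * real n powr (-(\<beta> / 4))) \<longlonglongrightarrow> 0" by simp
  show ?case
  proof (rule uniform_limitI)
    fix e :: real assume "0 < e"
    have "\<forall>\<^sub>F n in sequentially. ?K * real n powr (-(\<beta> / 4)) < e" using order_tendstoD(2)[OF lim \<open>0 < e\<close>] .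
    with elim eventually_ge_at_top[of N]
    show "\<forall>\<^sub>F n in sequentially. \<forall>t\<in>cball 0 \<rho>. dist (fluct n t \<omega>) 0 < e"
    proof eventually_elim
      case (elim n)
      have "\<bar>fluct n t \<omega>\<bar> < e" if "t \<in> cball 0 \<rho>" for t
        using fluct_good[of n \<omega> t] elim that by (simp add: amp_def powr_minus_divide)
      then show ?case by (simp add: dist_norm)
    qed
  qed
qed

end

subsection \<open>Normalized increments of the field\<close>

lemma gaussian_rv_moments:
  assumes "prob_space M" "gaussian_rv M W"
  defines "m \<equiv> (\<integral>\<omega>. W \<omega> \<partial>M)"
  shows "all_moments M (\<lambda>\<omega>. W \<omega> - m)"
    "(\<integral>\<omega>. (W \<omega> - m) ^ k \<partial>M) = normal_moment k * (\<integral>\<omega>. (W \<omega> - m)\<^sup>2 \<partial>M) ^ (k div 2)"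
    "integrable M W"
proof -
  interpret prob_space M by fact
  have meas[measurable]: "W \<in> borel_measurable M" using assms(2) by (simp add: gaussian_rv_def)
  consider m0 where "AE \<omega> in M. W \<omega> = m0"
    | m0 \<sigma> where "0 < \<sigma>" "distributed M lborel W (\<lambda>x. ennreal (normal_density m0 \<sigma> x))"
    using assms(2) by (auto simp: gaussian_rv_def)
  then have "all_moments M (\<lambda>\<omega>. W \<omega> - m) \<and> integrable M W \<and>
    (\<integral>\<omega>. (W \<omega> - m) ^ k \<partial>M) = normal_moment k * (\<integral>\<omega>. (W \<omega> - m)\<^sup>2 \<partial>M) ^ (k div 2)"
  proof cases
    case 1
    have int: "integrable M W" using 1 by (subst integrable_cong_AE[of _ _ "\<lambda>_. m0"]) auto
    have "m = (\<integral>\<omega>. m0 \<partial>M)" unfolding m_def using 1 by (intro integral_cong_AE) auto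
    then have m: "m = m0" by (simp add: prob_space)
    have pw: "AE \<omega> in M. \<bar>W \<omega> - m\<bar> ^ j = 0 ^ j" "AE \<omega> in M. (W \<omega> - m) ^ j = 0 ^ j" for j
      using 1 by (auto simp: m)
    have "integrable M (\<lambda>\<omega>. \<bar>W \<omega> - m\<bar> ^ j)" for j
      using pw(1)[of j] by (subst integrable_cong_AE[of _ _ "\<lambda>_. 0 ^ j"]) auto
    then have am: "all_moments M (\<lambda>\<omega>. W \<omega> - m)" by (auto simp: all_moments_def)
    have I: "(\<integral>\<omega>. (W \<omega> - m) ^ j \<partial>M) = 0 ^ j" for j
    proof -
      have "(\<integral>\<omega>. (W \<omega> - m) ^ j \<partial>M) = (\<integral>\<omega>. 0 ^ j \<partial>M)" using pw(2)[of j] by (intro integral_cong_AE) auto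
      then show ?thesis by (simp add: prob_space)
    qed
    \<comment> \<open>The delicate value is \<open>k = 1\<close>: there \<open>k div 2 = 0\<close>
      and the power on the right is 1, but the odd normal moment is 0.\<close>
    have "0 ^ k = normal_moment k * (0::real) ^ (k div 2)"
      by (cases "k = 0"; cases "k = 1") (auto simp: normal_moment_def power_0_left)
    then show ?thesis using am int by (simp add: I)
  next
    case 2
    have m: "m = m0" unfolding m_def using normal_distributed_expectation[OF 2] .
    have tr: "(\<integral>\<omega>. g (W \<omega>) \<partial>M) = (\<integral>x. normal_density m0 \<sigma> x * g x \<partial>lborel)"
      "integrable M (\<lambda>\<omega>. g (W \<omega>)) \<longleftrightarrow> integrable lborel (\<lambda>x. normal_density m0 \<sigma> x * g x)"
      if "g \<in> borel_measurable borel" for g :: "real \<Rightarrow> real"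
      using distributed_integral[OF 2(2), of g] distributed_integrable[OF 2(2), of g] that by auto
    have "integrable M (\<lambda>\<omega>. \<bar>W \<omega> - m\<bar> ^ j)" for j
      using tr(2)[of "\<lambda>x. \<bar>x - m\<bar> ^ j"] integrable_normal_moment_abs[OF 2(1), of m0 j] by (simp add: m)
    then have am: "all_moments M (\<lambda>\<omega>. W \<omega> - m)" by (auto simp: all_moments_def)
    have "integrable M (\<lambda>\<omega>. (W \<omega> - m) + m)"
      using all_moments_integrable[OF am] by (intro Bochner_Integration.integrable_add) auto
    then have int: "integrable M W" by simp
    have ev: "(\<integral>\<omega>. (W \<omega> - m) ^ (2 * j) \<partial>M) = normal_moment (2 * j) * (\<sigma>\<^sup>2) ^ j" for j
      using tr(1)[of "\<lambda>x. (x - m) ^ (2 * j)"] has_bochner_integral_integral_eq[OF normal_moment_even[OF 2(1), of m0 j]] 2(1)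
      by (simp add: m normal_moment_def power_divide field_simps)
    have od: "(\<integral>\<omega>. (W \<omega> - m) ^ (2 * j + 1) \<partial>M) = 0" for j
      using tr(1)[of "\<lambda>x. (x - m) ^ (2 * j + 1)"] has_bochner_integral_integral_eq[OF normal_moment_odd[OF 2(1), of m0 j]]
      by (simp add: m)
    have s: "(\<integral>\<omega>. (W \<omega> - m)\<^sup>2 \<partial>M) = \<sigma>\<^sup>2" using ev[of 1] by (simp add: normal_moment_def)
    have "(\<integral>\<omega>. (W \<omega> - m) ^ k \<partial>M) = normal_moment k * (\<sigma>\<^sup>2) ^ (k div 2)"
    proof (cases "even k")
      case True
      then show ?thesis using ev by auto
    next
      case False
      then obtain j where "k = 2 * j + 1" by (auto elim: oddE)
      then show ?thesis using od[of j] by (simp add: normal_moment_def)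
    qed
    then show ?thesis using am int s by simp
  qed
  then show "all_moments M (\<lambda>\<omega>. W \<omega> - m)" "integrable M W"
    "(\<integral>\<omega>. (W \<omega> - m) ^ k \<partial>M) = normal_moment k * (\<integral>\<omega>. (W \<omega> - m)\<^sup>2 \<partial>M) ^ (k div 2)"
    by auto
qed

text \<open>The linear span of the centred field, as actual functions rather than classes modulo
  null sets.\<close>

definition lincombs :: "('a \<Rightarrow> 'w \<Rightarrow> real) \<Rightarrow> real \<Rightarrow> ('w \<Rightarrow> real) set" where
  "lincombs Z \<mu> = {(\<lambda>\<omega>. \<Sum>t\<in>T. a t * (Z t \<omega> - \<mu>)) |T a. finite T}"

lemma lincombsE:
  assumes "X \<in> lincombs Z \<mu>"
  obtains T a where "finite T" "X = (\<lambda>\<omega>. \<Sum>t\<in>T. a t * (Z t \<omega> - \<mu>))"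
proof -
  from assms have "\<exists>T a. X = (\<lambda>\<omega>. \<Sum>t\<in>T. a t * (Z t \<omega> - \<mu>)) \<and> finite T"
    unfolding lincombs_def by (rule CollectD)
  then show thesis by (elim exE conjE) (rule that)
qed

lemma lincombsI: "finite T \<Longrightarrow> (\<lambda>\<omega>. \<Sum>t\<in>T. a t * (Z t \<omega> - \<mu>)) \<in> lincombs Z \<mu>"
  unfolding lincombs_def by (intro CollectI exI[of _ T] exI[of _ a]) simp

lemma lincombs_single: "(\<lambda>\<omega>. Z t \<omega> - \<mu>) \<in> lincombs Z \<mu>"
  unfolding lincombs_def by (intro CollectI exI[of _ "{t}"] exI[of _ "\<lambda>_. 1"]) auto

text \<open>Each member is a finite linear combination of field values minus its mean, so the
  one-dimensional moment formula for Gaussian variables covers the whole span.\<close>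

lemma gaussian_space_lincombs:
  assumes "prob_space M" "gaussian_field M Z" "\<And>t. (\<integral>\<omega>. Z t \<omega> \<partial>M) = \<mu>"
  shows "gaussian_space M (lincombs Z \<mu>)"
proof -
  interpret prob_space M by fact
  have grv: "gaussian_rv M (\<lambda>\<omega>. \<Sum>t\<in>T. a t * Z t \<omega>)" if "finite T" for T a
    using assms(2) that by (auto simp: gaussian_field_def)
  have "gaussian_rv M (Z t)" for t using grv[of "{t}" "\<lambda>_. 1"] by simp
  then have int: "integrable M (Z t)" for t using gaussian_rv_moments(3)[OF assms(1)] by blast
  have repr: "all_moments M X \<and> (\<integral>\<omega>. X \<omega> ^ m \<partial>M) = normal_moment m * (\<integral>\<omega>. (X \<omega>)\<^sup>2 \<partial>M) ^ (m div 2)"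
    if X: "X \<in> lincombs Z \<mu>" for X m
  proof -
    obtain T a where T: "finite T" "X = (\<lambda>\<omega>. \<Sum>t\<in>T. a t * (Z t \<omega> - \<mu>))"
      by (rule lincombsE[OF X])
    let ?W = "\<lambda>\<omega>. \<Sum>t\<in>T. a t * Z t \<omega>"
    have "(\<integral>\<omega>. ?W \<omega> \<partial>M) = (\<Sum>t\<in>T. a t * \<mu>)"
      using int by (subst Bochner_Integration.integral_sum) (auto simp: assms(3))
    then have eq: "X = (\<lambda>\<omega>. ?W \<omega> - (\<integral>\<omega>. ?W \<omega> \<partial>M))"
      by (simp add: T(2) sum_subtractf right_diff_distrib)
    show ?thesis unfolding eq
      by (rule conjI[OF gaussian_rv_moments(1,2)[OF assms(1) grv[OF T(1), of a]]])
  qed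
  show ?thesis
  proof unfold_locales
    fix X Y assume XY: "X \<in> lincombs Z \<mu>" "Y \<in> lincombs Z \<mu>"
    obtain T a where T: "finite T" "X = (\<lambda>\<omega>. \<Sum>t\<in>T. a t * (Z t \<omega> - \<mu>))"
      by (rule lincombsE[OF XY(1)])
    obtain T' a' where T': "finite T'" "Y = (\<lambda>\<omega>. \<Sum>t\<in>T'. a' t * (Z t \<omega> - \<mu>))"
      by (rule lincombsE[OF XY(2)])
    \<comment> \<open>The index sets may overlap, so both coefficient families are extended by 0 to
      the union and added there.\<close>
    have "(\<lambda>\<omega>. X \<omega> + Y \<omega>) = (\<lambda>\<omega>. \<Sum>t\<in>T \<union> T'. ((if t \<in> T then a t else 0) + (if t \<in> T' then a' t else 0)) * (Z t \<omega> - \<mu>))"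
    proof
      fix \<omega>
      have "X \<omega> = (\<Sum>t\<in>T \<union> T'. (if t \<in> T then a t else 0) * (Z t \<omega> - \<mu>))"
        unfolding T(2) using T(1) T'(1) by (intro sum.mono_neutral_cong_left) auto
      moreover have "Y \<omega> = (\<Sum>t\<in>T \<union> T'. (if t \<in> T' then a' t else 0) * (Z t \<omega> - \<mu>))"
        unfolding T'(2) using T(1) T'(1) by (intro sum.mono_neutral_cong_left) auto
      ultimately show "X \<omega> + Y \<omega> = (\<Sum>t\<in>T \<union> T'. ((if t \<in> T then a t else 0) + (if t \<in> T' then a' t else 0)) * (Z t \<omega> - \<mu>))"
        unfolding distrib_right sum.distrib by (rule arg_cong2[where f="(+)"])
    qed
    then show "(\<lambda>\<omega>. X \<omega> + Y \<omega>) \<in> lincombs Z \<mu>"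
      by (rule ssubst) (rule lincombsI[OF finite_UnI[OF T(1) T'(1)]])
  next
    fix X and c :: real assume X: "X \<in> lincombs Z \<mu>"
    obtain T a where T: "finite T" "X = (\<lambda>\<omega>. \<Sum>t\<in>T. a t * (Z t \<omega> - \<mu>))"
      by (rule lincombsE[OF X])
    then have "(\<lambda>\<omega>. c * X \<omega>) = (\<lambda>\<omega>. \<Sum>t\<in>T. (c * a t) * (Z t \<omega> - \<mu>))"
      by (simp add: sum_distrib_left mult.assoc)
    then show "(\<lambda>\<omega>. c * X \<omega>) \<in> lincombs Z \<mu>"
      by (rule ssubst) (rule lincombsI[OF T(1)])
  next
    fix X assume "X \<in> lincombs Z \<mu>"
    then show "all_moments M X" using repr by blast
  next
    fix X m assume "X \<in> lincombs Z \<mu>"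
    then show "(\<integral>\<omega>. X \<omega> ^ m \<partial>M) = normal_moment m * (\<integral>\<omega>. (X \<omega>)\<^sup>2 \<partial>M) ^ (m div 2)"
      using repr by blast
  qed
qed

section \<open>Covariances of normalized second differences\<close>

context gaussian_space
begin

lemma cv_integrable: "A \<in> V \<Longrightarrow> B \<in> V \<Longrightarrow> integrable M (\<lambda>\<omega>. A \<omega> * B \<omega>)"
  by (intro all_moments_integrable all_moments_mult moments)

lemma cv_second_difference:
  assumes "A0 \<in> V" "A1 \<in> V" "A2 \<in> V" "B \<in> V"
  shows "cv (\<lambda>\<omega>. A2 \<omega> - 2 * A1 \<omega> + A0 \<omega>) B = cv A2 B - 2 * cv A1 B + cv A0 B"
proof -
  note I = cv_integrable[OF assms(1,4)] cv_integrable[OF assms(2,4)] cv_integrable[OF assms(3,4)]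
  have "(\<integral>\<omega>. (A2 \<omega> - 2 * A1 \<omega> + A0 \<omega>) * B \<omega> \<partial>M) = (\<integral>\<omega>. A2 \<omega> * B \<omega> - 2 * (A1 \<omega> * B \<omega>) + A0 \<omega> * B \<omega> \<partial>M)"
    by (simp add: algebra_simps)
  also have "\<dots> = cv A2 B - 2 * cv A1 B + cv A0 B"
    unfolding cv_def using I by simp
  finally show ?thesis by (simp add: cv_def)
qed

lemma second_difference_closed:
  assumes "A0 \<in> V" "A1 \<in> V" "A2 \<in> V"
  shows "(\<lambda>\<omega>. A2 \<omega> - 2 * A1 \<omega> + A0 \<omega>) \<in> V"
  using add_closed[OF add_closed[OF assms(3) scale_closed[OF assms(2), of "-2"]] assms(1)] by simp

lemma cv_scale: "cv (\<lambda>\<omega>. c * A \<omega>) (\<lambda>\<omega>. c * B \<omega>) = c * c * cv A B"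
proof -
  have "cv (\<lambda>\<omega>. c * A \<omega>) (\<lambda>\<omega>. c * B \<omega>) = (\<integral>\<omega>. c * c * (A \<omega> * B \<omega>) \<partial>M)"
    unfolding cv_def by (simp add: algebra_simps)
  then show ?thesis by (simp add: cv_def)
qed

text \<open>The expectations of \<open>(A + B)^2\<close> and \<open>(A - B)^2\<close> are
  nonnegative. This replaces the derivative estimate for grid points that are too close to each
  other.\<close>

lemma cv_abs_le:
  assumes "A \<in> V" "B \<in> V"
  shows "2 * \<bar>cv A B\<bar> \<le> cv A A + cv B B"
proof -
  have I: "integrable M (\<lambda>\<omega>. A \<omega> * A \<omega>)" "integrable M (\<lambda>\<omega>. A \<omega> * B \<omega>)" "integrable M (\<lambda>\<omega>. B \<omega> * B \<omega>)"
    using cv_integrable assms by auto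
  have "0 \<le> (\<integral>\<omega>. (A \<omega> + s * B \<omega>)\<^sup>2 \<partial>M)" for s by simp
  moreover have "(\<integral>\<omega>. (A \<omega> + s * B \<omega>)\<^sup>2 \<partial>M) = cv A A + 2 * s * cv A B + cv B B" if "s * s = 1" for s
  proof -
    have "(A \<omega> + s * B \<omega>)\<^sup>2 = A \<omega> * A \<omega> + 2 * s * (A \<omega> * B \<omega>) + (s * s) * (B \<omega> * B \<omega>)" for \<omega>
      by (simp add: power2_eq_square algebra_simps)
    then have "(\<integral>\<omega>. (A \<omega> + s * B \<omega>)\<^sup>2 \<partial>M) = (\<integral>\<omega>. A \<omega> * A \<omega> + 2 * s * (A \<omega> * B \<omega>) + B \<omega> * B \<omega> \<partial>M)"
      by (simp add: that)
    then show ?thesis using I by (simp add: cv_def)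
  qed
  ultimately have "0 \<le> cv A A + 2 * s * cv A B + cv B B" if "s * s = 1" for s using that by metis
  from this[of 1] this[of "-1"] show ?thesis by (simp add: abs_le_iff)
qed

end

text \<open>The factor \<open>n^(\<alpha>/2)\<close> is the square root of the normalization in the
  estimator, so the squares of these variables are exactly its summands.\<close>

definition nincr :: "(real^2 \<Rightarrow> 'w \<Rightarrow> real) \<Rightarrow> (real^2 \<Rightarrow> real^2) \<Rightarrow> real \<Rightarrow> real^2 \<Rightarrow> nat \<Rightarrow> real^2 \<Rightarrow> 'w \<Rightarrow> real" where
  "nincr Z f \<alpha> h n w \<omega> = real n powr (\<alpha> / 2) * incr (h /\<^sub>R real n) (incr (h /\<^sub>R real n) ((\<lambda>s. Z s \<omega>) \<circ> f)) w"

lemma nincr_square: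
  assumes "1 \<le> n"
  shows "(nincr Z f \<alpha> h n w \<omega>)\<^sup>2 = (incr (h /\<^sub>R real n) (incr (h /\<^sub>R real n) ((\<lambda>s. Z s \<omega>) \<circ> f)) w)\<^sup>2 / real n powr (- \<alpha>)"
proof -
  have "(real n powr (\<alpha> / 2))\<^sup>2 = real n powr \<alpha>" using assms by (simp add: powr_power)
  then show ?thesis by (simp add: nincr_def power_mult_distrib powr_minus_divide)
qed

text \<open>A second difference annihilates the constant mean, so the increment belongs to the
  centred span. The three points are written as in \<open>sdiff_cov\<close>, including the trivial
  shift by \<open>0 *\<^sub>R h\<close>, so that covariances match term by term.\<close>

lemma nincr_eq:
  assumes "1 \<le> n"
  shows "nincr Z f \<alpha> h n w = (\<lambda>\<omega>. real n powr (\<alpha> / 2) *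
    ((Z (f (w + (2 * (1 / real n)) *\<^sub>R h)) \<omega> - \<mu>) - 2 * (Z (f (w + (1 / real n) *\<^sub>R h)) \<omega> - \<mu>) + (Z (f (w + 0 *\<^sub>R h)) \<omega> - \<mu>)))"
proof
  fix \<omega>
  have e: "w + (2 * (1 / real n)) *\<^sub>R h = w + h /\<^sub>R real n + h /\<^sub>R real n" "w + (1 / real n) *\<^sub>R h = w + h /\<^sub>R real n"
    "w + 0 *\<^sub>R h = w"
    unfolding mult_2 scaleR_add_left by (simp_all only: divide_inverse mult_1_left add.assoc scaleR_zero_left add_0_right)
  have lin: "(x - y) - (y - z) = (x - \<mu>) - 2 * (y - \<mu>) + (z - \<mu>)" for x y z by simp
  show "nincr Z f \<alpha> h n w \<omega> = real n powr (\<alpha> / 2) *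
    ((Z (f (w + (2 * (1 / real n)) *\<^sub>R h)) \<omega> - \<mu>) - 2 * (Z (f (w + (1 / real n) *\<^sub>R h)) \<omega> - \<mu>) + (Z (f (w + 0 *\<^sub>R h)) \<omega> - \<mu>))"
    unfolding e nincr_def incr_def o_def by (simp only: lin)
qed

locale stationary_field =
  fixes M :: "'w measure" and Z :: "real^2 \<Rightarrow> 'w \<Rightarrow> real" and R :: "real \<Rightarrow> real" and \<mu> :: real
  assumes ps: "prob_space M" and gf: "gaussian_field M Z" and mean: "\<And>t. (\<integral>\<omega>. Z t \<omega> \<partial>M) = \<mu>"
    and covar: "\<And>t s. covar M (Z t) (Z s) = R (norm (t - s))"
begin

sublocale gaussian_space M "lincombs Z \<mu>"
  by (rule gaussian_space_lincombs[OF ps gf mean])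

lemma cv_Z: "cv (\<lambda>\<omega>. Z t \<omega> - \<mu>) (\<lambda>\<omega>. Z s \<omega> - \<mu>) = R (norm (t - s))"
  using covar[of t s] by (simp add: covar_def mean cv_def)

lemma nincr_mem:
  assumes "1 \<le> n" shows "nincr Z f \<alpha> h n w \<in> lincombs Z \<mu>"
  unfolding nincr_eq[OF assms, of Z f \<alpha> h w \<mu>]
  by (intro scale_closed second_difference_closed lincombs_single)

lemma cv_nincr:
  assumes "1 \<le> n"
  shows "cv (nincr Z f \<alpha> h n w) (nincr Z f \<alpha> h n w') = (1 / real n) powr (-\<alpha>) * sdiff_cov R f h (1 / real n) w w'"
proof -
  let ?D = "\<lambda>w \<omega>. (Z (f (w + (2 * (1 / real n)) *\<^sub>R h)) \<omega> - \<mu>) - 2 * (Z (f (w + (1 / real n) *\<^sub>R h)) \<omega> - \<mu>) + (Z (f (w + 0 *\<^sub>R h)) \<omega> - \<mu>)"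
  have D: "?D w \<in> lincombs Z \<mu>" for w by (intro second_difference_closed lincombs_single)
  have one: "cv (\<lambda>\<omega>. Z t \<omega> - \<mu>) (?D w') = R (norm (t - f (w' + (2 * (1 / real n)) *\<^sub>R h)))
     - 2 * R (norm (t - f (w' + (1 / real n) *\<^sub>R h))) + R (norm (t - f (w' + 0 *\<^sub>R h)))" for t
  proof -
    have "cv (\<lambda>\<omega>. Z t \<omega> - \<mu>) (?D w') = cv (?D w') (\<lambda>\<omega>. Z t \<omega> - \<mu>)" by (rule cv_commute)
    also have "\<dots> = R (norm (f (w' + (2 * (1 / real n)) *\<^sub>R h) - t)) - 2 * R (norm (f (w' + (1 / real n) *\<^sub>R h) - t))
        + R (norm (f (w' + 0 *\<^sub>R h) - t))"
      by (subst cv_second_difference) (simp_all only: lincombs_single cv_Z)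
    finally show ?thesis by (simp only: norm_minus_commute[of t])
  qed
  have "cv (?D w) (?D w') = sdiff_cov R f h (1 / real n) w w'"
    by (subst cv_second_difference[OF lincombs_single lincombs_single lincombs_single D])
       (simp only: one sdiff_cov_def Let_def, simp add: algebra_simps)
  moreover have "real n powr (\<alpha> / 2) * real n powr (\<alpha> / 2) = (1 / real n) powr (-\<alpha>)"
    using assms by (simp add: powr_add[symmetric] powr_minus_divide powr_divide)
  ultimately show ?thesis
    unfolding nincr_eq[OF assms, of Z f \<alpha> h _ \<mu>] cv_scale by simp
qed

text \<open>Pairs at distance at least \<open>4 |h| / n\<close> are covered by the estimate away
  from the singularity. For closer pairs the bounded variances suffice, as the claimed decay factor
  is then bounded below.\<close>

lemma cv_nincr_bounds:
  assumes dl: "diffeo_line f h \<rho> B m" and \<alpha>: "0 < \<alpha>" "\<alpha> < 2" and "0 < \<gamma>" "0 < t0" "0 \<le> c"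
    and R0: "\<And>t. 0 \<le> t \<Longrightarrow> t \<le> t0 \<Longrightarrow> \<bar>R t - (R 0 - t powr \<alpha>)\<bar> \<le> t powr (\<alpha> + \<gamma>)"
    and R4: "\<And>t. 0 < t \<Longrightarrow> t \<le> t0 \<Longrightarrow> \<bar>(deriv ^^ 4) R t\<bar> \<le> c * t powr (\<alpha> - 4)"
    and CrR: "Cr_on 4 {0<..} R"
  obtains C K N where "0 \<le> C" "0 \<le> K" "1 \<le> N"
    "\<And>n w. n \<ge> N \<Longrightarrow> w \<in> cball 0 \<rho> \<Longrightarrow>
      \<bar>cv (nincr Z f \<alpha> h n w) (nincr Z f \<alpha> h n w) - (8 - 2 powr (\<alpha> + 1)) * norm (dirD h f w) powr \<alpha>\<bar>
        \<le> K * (1 / real n + (1 / real n) powr \<gamma>)"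
    "\<And>n w w'. n \<ge> N \<Longrightarrow> w \<in> cball 0 \<rho> \<Longrightarrow> w' \<in> cball 0 \<rho> \<Longrightarrow>
      \<bar>cv (nincr Z f \<alpha> h n w) (nincr Z f \<alpha> h n w')\<bar> \<le> C * (1 + norm (w - w') / (1 / real n)) powr (-(3 - \<alpha>))"
proof -
  interpret diffeo_line f h \<rho> B m by fact
  obtain K \<epsilon>0 where K: "0 \<le> K" "0 < \<epsilon>0" "\<epsilon>0 \<le> 1" and var: "\<And>\<epsilon> w. 0 < \<epsilon> \<Longrightarrow> \<epsilon> \<le> \<epsilon>0 \<Longrightarrow> w \<in> cball 0 \<rho> \<Longrightarrow>
     \<bar>\<epsilon> powr (-\<alpha>) * sdiff_cov R f h \<epsilon> w w - (8 - 2 powr (\<alpha> + 1)) * norm (dirD h f w) powr \<alpha>\<bar> \<le> K * (\<epsilon> + \<epsilon> powr \<gamma>)"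
    using sdiff_cov_variance[OF \<alpha> assms(4,5) R0] by blast
  \<comment> \<open>Below 1 the power \<open>\<alpha> + \<gamma>\<close> is dominated by the power
    \<alpha>; with the main term this gives the constant 2 in \<open>c1\<close>.\<close>
  define t1 where "t1 = min t0 1"
  define c1 where "c1 = max c 2"
  have t1: "0 < t1" "0 \<le> c1" using assms by (auto simp: t1_def c1_def)
  have Ra: "\<bar>R t - R 0\<bar> \<le> c1 * t powr \<alpha>" if t: "0 < t" "t \<le> t1" for t
  proof -
    have "t powr (\<alpha> + \<gamma>) \<le> t powr \<alpha>" using t assms by (intro powr_mono') (auto simp: t1_def)
    then have "\<bar>R t - R 0\<bar> \<le> 2 * t powr \<alpha>"
      using R0[of t] t powr_ge_zero[of t \<alpha>] by (simp add: t1_def abs_le_iff)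
    also have "\<dots> \<le> c1 * t powr \<alpha>" by (intro mult_right_mono) (auto simp: c1_def)
    finally show ?thesis .
  qed
  have Rb: "\<bar>(deriv ^^ 4) R t\<bar> \<le> c1 * t powr (\<alpha> - 4)" if t: "0 < t" "t \<le> t1" for t
  proof -
    have "\<bar>(deriv ^^ 4) R t\<bar> \<le> c * t powr (\<alpha> - 4)" using t by (intro R4) (auto simp: t1_def)
    also have "\<dots> \<le> c1 * t powr (\<alpha> - 4)" by (intro mult_right_mono) (auto simp: c1_def)
    finally show ?thesis .
  qed
  obtain K2 where K2: "0 \<le> K2" and far: "\<And>\<epsilon> w w'. 0 < \<epsilon> \<Longrightarrow> \<epsilon> \<le> 1 \<Longrightarrow> w \<in> cball 0 \<rho> \<Longrightarrow> w' \<in> cball 0 \<rho> \<Longrightarrow>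
     4 * norm h * \<epsilon> \<le> norm (w - w') \<Longrightarrow>
     \<bar>\<epsilon> powr (-\<alpha>) * sdiff_cov R f h \<epsilon> w w'\<bar> \<le> K2 * (norm (w - w') / \<epsilon>) powr (\<alpha> - 3)"
    using sdiff_cov_far[OF \<alpha> t1 Ra Rb CrR] by blast
  obtain N where N: "1 \<le> N" "1 / real N \<le> \<epsilon>0"
  proof -
    obtain N where "N \<noteq> 0" "inverse (real N) < \<epsilon>0" using real_arch_invD[OF K(2)] by blast
    then show thesis by (intro that[of N]) (auto simp: divide_inverse)
  qed
  have eps: "0 < 1 / real n" "1 / real n \<le> \<epsilon>0" "1 / real n \<le> 1" "1 \<le> n" if "n \<ge> N" for n
  proof -
    show "1 \<le> n" using that N by simp
    then show "0 < 1 / real n" "1 / real n \<le> 1" by simp_all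
    have "1 / real n \<le> 1 / real N" using that N by (intro divide_left_mono) auto
    then show "1 / real n \<le> \<epsilon>0" using N by linarith
  qed
  define Cv where "Cv = \<bar>8 - 2 powr (\<alpha> + 1)\<bar> * B powr \<alpha> + 2 * K"
  have Cv: "cv (nincr Z f \<alpha> h n w) (nincr Z f \<alpha> h n w) \<le> Cv" if n: "n \<ge> N" and w: "w \<in> cball 0 \<rho>" for n w
  proof -
    have w0: "w \<in> cball 0 (\<rho> + 2 * norm h)" using on_line[OF w, of 0] by simp
    have "(8 - 2 powr (\<alpha> + 1)) * norm (dirD h f w) powr \<alpha> \<le> \<bar>8 - 2 powr (\<alpha> + 1)\<bar> * B powr \<alpha>"
      using B1[OF w0] \<alpha> by (intro mult_mono powr_mono2) auto
    moreover have "K * (1 / real n + (1 / real n) powr \<gamma>) \<le> K * 2"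
    proof (intro mult_left_mono K)
      have "(1 / real n) powr \<gamma> \<le> 1 powr \<gamma>" using eps[OF n] assms by (intro powr_mono2) auto
      then have "(1 / real n) powr \<gamma> \<le> 1" by simp
      then show "1 / real n + (1 / real n) powr \<gamma> \<le> 2" using eps(3)[OF n] by linarith
    qed
    ultimately show ?thesis
      using var[OF eps(1,2)[OF n] w] unfolding cv_nincr[OF eps(4)[OF n]] Cv_def by linarith
  qed
  let ?k0 = "4 * norm h"
  have k0: "0 < ?k0" using h by simp
  define C where "C = \<bar>Cv\<bar> * (1 + ?k0) powr (3 - \<alpha>) + K2 * (1 + 1 / ?k0) powr (3 - \<alpha>)"
  have C1: "0 \<le> \<bar>Cv\<bar> * (1 + ?k0) powr (3 - \<alpha>)" "0 \<le> K2 * (1 + 1 / ?k0) powr (3 - \<alpha>)" using K2 by auto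
  show thesis
  proof (rule that[of C K N])
    show "0 \<le> C" using C1 by (simp add: C_def)
    show "0 \<le> K" "1 \<le> N" by fact+
    fix n and w :: "real^2" assume n: "n \<ge> N" and w: "w \<in> cball 0 \<rho>"
    show "\<bar>cv (nincr Z f \<alpha> h n w) (nincr Z f \<alpha> h n w) - (8 - 2 powr (\<alpha> + 1)) * norm (dirD h f w) powr \<alpha>\<bar>
        \<le> K * (1 / real n + (1 / real n) powr \<gamma>)"
      using var[OF eps(1,2)[OF n] w] unfolding cv_nincr[OF eps(4)[OF n]] .
    fix w' :: "real^2" assume w': "w' \<in> cball 0 \<rho>"
    let ?y = "norm (w - w') / (1 / real n)"
    have y: "0 \<le> ?y" by simp
    show "\<bar>cv (nincr Z f \<alpha> h n w) (nincr Z f \<alpha> h n w')\<bar> \<le> C * (1 + ?y) powr (-(3 - \<alpha>))"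
    proof (cases "?k0 * (1 / real n) \<le> norm (w - w')")
      case True
      then have yk: "?k0 \<le> ?y" using eps[OF n] by (simp add: field_simps)
      then have y0: "0 < ?y" using k0 by linarith
      have "\<bar>cv (nincr Z f \<alpha> h n w) (nincr Z f \<alpha> h n w')\<bar> \<le> K2 * ?y powr (\<alpha> - 3)"
        using far[OF eps(1,3)[OF n] w w' True] unfolding cv_nincr[OF eps(4)[OF n]] .
      also have "?y powr (\<alpha> - 3) \<le> (1 + 1 / ?k0) powr (3 - \<alpha>) * (1 + ?y) powr (\<alpha> - 3)"
      proof -
        \<comment> \<open>Since \<open>?y\<close> is at least \<open>?k0\<close>, the summand 1 is
          at most \<open>?y / ?k0\<close>. So the decay in \<open>?y\<close> is comparable with the
          decay in \<open>1 + ?y\<close>.\<close>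
        have "1 + ?y \<le> (1 + 1 / ?k0) * ?y" using yk k0 by (simp add: field_simps)
        then have "(1 + ?y) powr (3 - \<alpha>) \<le> ((1 + 1 / ?k0) * ?y) powr (3 - \<alpha>)"
          using \<alpha> y by (intro powr_mono2) auto
        also have "\<dots> = (1 + 1 / ?k0) powr (3 - \<alpha>) * ?y powr (3 - \<alpha>)" by (rule powr_mult)
        finally have "(1 + ?y) powr (3 - \<alpha>) * (?y powr (\<alpha> - 3) * (1 + ?y) powr (\<alpha> - 3)) \<le>
           ((1 + 1 / ?k0) powr (3 - \<alpha>) * ?y powr (3 - \<alpha>)) * (?y powr (\<alpha> - 3) * (1 + ?y) powr (\<alpha> - 3))"
          by (intro mult_right_mono) auto
        moreover have "z powr (3 - \<alpha>) * z powr (\<alpha> - 3) = 1" if "0 < z" for z using that by (simp add: powr_add[symmetric])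
        from this[of ?y] this[of "1 + ?y"] have "?y powr (3 - \<alpha>) * ?y powr (\<alpha> - 3) = 1" "(1 + ?y) powr (3 - \<alpha>) * (1 + ?y) powr (\<alpha> - 3) = 1"
          using y0 by auto
        moreover have "P * (Q * P') \<le> (A * S) * (Q * P') \<Longrightarrow> S * Q = 1 \<Longrightarrow> P * P' = 1 \<Longrightarrow> Q \<le> A * P'" for P Q P' A S :: real
        proof -
          assume a: "P * (Q * P') \<le> (A * S) * (Q * P')" "S * Q = 1" "P * P' = 1"
          have "Q * (P * P') \<le> A * (S * Q) * P'" using a(1) by (simp only: mult_ac)
          then show "Q \<le> A * P'" unfolding a(2,3) by simp
        qed
        ultimately show ?thesis by blast
      qed
      finally have "\<bar>cv (nincr Z f \<alpha> h n w) (nincr Z f \<alpha> h n w')\<bar> \<le> K2 * ((1 + 1 / ?k0) powr (3 - \<alpha>) * (1 + ?y) powr (\<alpha> - 3))"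
        using K2 by (simp add: mult_left_mono)
      also have "\<dots> = K2 * (1 + 1 / ?k0) powr (3 - \<alpha>) * (1 + ?y) powr (-(3 - \<alpha>))" by simp
      also have "\<dots> \<le> C * (1 + ?y) powr (-(3 - \<alpha>))"
        unfolding C_def using C1 by (intro mult_right_mono) auto
      finally show ?thesis .
    next
      case False
      then have yk: "?y \<le> ?k0" using eps[OF n] by (simp add: field_simps)
      \<comment> \<open>Close pairs: the constant variance bound is multiplied and divided by the
        decay factor at the largest possible \<open>?y\<close>.\<close>
      have "\<bar>cv (nincr Z f \<alpha> h n w) (nincr Z f \<alpha> h n w')\<bar> \<le> \<bar>Cv\<bar>"
        using cv_abs_le[OF nincr_mem[OF eps(4)[OF n]] nincr_mem[OF eps(4)[OF n]], of f \<alpha> h w f \<alpha> h w'] Cv[OF n w] Cv[OF n w'] by linarith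
      also have "\<dots> = \<bar>Cv\<bar> * ((1 + ?k0) powr (3 - \<alpha>) * (1 + ?k0) powr (-(3 - \<alpha>)))"
      proof -
        have "1 + ?k0 \<noteq> 0" using k0 by linarith
        then show ?thesis by (simp add: powr_add[symmetric])
      qed
      also have "\<dots> \<le> \<bar>Cv\<bar> * ((1 + ?k0) powr (3 - \<alpha>) * (1 + ?y) powr (-(3 - \<alpha>)))"
      proof -
        have "0 < 1 + ?y" using y by linarith
        then show ?thesis using yk \<alpha> by (intro mult_left_mono powr_mono2') auto
      qed
      also have "\<dots> \<le> C * (1 + ?y) powr (-(3 - \<alpha>))"
        unfolding C_def mult.assoc[symmetric] using C1 by (intro mult_right_mono) auto
      finally show ?thesis .
    qed
  qed
qed

end

subsection \<open>Convergence of the expectation\<close>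

text \<open>Uniform continuity of the partial derivatives on the ball of radius
  \<open>\<rho> + 1\<close> makes \<delta> independent of the base point \<open>t\<close>. The mean
  value inequality for \<open>g\<close> minus its linear part at \<open>t\<close> does the rest;
  \<open>\<delta> \<le> 1\<close> keeps the points in that ball.\<close>

lemma derivative_uniform:
  fixes g :: "real^2 \<Rightarrow> real"
  assumes der: "\<And>x. (g has_derivative g' x) (at x)"
    and cont: "\<And>i. continuous_on UNIV (\<lambda>x. g' x (axis i 1))" and "0 < \<eta>"
  obtains \<delta> where "0 < \<delta>" "\<And>t w. norm t \<le> \<rho> \<Longrightarrow> norm (w - t) \<le> \<delta> \<Longrightarrow> \<bar>g w - g t - g' t (w - t)\<bar> \<le> \<eta> * norm (w - t)"
proof -
  let ?D = "cball 0 (\<rho> + 1) :: (real^2) set"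
  have "\<exists>d>0. \<forall>x\<in>?D. \<forall>y\<in>?D. dist y x < d \<longrightarrow> dist (g' y (axis i 1)) (g' x (axis i 1)) < \<eta> / 2" for i
  proof -
    have "uniformly_continuous_on ?D (\<lambda>x. g' x (axis i 1))"
      by (intro compact_uniformly_continuous continuous_on_subset[OF cont]) auto
    then show ?thesis unfolding uniformly_continuous_on_def using half_gt_zero[OF \<open>0 < \<eta>\<close>] by blast
  qed
  then obtain d where d: "\<And>i. 0 < d i" "\<And>i x y. x \<in> ?D \<Longrightarrow> y \<in> ?D \<Longrightarrow> dist y x < d i \<Longrightarrow> \<bar>g' y (axis i 1) - g' x (axis i 1)\<bar> < \<eta> / 2"
    unfolding dist_real_def by metis
  define \<delta> where "\<delta> = min 1 (min (d 1) (d 2)) / 2"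
  have \<delta>: "0 < \<delta>" "\<delta> \<le> 1" "\<delta> < d 1" "\<delta> < d 2" using d(1)[of 1] d(1)[of 2] by (auto simp: \<delta>_def min_def)
  show thesis
  proof (rule that[OF \<delta>(1)])
    fix t w :: "real^2" assume t: "norm t \<le> \<rho>" and w: "norm (w - t) \<le> \<delta>"
    have lin: "linear (g' x)" for x by (rule has_derivative_linear[OF der])
    have g2: "g' x k = k $ 1 * g' x (axis 1 1) + k $ 2 * g' x (axis 2 1)" for x k
      using dirD_eqI[OF der, of k x] dirD_2[of k g x] partial_deriv_eqI[OF der, of _ x] by simp
    have "norm ((g w - g' t w) - (g t - g' t t)) \<le> \<eta> * norm (w - t)"
    proof (rule differentiable_bound[of "cball t \<delta>" "\<lambda>x. g x - g' t x" "\<lambda>x k. g' x k - g' t k"])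
      fix x assume x: "x \<in> cball t \<delta>"
      show "((\<lambda>x. g x - g' t x) has_derivative (\<lambda>k. g' x k - g' t k)) (at x within cball t \<delta>)"
        by (intro has_derivative_diff has_derivative_at_withinI[OF der] linear_imp_has_derivative lin)
      have xD: "x \<in> ?D" "t \<in> ?D"
        using x t \<delta>(2) norm_triangle_ineq[of t "x - t"] by (auto simp: dist_norm norm_minus_commute)
      have "\<bar>g' x (axis i 1) - g' t (axis i 1)\<bar> \<le> \<eta> / 2" if "\<delta> < d i" for i
        using d(2)[OF xD(2,1), of i] x that by (auto simp: dist_commute intro: less_imp_le)
      then have c: "\<bar>g' x (axis 1 1) - g' t (axis 1 1)\<bar> \<le> \<eta> / 2" "\<bar>g' x (axis 2 1) - g' t (axis 2 1)\<bar> \<le> \<eta> / 2"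
        using \<delta> by auto
      show "onorm (\<lambda>k. g' x k - g' t k) \<le> \<eta>"
      proof (rule onorm_bound)
        fix k :: "real^2"
        have "g' x k - g' t k = k $ 1 * (g' x (axis 1 1) - g' t (axis 1 1)) + k $ 2 * (g' x (axis 2 1) - g' t (axis 2 1))"
          unfolding g2[of x k] g2[of t k] by (simp add: algebra_simps)
        also have "norm \<dots> \<le> \<bar>k $ 1\<bar> * \<bar>g' x (axis 1 1) - g' t (axis 1 1)\<bar> + \<bar>k $ 2\<bar> * \<bar>g' x (axis 2 1) - g' t (axis 2 1)\<bar>"
          unfolding real_norm_def abs_mult[symmetric] by (rule abs_triangle_ineq)
        also have "\<dots> \<le> norm k * (\<eta> / 2) + norm k * (\<eta> / 2)"
          using c by (intro add_mono mult_mono norm_component_le) auto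
        finally show "norm (g' x k - g' t k) \<le> \<eta> * norm k" by (simp add: mult.commute)
      qed (use \<open>0 < \<eta>\<close> in simp)
    qed (use w \<delta>(1) in \<open>auto simp: dist_norm norm_minus_commute\<close>)
    then show "\<bar>g w - g t - g' t (w - t)\<bar> \<le> \<eta> * norm (w - t)"
      by (simp add: linear_diff[OF lin] algebra_simps)
  qed
qed

lemma lattice_scale:
  assumes "0 < b"
  shows "lattice (\<epsilon> / b) = (\<lambda>w. w /\<^sub>R b) ` lattice \<epsilon>"
  unfolding lattice_def image_image by (intro image_cong refl) (simp add: divide_inverse mult.commute)

text \<open>Division by \<open>b\<close> turns the lattice of mesh \<open>1/n\<close> into one of
  mesh \<open>1/(n b)\<close>, to which the unscaled Riemann sum bound applies.\<close>

lemma Riemann_sum_scaled: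
  fixes \<phi> :: "real^2 \<Rightarrow> real"
  assumes Lip: "\<And>x y. \<bar>\<phi> x - \<phi> y\<bar> \<le> L * norm (x - y)" and L: "0 \<le> L" and r: "0 \<le> r"
    and supp: "\<And>x. r < norm x \<Longrightarrow> \<phi> x = 0"
  obtains C where "0 \<le> C" "\<And>n b t S. 1 \<le> n \<Longrightarrow> 0 < b \<Longrightarrow> 1 \<le> real n * b \<Longrightarrow> finite S \<Longrightarrow> S \<subseteq> lattice (1 / real n) \<Longrightarrow>
     {w \<in> lattice (1 / real n). norm (w - t) \<le> r * b} \<subseteq> S \<Longrightarrow>
     \<bar>1 / ((real n)\<^sup>2 * b\<^sup>2) * (\<Sum>w\<in>S. \<phi> ((w - t) /\<^sub>R b)) - (\<integral>x. \<phi> x \<partial>lborel)\<bar> \<le> C / (real n * b)"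
proof -
  obtain C where C: "0 \<le> C" and RS: "\<And>\<epsilon> \<tau> S. 0 < \<epsilon> \<Longrightarrow> \<epsilon> \<le> 1 \<Longrightarrow> finite S \<Longrightarrow> S \<subseteq> lattice \<epsilon> \<Longrightarrow>
     {w \<in> lattice \<epsilon>. norm (w - \<tau>) \<le> r} \<subseteq> S \<Longrightarrow>
     \<bar>\<epsilon>\<^sup>2 * (\<Sum>w\<in>S. \<phi> (w - \<tau>)) - (\<integral>x. \<phi> x \<partial>lborel)\<bar> \<le> C * \<epsilon>"
    by (rule lattice_Riemann_sum[OF Lip L r supp]; (assumption | (rule that, assumption+)))
  show thesis
  proof (rule that[OF C])
    fix n b t S assume n: "1 \<le> n" and b: "0 < (b::real)" "1 \<le> real n * b" and S: "finite S" "S \<subseteq> lattice (1 / real n)"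
     "{w \<in> lattice (1 / real n). norm (w - t) \<le> r * b} \<subseteq> S"
    let ?\<epsilon> = "1 / real n / b" and ?s = "\<lambda>w::real^2. w /\<^sub>R b"
    have \<epsilon>: "0 < ?\<epsilon>" "?\<epsilon> \<le> 1" using n b by (auto simp: field_simps)
    have "{w \<in> lattice ?\<epsilon>. norm (w - ?s t) \<le> r} \<subseteq> ?s ` S"
    proof
      fix x assume "x \<in> {w \<in> lattice ?\<epsilon>. norm (w - ?s t) \<le> r}"
      then obtain w where w: "w \<in> lattice (1 / real n)" "x = ?s w" "norm (?s w - ?s t) \<le> r"
        unfolding lattice_scale[OF b(1)] by auto
      have "norm (?s w - ?s t) = norm (w - t) / b"
        unfolding scaleR_diff_right[symmetric] using b(1) by (simp add: divide_inverse mult.commute)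
      then have "norm (w - t) \<le> r * b" using w(3) b(1) by (simp add: pos_divide_le_eq)
      then show "x \<in> ?s ` S" using w S(3) by auto
    qed
    moreover have "?s ` S \<subseteq> lattice ?\<epsilon>" unfolding lattice_scale[OF b(1)] using S(2) by (rule image_mono)
    ultimately have "\<bar>?\<epsilon>\<^sup>2 * (\<Sum>w\<in>?s ` S. \<phi> (w - ?s t)) - (\<integral>x. \<phi> x \<partial>lborel)\<bar> \<le> C * ?\<epsilon>"
      using S(1) by (intro RS \<epsilon>) auto
    moreover have "(\<Sum>w\<in>?s ` S. \<phi> (w - ?s t)) = (\<Sum>w\<in>S. \<phi> ((w - t) /\<^sub>R b))"
      using b(1) by (subst sum.reindex) (auto simp: inj_on_def scaleR_diff_right)
    ultimately show "\<bar>1 / ((real n)\<^sup>2 * b\<^sup>2) * (\<Sum>w\<in>S. \<phi> ((w - t) /\<^sub>R b)) - (\<integral>x. \<phi> x \<partial>lborel)\<bar> \<le> C / (real n * b)"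
      by (simp add: power_divide power_mult_distrib)
  qed
qed

text \<open>The values \<open>v n w\<close> are split into their error against \<open>g\<close>, the
  Taylor remainder of \<open>g\<close> at \<open>t\<close>, and the constant and linear Taylor
  terms. The last two become Riemann sums for the known moments of \<kappa>.\<close>

lemma bias_uniform_limit:
  fixes \<kappa> g :: "real^2 \<Rightarrow> real" and v :: "nat \<Rightarrow> real^2 \<Rightarrow> real" and b :: "nat \<Rightarrow> real"
  assumes \<kappa>: "0 < r" "0 < L" "0 < B" "\<And>x. r < norm x \<Longrightarrow> \<kappa> x = 0"
    "\<And>x y. \<bar>\<kappa> x - \<kappa> y\<bar> \<le> L * norm (x - y)" "\<And>x. \<bar>\<kappa> x\<bar> \<le> B"
    "(\<integral>x. \<kappa> x \<partial>lborel) = 0" "\<And>i. (\<integral>x. \<kappa> x * x $ i \<partial>lborel) = - u $ i"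
    and g: "\<And>x. (g has_derivative g' x) (at x)" "\<And>i. continuous_on UNIV (\<lambda>x. g' x (axis i 1))"
    and \<Theta>: "compact \<Theta>" "\<Theta> \<subseteq> \<Omega>" "open \<Omega>" "\<Omega> \<subseteq> cball 0 \<rho>"
    and v: "0 \<le> Kv" "\<And>n w. n \<ge> N \<Longrightarrow> w \<in> cball 0 \<rho> \<Longrightarrow> \<bar>v n w - g w\<bar> \<le> Kv * (1 / real n + (1 / real n) powr \<gamma>)"
    and b: "\<And>n. n \<ge> N \<Longrightarrow> 0 < b n \<and> b n \<le> 1 \<and> 1 \<le> real n * b n" "b \<longlonglongrightarrow> 0" "1 \<le> N"
    and b4: "\<And>n. n \<ge> N \<Longrightarrow> 1 / (real n * b n ^ 4) \<le> Cb * real n powr (-\<beta>)" "0 < Cb"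
    and \<beta>: "0 < \<beta>" "1 - 4 * \<gamma> < \<beta>"
  shows "uniform_limit \<Theta> (\<lambda>n t. - (1 / ((real n)\<^sup>2 * b n ^ 3)) * (\<Sum>w\<in>grid \<Omega> n. \<kappa> ((w - t) /\<^sub>R b n) * v n w))
     (\<lambda>t. g' t u) sequentially"
proof (rule uniform_limitI)
  fix e :: real assume "0 < e"
  have lin: "linear (g' x)" for x by (rule has_derivative_linear[OF g(1)])
  have g2: "g' x k = k $ 1 * g' x (axis 1 1) + k $ 2 * g' x (axis 2 1)" for x k
    using dirD_eqI[OF g(1), of k x] dirD_2[of k g x] partial_deriv_eqI[OF g(1), of _ x] by simp
  have gcont: "continuous_on UNIV g"
    using g(1) by (meson continuous_at_imp_continuous_on has_derivative_continuous)
  obtain G0 where G0: "0 < G0" "\<And>x. x \<in> cball 0 \<rho> \<Longrightarrow> norm (g x) \<le> G0"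
    by (rule continuous_bounded_on_cball[OF gcont]) blast
  obtain G1 where G1: "0 < G1" "\<And>x. x \<in> cball 0 \<rho> \<Longrightarrow> norm (g' x (axis 1 1)) \<le> G1"
    by (rule continuous_bounded_on_cball[OF g(2)[of 1]]) blast
  obtain G2 where G2: "0 < G2" "\<And>x. x \<in> cball 0 \<rho> \<Longrightarrow> norm (g' x (axis 2 1)) \<le> G2"
    by (rule continuous_bounded_on_cball[OF g(2)[of 2]]) blast
  have rn: "0 \<le> r" "0 \<le> L" "0 \<le> B" using \<kappa> by auto
  obtain C0 where C0: "0 \<le> C0" and RS0: "\<And>n b t S. 1 \<le> n \<Longrightarrow> 0 < b \<Longrightarrow> 1 \<le> real n * b \<Longrightarrow> finite S \<Longrightarrow> S \<subseteq> lattice (1 / real n) \<Longrightarrow>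
     {w \<in> lattice (1 / real n). norm (w - t) \<le> r * b} \<subseteq> S \<Longrightarrow>
     \<bar>1 / ((real n)\<^sup>2 * b\<^sup>2) * (\<Sum>w\<in>S. \<kappa> ((w - t) /\<^sub>R b)) - (\<integral>x. \<kappa> x \<partial>lborel)\<bar> \<le> C0 / (real n * b)"
    by (rule Riemann_sum_scaled[OF \<kappa>(5) rn(2) rn(1) \<kappa>(4)]; (assumption | (rule that, assumption+)))
  \<comment> \<open>The Riemann sum bound is packaged as a predicate so that one constant per
    coordinate can be chosen.\<close>
  define P where "P i C \<longleftrightarrow> 0 \<le> C \<and> (\<forall>n b t S. 1 \<le> n \<longrightarrow> 0 < b \<longrightarrow> 1 \<le> real n * b \<longrightarrow> finite S \<longrightarrow> S \<subseteq> lattice (1 / real n) \<longrightarrow>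
     {w \<in> lattice (1 / real n). norm (w - t) \<le> r * b} \<subseteq> S \<longrightarrow>
     \<bar>1 / ((real n)\<^sup>2 * b\<^sup>2) * (\<Sum>w\<in>S. \<kappa> ((w - t) /\<^sub>R b) * ((w - t) /\<^sub>R b) $ i) + u $ i\<bar> \<le> C / (real n * b))" for i C
  have "\<exists>C. P i C" for i
  proof -
    have Ln: "0 \<le> L * r + B" using rn by simp
    have sup: "\<kappa> x * x $ i = 0" if "r < norm x" for x using \<kappa>(4)[OF that] by simp
    obtain C where "0 \<le> C" "\<And>n b t S. 1 \<le> n \<Longrightarrow> 0 < b \<Longrightarrow> 1 \<le> real n * b \<Longrightarrow> finite S \<Longrightarrow> S \<subseteq> lattice (1 / real n) \<Longrightarrow>
     {w \<in> lattice (1 / real n). norm (w - t) \<le> r * b} \<subseteq> S \<Longrightarrow>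
     \<bar>1 / ((real n)\<^sup>2 * b\<^sup>2) * (\<Sum>w\<in>S. \<kappa> ((w - t) /\<^sub>R b) * ((w - t) /\<^sub>R b) $ i) - (\<integral>x. \<kappa> x * x $ i \<partial>lborel)\<bar> \<le> C / (real n * b)"
      by (rule Riemann_sum_scaled[OF Lipschitz_mult_component[OF \<kappa>(5,6,4) rn(2,3,1), where i=i] Ln rn(1) sup];
          (assumption | (rule that, assumption+)))
    then show ?thesis unfolding \<kappa>(8) P_def by (intro exI[of _ C]) simp
  qed
  then obtain Ci where "\<And>i. P i (Ci i)" by metis
  then have Ci: "\<And>i. 0 \<le> Ci i" and RSi: "\<And>i n b t S. 1 \<le> n \<Longrightarrow> 0 < b \<Longrightarrow> 1 \<le> real n * b \<Longrightarrow> finite S \<Longrightarrow> S \<subseteq> lattice (1 / real n) \<Longrightarrow>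
     {w \<in> lattice (1 / real n). norm (w - t) \<le> r * b} \<subseteq> S \<Longrightarrow>
     \<bar>1 / ((real n)\<^sup>2 * b\<^sup>2) * (\<Sum>w\<in>S. \<kappa> ((w - t) /\<^sub>R b) * ((w - t) /\<^sub>R b) $ i) + u $ i\<bar> \<le> Ci i / (real n * b)"
    unfolding P_def by auto
  define A1 where "A1 = (2 * r + 1)\<^sup>2 * B * Kv"
  define A2 where "A2 = (2 * r + 1)\<^sup>2 * B * r"
  have A: "0 \<le> A1" "0 \<le> A2" using rn v(1) by (auto simp: A1_def A2_def)
  \<comment> \<open>The summand 1 avoids a division by 0, and the total weight \<open>A2\<close> of
    the Taylor remainder is then compensated to below \<open>e / 2\<close>.\<close>
  define \<eta> where "\<eta> = e / (2 * (A2 + 1))"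
  have \<eta>: "0 < \<eta>" "A2 * \<eta> < e / 2" using \<open>0 < e\<close> A by (auto simp: \<eta>_def field_simps)
  obtain \<delta> where \<delta>: "0 < \<delta>" "\<And>t w. norm t \<le> \<rho> \<Longrightarrow> norm (w - t) \<le> \<delta> \<Longrightarrow> \<bar>g w - g t - g' t (w - t)\<bar> \<le> \<eta> * norm (w - t)"
    by (rule derivative_uniform[OF g \<eta>(1)]) blast
  \<comment> \<open>The positive distance from \<Theta> to the complement of \<Omega>: once
    \<open>r b\<close> is smaller, every scaled kernel centred in \<Theta> has its support inside
    \<Omega>, and no boundary effect remains.\<close>
  obtain \<delta>2 where \<delta>2: "0 < \<delta>2" "\<And>t. t \<in> \<Theta> \<Longrightarrow> cball t \<delta>2 \<subseteq> \<Omega>"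
  proof -
    have "\<Theta> \<inter> - \<Omega> = {}" "closed (- \<Omega>)" using \<Theta> by auto
    from separate_compact_closed[OF \<Theta>(1) this(2) this(1)]
    obtain d where d: "0 < d" "\<And>x y. x \<in> \<Theta> \<Longrightarrow> y \<in> - \<Omega> \<Longrightarrow> d \<le> dist x y" by auto
    show thesis
    proof (rule that[of "d / 2"])
      show "cball t (d / 2) \<subseteq> \<Omega>" if "t \<in> \<Theta>" for t
      proof
        fix y assume "y \<in> cball t (d / 2)"
        then show "y \<in> \<Omega>" using d(2)[OF that, of y] d(1) by force
      qed
    qed (use d in simp)
  qed
  define z where "z n = Cb * real n powr (-\<beta>)" for n
  \<comment> \<open>The bound for the variance error divided by \<open>b\<close>. With
    \<open>1 / b\<close> of order \<open>n^((1 - \<beta>)/4)\<close>, the exponents are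
    \<open>(1 - \<beta>)/4 - 1\<close> and \<open>(1 - \<beta>)/4 - \<gamma>\<close>; the second is
    negative exactly by \<open>1 - 4 \<gamma> < \<beta>\<close>.\<close>
  define e1 where "e1 n = Cb powr (1/4) * (real n powr (-(3 + \<beta>)/4) + real n powr ((1 - \<beta> - 4 * \<gamma>)/4))" for n
  define s where "s n = A1 * e1 n + (G0 * C0 + G1 * Ci 1 + G2 * Ci 2) * z n" for n
  have tz: "(\<lambda>n. real n powr p) \<longlonglongrightarrow> 0" if "p < 0" for p :: real
    using that by (intro tendsto_neg_powr filterlim_real_sequentially)
  have "s \<longlonglongrightarrow> A1 * (Cb powr (1/4) * (0 + 0)) + (G0 * C0 + G1 * Ci 1 + G2 * Ci 2) * (Cb * 0)"
    unfolding s_def e1_def z_def using \<beta> by (intro tendsto_intros tz) auto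
  then have s: "\<forall>\<^sub>F n in sequentially. s n < e / 2" using \<open>0 < e\<close> by (intro order_tendstoD) auto
  have "(\<lambda>n. r * b n) \<longlonglongrightarrow> r * 0" by (intro tendsto_intros b)
  then have rb: "\<forall>\<^sub>F n in sequentially. r * b n < min \<delta> \<delta>2" using \<delta> \<delta>2 by (intro order_tendstoD) auto
  show "\<forall>\<^sub>F n in sequentially. \<forall>t\<in>\<Theta>. dist (- (1 / ((real n)\<^sup>2 * b n ^ 3)) * (\<Sum>w\<in>grid \<Omega> n. \<kappa> ((w - t) /\<^sub>R b n) * v n w)) (g' t u) < e"
    using s rb eventually_ge_at_top[of N]
  proof eventually_elim
    case (elim n)
    note n = elim(3)
    have x: "1 \<le> n" "0 < b n" "b n \<le> 1" "1 \<le> real n * b n" "0 < real n" using b(1)[OF n] n b(3) by auto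
    let ?x = "real n" and ?c = "1 / ((real n)\<^sup>2 * b n ^ 3)"
    have c: "0 < ?c" using x by simp
    \<comment> \<open>As \<open>b \<le> 1\<close>, both quantities are below
      \<open>1 / (n b^4)\<close>, to which the bandwidth condition applies.\<close>
    have zb: "1 / (?x * b n) \<le> z n" "1 / (?x * (b n)\<^sup>2) \<le> z n"
    proof -
      have "b n ^ 4 \<le> b n ^ 1" "b n ^ 4 \<le> (b n)\<^sup>2" using x by (intro power_decreasing; simp)+
      then have "1 / (?x * b n) \<le> 1 / (?x * b n ^ 4)" "1 / (?x * (b n)\<^sup>2) \<le> 1 / (?x * b n ^ 4)"
        using x by (intro divide_left_mono mult_left_mono mult_pos_pos; simp)+
      then show "1 / (?x * b n) \<le> z n" "1 / (?x * (b n)\<^sup>2) \<le> z n" using b4(1)[OF n] by (auto simp: z_def)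
    qed
    have e1: "1 / b n * (1 / ?x + (1 / ?x) powr \<gamma>) \<le> e1 n"
    proof -
      have b4': "b n ^ 4 = b n powr 4" using x by (simp add: powr_numeral)
      have "(b n ^ 4) powr (1/4) = b n" unfolding b4' powr_powr using x by simp
      then have "1 / b n = (1 / b n ^ 4) powr (1/4)" using x by (simp add: powr_divide)
      also have "\<dots> \<le> (Cb * ?x powr (1 - \<beta>)) powr (1/4)"
      proof (rule powr_mono2)
        have "1 / b n ^ 4 = ?x * (1 / (?x * b n ^ 4))" using x by simp
        also have "\<dots> \<le> ?x * (Cb * ?x powr (-\<beta>))" using b4(1)[OF n] by (intro mult_left_mono) auto
        also have "\<dots> = Cb * ?x powr (1 - \<beta>)" using x by (simp add: powr_diff powr_minus_divide)
        finally show "1 / b n ^ 4 \<le> Cb * ?x powr (1 - \<beta>)" .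
      qed (use x in auto)
      also have "\<dots> = Cb powr (1/4) * ?x powr ((1 - \<beta>)/4)" by (simp add: powr_mult powr_powr)
      finally have "1 / b n * (1 / ?x + (1 / ?x) powr \<gamma>) \<le> (Cb powr (1/4) * ?x powr ((1 - \<beta>)/4)) * (1 / ?x + (1 / ?x) powr \<gamma>)"
        by (intro mult_right_mono) auto
      also have "\<dots> = Cb powr (1/4) * (?x powr ((1 - \<beta>)/4) * ?x powr (-1) + ?x powr ((1 - \<beta>)/4) * ?x powr (-\<gamma>))"
        using x by (simp add: powr_minus_divide powr_divide algebra_simps)
      also have "\<dots> = e1 n"
        unfolding e1_def powr_add[symmetric] by (intro arg_cong2[where f="(*)"] arg_cong2[where f="(+)"] arg_cong2[where f="(powr)"] refl) (simp_all add: field_simps)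
      finally show ?thesis .
    qed
    show ?case
    proof
      fix t assume t: "t \<in> \<Theta>"
      have t\<rho>: "t \<in> cball 0 \<rho>" "norm t \<le> \<rho>" using t \<Theta> by auto
      let ?S = "{w \<in> lattice (1 / ?x). norm (w - t) \<le> r * b n}"
      have fS: "finite ?S" and cS: "real (card ?S) \<le> (2 * r + 1)\<^sup>2 * (?x * b n)\<^sup>2"
        using lattice_scaled_card[OF x(1) rn(1) x(4)] by auto
      have S\<Omega>: "?S \<subseteq> \<Omega>" using \<delta>2(2)[OF t] elim(2) by (auto simp: dist_norm norm_minus_commute)
      have S\<rho>: "?S \<subseteq> cball 0 \<rho>" using S\<Omega> \<Theta>(4) by blast
      have k0: "\<kappa> ((w - t) /\<^sub>R b n) = 0" if "r * b n < norm (w - t)" for w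
      proof (rule \<kappa>(4))
        have "norm ((w - t) /\<^sub>R b n) = norm (w - t) / b n" using x by (simp add: divide_inverse mult.commute)
        then show "r < norm ((w - t) /\<^sub>R b n)" using that x by (simp only: pos_less_divide_eq)
      qed
      \<comment> \<open>On the support of the scaled kernel the grid is the full lattice, as
        required for the Riemann sums.\<close>
      have gS: "(\<Sum>w\<in>grid \<Omega> n. \<kappa> ((w - t) /\<^sub>R b n) * v n w) = (\<Sum>w\<in>?S. \<kappa> ((w - t) /\<^sub>R b n) * v n w)"
      proof (rule sum.mono_neutral_right)
        have "grid \<Omega> n \<subseteq> {w \<in> lattice (1 / ?x). norm (w - 0) \<le> \<bar>\<rho>\<bar>}"
          using \<Theta>(4) by (auto simp: grid_eq_lattice)
        then show "finite (grid \<Omega> n)" using lattice_ball_card(1)[of "1 / ?x" "\<bar>\<rho>\<bar>" 0] x by (simp add: finite_subset)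
        show "?S \<subseteq> grid \<Omega> n" using S\<Omega> by (auto simp: grid_eq_lattice)
        show "\<forall>w\<in>grid \<Omega> n - ?S. \<kappa> ((w - t) /\<^sub>R b n) * v n w = 0"
          using k0 by (auto simp: grid_eq_lattice not_le)
      qed
      let ?k = "\<lambda>w. \<kappa> ((w - t) /\<^sub>R b n)"
      let ?T1 = "?c * (\<Sum>w\<in>?S. ?k w * (v n w - g w))"
      let ?T2 = "?c * (\<Sum>w\<in>?S. ?k w * (g w - g t - g' t (w - t)))"
      let ?Zs = "1 / (?x\<^sup>2 * (b n)\<^sup>2) * (\<Sum>w\<in>?S. ?k w)"
      let ?Si = "\<lambda>i. 1 / (?x\<^sup>2 * (b n)\<^sup>2) * (\<Sum>w\<in>?S. ?k w * ((w - t) /\<^sub>R b n) $ i)"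
      \<comment> \<open>At most a multiple of \<open>(n b)^2\<close> active points, each weighted by
        \<open>1 / (n^2 b^3)\<close>: a uniform error \<open>D\<close> is amplified to order
        \<open>D / b\<close>.\<close>
      have bound: "\<bar>?c * (\<Sum>w\<in>?S. ?k w * F w)\<bar> \<le> (2 * r + 1)\<^sup>2 * B * D / b n"
        if "\<And>w. w \<in> ?S \<Longrightarrow> \<bar>F w\<bar> \<le> D" "0 \<le> D" for F D
      proof -
        have "\<bar>\<Sum>w\<in>?S. ?k w * F w\<bar> \<le> (\<Sum>w\<in>?S. B * D)"
          unfolding abs_mult
        proof (rule order_trans[OF sum_abs], rule sum_mono)
          fix w assume w: "w \<in> ?S"
          show "\<bar>?k w * F w\<bar> \<le> B * D"
            unfolding abs_mult by (intro mult_mono \<kappa>(6) that(1)[OF w] rn) simp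
        qed
        also have "\<dots> = real (card ?S) * (B * D)" by simp
        also have "\<dots> \<le> ((2 * r + 1)\<^sup>2 * (?x * b n)\<^sup>2) * (B * D)" using rn that(2) by (intro mult_right_mono cS) auto
        finally have "?c * \<bar>\<Sum>w\<in>?S. ?k w * F w\<bar> \<le> ?c * (((2 * r + 1)\<^sup>2 * (?x * b n)\<^sup>2) * (B * D))"
          using c by (intro mult_left_mono) auto
        also have "\<dots> = (2 * r + 1)\<^sup>2 * B * D / b n"
          using x by (simp add: field_simps eval_nat_numeral)
        finally show ?thesis unfolding abs_mult using c by simp
      qed
      have T1: "\<bar>?T1\<bar> \<le> A1 * e1 n"
      proof -
        have "\<bar>?T1\<bar> \<le> (2 * r + 1)\<^sup>2 * B * (Kv * (1 / ?x + (1 / ?x) powr \<gamma>)) / b n"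
          using S\<rho> v(1) by (intro bound v(2) n) auto
        also have "\<dots> = A1 * (1 / b n * (1 / ?x + (1 / ?x) powr \<gamma>))" by (simp add: A1_def)
        also have "\<dots> \<le> A1 * e1 n" using A by (intro mult_left_mono e1) auto
        finally show ?thesis .
      qed
      have T2: "\<bar>?T2\<bar> \<le> A2 * \<eta>"
      proof -
        have "\<bar>?T2\<bar> \<le> (2 * r + 1)\<^sup>2 * B * (\<eta> * (r * b n)) / b n"
        proof (rule bound)
          fix w assume w: "w \<in> ?S"
          then have "\<bar>g w - g t - g' t (w - t)\<bar> \<le> \<eta> * norm (w - t)" using elim(2) by (intro \<delta>(2) t\<rho>) auto
          also have "\<dots> \<le> \<eta> * (r * b n)" using w \<eta> by (intro mult_left_mono) auto
          finally show "\<bar>g w - g t - g' t (w - t)\<bar> \<le> \<eta> * (r * b n)" .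
        qed (use \<eta> rn x in auto)
        also have "\<dots> = A2 * \<eta>" using x by (simp add: A2_def)
        finally show ?thesis .
      qed
      \<comment> \<open>The constant \<open>g t\<close> appears with weight \<open>1 / b\<close>. As
        \<kappa> has integral 0, only the Riemann sum error is left, and even divided by
        \<open>b\<close> it tends to 0.\<close>
      have "\<bar>?Zs - 0\<bar> \<le> C0 / (?x * b n)"
        using RS0[OF x(1,2,4) fS _ order_refl] unfolding \<kappa>(7) by blast
      then have S0: "\<bar>?Zs / b n\<bar> \<le> C0 * z n"
      proof -
        assume a: "\<bar>?Zs - 0\<bar> \<le> C0 / (?x * b n)"
        have "\<bar>?Zs / b n\<bar> = \<bar>?Zs\<bar> / b n" using x by (simp add: abs_divide)
        also have "\<dots> \<le> (C0 / (?x * b n)) / b n" using a x by (intro divide_right_mono) auto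
        also have "\<dots> = C0 * (1 / (?x * (b n)\<^sup>2))" by (simp add: power2_eq_square)
        also have "\<dots> \<le> C0 * z n" using C0 by (intro mult_left_mono zb) auto
        finally show ?thesis .
      qed
      have Si: "\<bar>?Si i + u $ i\<bar> \<le> Ci i * z n" for i
      proof -
        have "\<bar>?Si i + u $ i\<bar> \<le> Ci i / (?x * b n)"
          using RSi[OF x(1,2,4) fS _ order_refl] by blast
        also have "\<dots> = Ci i * (1 / (?x * b n))" by simp
        also have "\<dots> \<le> Ci i * z n" by (intro mult_left_mono zb Ci)
        finally show ?thesis .
      qed
      \<comment> \<open>In the linear terms \<open>w - t\<close> contributes a factor
        \<open>b\<close>, which lowers the weight \<open>1 / (n^2 b^3)\<close> to the Riemann weight
        \<open>1 / (n b)^2\<close>.\<close>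
      have dec: "?c * (\<Sum>w\<in>?S. ?k w * v n w) = ?T1 + ?T2 + g t * (?Zs / b n)
          + g' t (axis 1 1) * ?Si 1 + g' t (axis 2 1) * ?Si 2"
      proof -
        have comp: "?c * (\<Sum>w\<in>?S. ?k w * (a * (w - t) $ i)) = a * ?Si i" for a i
        proof -
          have pw: "(w - t) $ i = b n * ((w - t) /\<^sub>R b n) $ i" for w using x by simp
          have "?k w * (a * (w - t) $ i) = a * b n * (?k w * ((w - t) /\<^sub>R b n) $ i)" for w
            by (subst pw) (simp only: mult_ac)
          then have "(\<Sum>w\<in>?S. ?k w * (a * (w - t) $ i)) = a * b n * (\<Sum>w\<in>?S. ?k w * ((w - t) /\<^sub>R b n) $ i)"
            by (simp only: sum_distrib_left)
          then show ?thesis using x by (simp add: field_simps eval_nat_numeral)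
        qed
        have k0': "?c * (\<Sum>w\<in>?S. ?k w * g t) = g t * (?Zs / b n)"
        proof -
          have "?c * (W * y) = y * (1 / (?x\<^sup>2 * (b n)\<^sup>2) * W / b n)" for W y :: real
            using x by (simp add: field_simps eval_nat_numeral)
          then show ?thesis unfolding sum_distrib_right[symmetric] .
        qed
        have pt: "?k w * v n w = ?k w * (v n w - g w) + ?k w * (g w - g t - g' t (w - t)) + ?k w * g t
           + ?k w * (g' t (axis 1 1) * (w - t) $ 1) + ?k w * (g' t (axis 2 1) * (w - t) $ 2)" for w
          unfolding g2[of t "w - t"] by (simp add: algebra_simps)
        have "?c * (\<Sum>w\<in>?S. ?k w * v n w) = ?T1 + ?T2 + ?c * (\<Sum>w\<in>?S. ?k w * g t)
           + ?c * (\<Sum>w\<in>?S. ?k w * (g' t (axis 1 1) * (w - t) $ 1)) + ?c * (\<Sum>w\<in>?S. ?k w * (g' t (axis 2 1) * (w - t) $ 2))"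
        proof -
          have "(\<Sum>w\<in>?S. ?k w * v n w) = (\<Sum>w\<in>?S. ?k w * (v n w - g w)) + (\<Sum>w\<in>?S. ?k w * (g w - g t - g' t (w - t)))
             + (\<Sum>w\<in>?S. ?k w * g t) + (\<Sum>w\<in>?S. ?k w * (g' t (axis 1 1) * (w - t) $ 1))
             + (\<Sum>w\<in>?S. ?k w * (g' t (axis 2 1) * (w - t) $ 2))"
            unfolding sum.distrib[symmetric] by (rule sum.cong[OF refl], rule pt)
          then show ?thesis by (simp only: distrib_left)
        qed
        then show ?thesis unfolding comp k0' .
      qed
      have "\<bar>g t * (?Zs / b n)\<bar> \<le> G0 * (C0 * z n)"
        unfolding abs_mult using G0(2)[OF t\<rho>(1)] S0 G0(1) by (intro mult_mono) auto
      moreover have "\<bar>g' t (axis 1 1) * (?Si 1 + u $ 1)\<bar> \<le> G1 * (Ci 1 * z n)"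
        unfolding abs_mult using G1(2)[OF t\<rho>(1)] Si[of 1] G1(1) by (intro mult_mono) auto
      moreover have "\<bar>g' t (axis 2 1) * (?Si 2 + u $ 2)\<bar> \<le> G2 * (Ci 2 * z n)"
        unfolding abs_mult using G2(2)[OF t\<rho>(1)] Si[of 2] G2(1) by (intro mult_mono) auto
      \<comment> \<open>The sums \<open>?Si i\<close> approximate \<open>- u $ i\<close>, so with
        the outer minus sign the linear terms produce \<open>g' t u\<close>; pairing each with
        \<open>u $ i\<close> displays the error.\<close>
      moreover have "- (?T1 + ?T2 + g t * (?Zs / b n) + g' t (axis 1 1) * ?Si 1 + g' t (axis 2 1) * ?Si 2) - g' t u
         = - (?T1 + ?T2 + g t * (?Zs / b n) + g' t (axis 1 1) * (?Si 1 + u $ 1) + g' t (axis 2 1) * (?Si 2 + u $ 2))"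
        unfolding g2[of t u] by (simp only: distrib_left) (simp add: mult.commute)
      moreover have "\<bar>- (a1 + a2 + a3 + a4 + a5)\<bar> \<le> B1 + B2 + B3 + B4 + B5"
        if "\<bar>a1\<bar> \<le> B1" "\<bar>a2\<bar> \<le> B2" "\<bar>a3\<bar> \<le> B3" "\<bar>a4\<bar> \<le> B4" "\<bar>a5\<bar> \<le> B5"
        for a1 a2 a3 a4 a5 B1 B2 B3 B4 B5 :: real using that by (smt (verit))
      ultimately have "\<bar>- (?T1 + ?T2 + g t * (?Zs / b n) + g' t (axis 1 1) * ?Si 1 + g' t (axis 2 1) * ?Si 2) - g' t u\<bar>
         \<le> A1 * e1 n + A2 * \<eta> + G0 * (C0 * z n) + G1 * (Ci 1 * z n) + G2 * (Ci 2 * z n)"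
        using T1 T2 by (simp only:)
      also have "\<dots> = s n + A2 * \<eta>" by (simp add: s_def algebra_simps)
      also have "\<dots> < e" using elim(1) \<eta>(2) by linarith
      finally show "dist (- ?c * (\<Sum>w\<in>grid \<Omega> n. ?k w * v n w)) (g' t u) < e"
        unfolding gS mult_minus_left dec dist_real_def .
    qed
  qed
qed

text \<open>A finite positive level \<open>e\<close> strictly below the target is inserted, because
  a pointwise strict bound becomes a weak one after the supremum.\<close>

lemma SUP_ennreal_tendsto_0:
  fixes F :: "nat \<Rightarrow> 'a::metric_space \<Rightarrow> real"
  assumes "uniform_limit \<Theta> F l sequentially"
  shows "(\<lambda>n. SUP t\<in>\<Theta>. ennreal \<bar>F n t - l t\<bar>) \<longlonglongrightarrow> 0"
proof (rule order_tendstoI)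
  fix a :: ennreal assume "0 < a"
  then obtain e where e: "0 < e" "e < a" using dense by blast
  define e' where "e' = enn2real e"
  have "e < \<top>" using e(2) by (rule less_le_trans) simp
  then have ee: "e = ennreal e'" "0 < e'"
    using e by (simp_all add: e'_def enn2real_positive_iff)
  have "\<forall>\<^sub>F n in sequentially. \<forall>t\<in>\<Theta>. dist (F n t) (l t) < e'"
    using assms ee(2) by (rule uniform_limitD)
  then show "\<forall>\<^sub>F n in sequentially. (SUP t\<in>\<Theta>. ennreal \<bar>F n t - l t\<bar>) < a"
  proof eventually_elim
    case (elim n)
    have "(SUP t\<in>\<Theta>. ennreal \<bar>F n t - l t\<bar>) \<le> e"
      unfolding ee(1) using elim by (intro SUP_least ennreal_leI) (auto simp: dist_real_def intro: less_imp_le)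
    then show ?case using e(2) by (rule le_less_trans)
  qed
qed simp

subsection \<open>Conclusion\<close>

text \<open>The condition forces \<open>n b^4\<close> to be eventually at least 1, and with
  \<open>b \<le> 1\<close> also \<open>n b \<ge> 1\<close>: the kernel window is eventually at least
  one grid step wide.\<close>

lemma bandwidth_conditions:
  fixes b :: "nat \<Rightarrow> real"
  assumes pos: "\<And>n. 1 \<le> n \<Longrightarrow> 0 < b n" and lim: "b \<longlonglongrightarrow> 0" and "0 < \<beta>"
    and O: "(\<lambda>n. 1 / (real n * b n ^ 4)) \<in> O(\<lambda>n. real n powr (- \<beta>))"
  obtains Cb N where "0 < Cb" "1 \<le> N"
    "\<And>n. n \<ge> N \<Longrightarrow> 0 < b n \<and> b n \<le> 1 \<and> 1 \<le> real n * b n"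
    "\<And>n. n \<ge> N \<Longrightarrow> 1 / (real n * b n ^ 4) \<le> Cb * real n powr (-\<beta>)"
proof -
  obtain Cb where Cb: "0 < Cb" "\<forall>\<^sub>F n in sequentially. norm (1 / (real n * b n ^ 4)) \<le> Cb * norm (real n powr (- \<beta>))"
    using landau_o.bigE[OF O] by blast
  have "(\<lambda>n. Cb * real n powr (-\<beta>)) \<longlonglongrightarrow> Cb * 0"
    using assms by (intro tendsto_intros tendsto_neg_powr filterlim_real_sequentially) auto
  then have "\<forall>\<^sub>F n in sequentially. Cb * real n powr (-\<beta>) < 1" by (intro order_tendstoD) auto
  moreover have "\<forall>\<^sub>F n in sequentially. b n < 1" using lim by (rule order_tendstoD) simp
  ultimately have "\<forall>\<^sub>F n in sequentially. (0 < b n \<and> b n \<le> 1 \<and> 1 \<le> real n * b n) \<and> 1 / (real n * b n ^ 4) \<le> Cb * real n powr (-\<beta>)"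
    using Cb(2) eventually_ge_at_top[of 1]
  proof eventually_elim
    case (elim n)
    have b: "0 < b n" "0 < real n" using pos elim by auto
    have c: "1 / (real n * b n ^ 4) \<le> Cb * real n powr (-\<beta>)" using elim(3) b by simp
    then have "1 / (real n * b n ^ 4) \<le> 1" using elim(1) by linarith
    then have "1 \<le> real n * b n ^ 4" using b by (simp add: divide_le_eq)
    also have "\<dots> \<le> real n * b n ^ 1" using b elim(2) by (intro mult_left_mono power_decreasing) auto
    finally show ?case using b c elim(2) by simp
  qed
  then obtain N0 where "\<And>n. n \<ge> N0 \<Longrightarrow> (0 < b n \<and> b n \<le> 1 \<and> 1 \<le> real n * b n) \<and> 1 / (real n * b n ^ 4) \<le> Cb * real n powr (-\<beta>)"
    unfolding eventually_sequentially by blast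
  then show thesis by (intro that[of Cb "max 1 N0"] Cb(1)) auto
qed

text \<open>The little-o term is used with constant 1. The filter at 0 omits the point 0 itself,
  where the bound is trivial because \<open>0 powr x = 0\<close>.\<close>

lemma covariance_expansion_bound:
  fixes R :: "real \<Rightarrow> real"
  assumes "(\<lambda>t::real. R \<bar>t\<bar> - (R 0 - \<bar>t\<bar> powr \<alpha>)) \<in> o[at 0](\<lambda>t. \<bar>t\<bar> powr (\<alpha> + \<gamma>))"
    and "0 < c" and R4: "\<forall>\<^sub>F t in at_right 0. \<bar>(deriv ^^ 4) R t\<bar> \<le> c * t powr (\<alpha> - 4)"
  obtains t0 where "0 < t0" "\<And>t. 0 \<le> t \<Longrightarrow> t \<le> t0 \<Longrightarrow> \<bar>R t - (R 0 - t powr \<alpha>)\<bar> \<le> t powr (\<alpha> + \<gamma>)"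
    "\<And>t. 0 < t \<Longrightarrow> t \<le> t0 \<Longrightarrow> \<bar>(deriv ^^ 4) R t\<bar> \<le> c * t powr (\<alpha> - 4)"
proof -
  have "\<forall>\<^sub>F t in at 0. norm (R \<bar>t\<bar> - (R 0 - \<bar>t\<bar> powr \<alpha>)) \<le> 1 * norm (\<bar>t\<bar> powr (\<alpha> + \<gamma>))"
    using landau_o.smallD[OF assms(1), of 1] by simp
  then obtain d1 where d1: "0 < d1" "\<And>t. t \<noteq> 0 \<Longrightarrow> dist t 0 < d1 \<Longrightarrow> norm (R \<bar>t\<bar> - (R 0 - \<bar>t\<bar> powr \<alpha>)) \<le> 1 * norm (\<bar>t\<bar> powr (\<alpha> + \<gamma>))"
    unfolding eventually_at by auto
  obtain d2 where d2: "0 < d2" "\<And>t. 0 < t \<Longrightarrow> t < d2 \<Longrightarrow> \<bar>(deriv ^^ 4) R t\<bar> \<le> c * t powr (\<alpha> - 4)"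
    using R4 unfolding eventually_at_right_field by auto
  show thesis
  proof (rule that[of "min d1 d2 / 2"])
    show "0 < min d1 d2 / 2" using d1 d2 by simp
    show "\<bar>R t - (R 0 - t powr \<alpha>)\<bar> \<le> t powr (\<alpha> + \<gamma>)" if "0 \<le> t" "t \<le> min d1 d2 / 2" for t
    proof (cases "t = 0")
      case False
      then show ?thesis using d1(1) d1(2)[of t] that by (simp add: dist_real_def)
    qed simp
    show "\<bar>(deriv ^^ 4) R t\<bar> \<le> c * t powr (\<alpha> - 4)" if "0 < t" "t \<le> min d1 d2 / 2" for t
      using that d2 by (intro d2(2)) auto
  qed
qed

theorem theorem2:
  fixes M :: "'w measure"
    and Z :: "real^2 \<Rightarrow> 'w \<Rightarrow> real"
    and R :: "real \<Rightarrow> real"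
    and \<mu> \<alpha> \<gamma> c\<^sub>0 \<beta> :: real
    and \<Omega> :: "(real^2) set"
    and f :: "real^2 \<Rightarrow> real^2"
    and h u :: "real^2"
    and K :: "real^2 \<Rightarrow> real"
    and b :: "nat \<Rightarrow> real"
  assumes "prob_space M"
    and "gaussian_field M Z"
    and "\<And>t. (\<integral>\<omega>. Z t \<omega> \<partial>M) = \<mu>"
    and "\<And>t s. covar M (Z t) (Z s) = R (norm (t - s))"
    and "0 < \<alpha>" and "\<alpha> < 2" and "0 < \<gamma>"
    and "(\<lambda>t::real. R \<bar>t\<bar> - (R 0 - \<bar>t\<bar> powr \<alpha>)) \<in> o[at 0](\<lambda>t. \<bar>t\<bar> powr (\<alpha> + \<gamma>))"
    and "Cr_on 4 {0<..} R"
    and "0 < c\<^sub>0"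
    and "\<forall>\<^sub>F t in at_right 0. \<bar>(deriv ^^ 4) R t\<bar> \<le> c\<^sub>0 * t powr (\<alpha> - 4)"
    and "bounded \<Omega>" and "open \<Omega>" and "connected \<Omega>" and "\<Omega> \<noteq> {}" and "simply_connected \<Omega>"
    and "Cr_diffeo 3 f"
    and "h \<noteq> 0" and "u \<noteq> 0"
    and "compact (closure {x. K x \<noteq> 0})"
    and "Cr_on 2 UNIV K"
    and "\<And>e. e \<in> Basis \<Longrightarrow> bounded (range (partial_deriv e K))"
    and "\<And>e e'. e \<in> Basis \<Longrightarrow> e' \<in> Basis \<Longrightarrow>
           bounded (range (partial_deriv e' (partial_deriv e K)))"
    and "has_bochner_integral lborel K 1"
    and "integrable lborel (\<lambda>x. norm x * K x)"
    and "\<And>n. 1 \<le> n \<Longrightarrow> 0 < b n"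
    and "b \<longlonglongrightarrow> 0"
    and "0 < \<beta>" and "1 - 4 * \<gamma> < \<beta>"
    and "(\<lambda>n. 1 / (real n * b n ^ 4)) \<in> O(\<lambda>n. real n powr (- \<beta>))"
  shows "\<forall>\<Theta>. compact \<Theta> \<and> \<Theta> \<subseteq> \<Omega> \<longrightarrow>
    (AE \<omega> in M.
      (\<lambda>n. SUP t\<in>\<Theta>. ennreal
         \<bar>dir_deriv u (B_est \<Omega> K \<alpha> h n (b n) ((\<lambda>s. Z s \<omega>) \<circ> f)) t
          - dir_deriv u
              (\<lambda>x. (8 - 2 powr (\<alpha> + 1)) * norm (jacobian f (at x) *v h) powr \<alpha>) t\<bar>)
      \<longlonglongrightarrow> 0)"
proof (intro allI impI)
  fix \<Theta> :: "(real^2) set" assume \<Theta>: "compact \<Theta> \<and> \<Theta> \<subseteq> \<Omega>"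
  interpret stationary_field M Z R \<mu> by (rule stationary_field.intro) (fact assms)+
  obtain \<rho> where \<rho>: "0 < \<rho>" "\<Omega> \<subseteq> cball 0 \<rho>"
    using \<open>bounded \<Omega>\<close> unfolding bounded_pos by (metis mem_cball_0 subsetI)
  obtain B0 m where dl: "diffeo_line f h \<rho> B0 m"
    by (rule diffeo_line_exists[OF \<open>Cr_diffeo 3 f\<close> \<open>h \<noteq> 0\<close> less_imp_le[OF \<rho>(1)]])
  obtain t0 where t0: "0 < t0" "\<And>t. 0 \<le> t \<Longrightarrow> t \<le> t0 \<Longrightarrow> \<bar>R t - (R 0 - t powr \<alpha>)\<bar> \<le> t powr (\<alpha> + \<gamma>)"
    "\<And>t. 0 < t \<Longrightarrow> t \<le> t0 \<Longrightarrow> \<bar>(deriv ^^ 4) R t\<bar> \<le> c\<^sub>0 * t powr (\<alpha> - 4)"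
    by (rule covariance_expansion_bound[OF assms(8,10,11)]) blast
  let ?g = "\<lambda>x. (8 - 2 powr (\<alpha> + 1)) * norm (dirD h f x) powr \<alpha>"
  let ?X = "nincr Z f \<alpha> h"
  let ?\<kappa> = "dirD u K"
  obtain C Kv N1 where C: "0 \<le> C" and Kv: "0 \<le> Kv" and N1: "1 \<le> N1"
    and var: "\<And>n w. n \<ge> N1 \<Longrightarrow> w \<in> cball 0 \<rho> \<Longrightarrow> \<bar>cv (?X n w) (?X n w) - ?g w\<bar> \<le> Kv * (1 / real n + (1 / real n) powr \<gamma>)"
    and cov: "\<And>n w w'. n \<ge> N1 \<Longrightarrow> w \<in> cball 0 \<rho> \<Longrightarrow> w' \<in> cball 0 \<rho> \<Longrightarrow>
      \<bar>cv (?X n w) (?X n w')\<bar> \<le> C * (1 + norm (w - w') / (1 / real n)) powr (-(3 - \<alpha>))"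
    by (rule cv_nincr_bounds[OF dl assms(5,6,7) t0(1) less_imp_le[OF \<open>0 < c\<^sub>0\<close>] t0(2,3) assms(9)];
        (assumption | (rule that, assumption+)))
  obtain r L B where \<kappa>: "0 < r" "0 < L" "0 < B" "\<And>x. r < norm x \<Longrightarrow> ?\<kappa> x = 0"
    "\<And>x y. \<bar>?\<kappa> x - ?\<kappa> y\<bar> \<le> L * norm (x - y)" "\<And>x. \<bar>?\<kappa> x\<bar> \<le> B"
    "(\<integral>x. ?\<kappa> x \<partial>lborel) = 0" "\<And>i. (\<integral>x. ?\<kappa> x * x $ i \<partial>lborel) = - u $ i"
    by (rule kernel_derivative[OF assms(20-24), of u]; (assumption | (rule that, assumption+)))
  obtain Cb N2 where Cb: "0 < Cb" "1 \<le> N2" "\<And>n. n \<ge> N2 \<Longrightarrow> 0 < b n \<and> b n \<le> 1 \<and> 1 \<le> real n * b n"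
    "\<And>n. n \<ge> N2 \<Longrightarrow> 1 / (real n * b n ^ 4) \<le> Cb * real n powr (-\<beta>)"
    by (rule bandwidth_conditions[OF assms(26,27,28,30)]; (assumption | (rule that, assumption+)))
  let ?N = "max N1 N2"
  have CrK: "Cr_on (Suc 1) UNIV K" using \<open>Cr_on 2 UNIV K\<close> by (simp add: numeral_2_eq_2)
  have Crf: "Cr_on (Suc (Suc 1)) UNIV f" using \<open>Cr_diffeo 3 f\<close> by (simp add: Cr_diffeo_def numeral_3_eq_3)
  \<comment> \<open>The decay exponent \<open>3 - \<alpha>\<close> exceeds 1 because
    \<open>\<alpha> < 2\<close>, which is the summability required by the locale.\<close>
  interpret L: gaussian_lattice M "lincombs Z \<mu>" ?X "grid \<Omega>" ?\<kappa> b \<rho> C "3 - \<alpha>" r L B \<beta> Cb ?N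
  proof unfold_locales
    show "grid \<Omega> n \<subseteq> {w \<in> lattice (1 / real n). norm w \<le> \<rho>}" for n
      using \<rho>(2) by (auto simp: grid_eq_lattice)
    show "?X n w \<in> lincombs Z \<mu>" if "?N \<le> n" for n w
      using that N1 by (intro nincr_mem) auto
    show "\<bar>cv (?X n w) (?X n w')\<bar> \<le> C * (1 + norm (w - w') / (1 / real n)) powr (-(3 - \<alpha>))"
      if "?N \<le> n" "w \<in> grid \<Omega> n" "w' \<in> grid \<Omega> n" for n w w'
      using that \<rho>(2) by (intro cov) (auto simp: grid_def)
  qed (use \<kappa> Cb C N1 \<rho> assms in auto)
  define g' where "g' x k = (8 - 2 powr (\<alpha> + 1)) * \<alpha> * norm (dirD h f x) powr (\<alpha> - 2) *
     (dirD h f x \<bullet> (\<Sum>e\<in>Basis. (h \<bullet> e) *\<^sub>R dirD k (partial_deriv e f) x))" for x k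
  \<comment> \<open>Both the differentiability of \<open>?g\<close> and the continuity of
    \<open>g'\<close>, which contains the power \<open>\<alpha> - 2\<close> of the norm, rest on
    this.\<close>
  have nz: "dirD h f x \<noteq> 0" for x
    using Cr_diffeo_dirD_nonzero[of 2 f h x] \<open>Cr_diffeo 3 f\<close> \<open>h \<noteq> 0\<close> by (simp add: numeral_3_eq_3 numeral_2_eq_2)
  have g: "(?g has_derivative g' x) (at x)" for x
    unfolding g'_def by (intro norm_powr_has_derivative[where c="8 - 2 powr (\<alpha> + 1)"] dirD_has_derivative[OF Crf] nz)
  have g'_cont: "continuous_on UNIV (\<lambda>x. g' x (axis i 1))" for i
    unfolding g'_def
  proof (intro continuous_intros continuous_on_dirD[OF Crf])
    show "continuous_on UNIV (dirD (axis i 1) (partial_deriv e f))" if "e \<in> Basis" for e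
      using Crf that by (intro continuous_on_dirD[of 1] Cr_on_partial)
  qed (use nz in auto)
  have dg: "dir_deriv u (\<lambda>x. (8 - 2 powr (\<alpha> + 1)) * norm (jacobian f (at x) *v h) powr \<alpha>) t = g' t u" for t
    unfolding jacobian_mult_eq_dirD[OF Crf] dir_deriv_eq_dirD by (rule dirD_eqI[OF g])
  have bias: "uniform_limit \<Theta> (\<lambda>n t. - (1 / ((real n)\<^sup>2 * b n ^ 3)) * (\<Sum>w\<in>grid \<Omega> n. ?\<kappa> ((w - t) /\<^sub>R b n) * cv (?X n w) (?X n w)))
     (\<lambda>t. g' t u) sequentially"
    by (rule bias_uniform_limit[OF \<kappa> g g'_cont _ _ \<open>open \<Omega>\<close> \<rho>(2) Kv _ _ \<open>b \<longlonglongrightarrow> 0\<close> _ _ Cb(1) \<open>0 < \<beta>\<close> \<open>1 - 4 * \<gamma> < \<beta>\<close>, where N="?N"])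
       (use \<Theta> var Cb N1 in auto)
  \<comment> \<open>Each square is its variance plus \<open>csq\<close>. The sign omitted from
    \<open>coef\<close> makes the fluctuation enter with a minus.\<close>
  have split: "dir_deriv u (B_est \<Omega> K \<alpha> h n (b n) ((\<lambda>s. Z s \<omega>) \<circ> f)) t =
     - (1 / ((real n)\<^sup>2 * b n ^ 3)) * (\<Sum>w\<in>grid \<Omega> n. ?\<kappa> ((w - t) /\<^sub>R b n) * cv (?X n w) (?X n w)) - L.fluct n t \<omega>"
    if n: "?N \<le> n" for n t \<omega>
  proof -
    have "1 \<le> n" "0 < b n" using n N1 Cb by auto
    have "L.fluct n t \<omega> = (1 / ((real n)\<^sup>2 * b n ^ 3)) * (\<Sum>w\<in>grid \<Omega> n. ?\<kappa> ((w - t) /\<^sub>R b n) * ((?X n w \<omega>)\<^sup>2 - cv (?X n w) (?X n w)))"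
      unfolding L.fluct_def L.coef_def csq_def by (simp only: sum_distrib_left mult.assoc)
    then show ?thesis
      unfolding dir_deriv_B_est[OF CrK \<open>0 < b n\<close>] nincr_square[OF \<open>1 \<le> n\<close>, symmetric]
      by (simp add: right_diff_distrib sum_subtractf)
  qed
  show "AE \<omega> in M. (\<lambda>n. SUP t\<in>\<Theta>. ennreal
         \<bar>dir_deriv u (B_est \<Omega> K \<alpha> h n (b n) ((\<lambda>s. Z s \<omega>) \<circ> f)) t
          - dir_deriv u (\<lambda>x. (8 - 2 powr (\<alpha> + 1)) * norm (jacobian f (at x) *v h) powr \<alpha>) t\<bar>) \<longlonglongrightarrow> 0"
    using L.AE_uniform_limit_fluct
  proof eventually_elim
    case (elim \<omega>)
    have "\<Theta> \<subseteq> cball 0 \<rho>" using \<Theta> \<rho>(2) by blast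
    from uniform_limit_on_subset[OF elim this] bias
    have "uniform_limit \<Theta> (\<lambda>n t. - (1 / ((real n)\<^sup>2 * b n ^ 3)) * (\<Sum>w\<in>grid \<Omega> n. ?\<kappa> ((w - t) /\<^sub>R b n) * cv (?X n w) (?X n w)) - L.fluct n t \<omega>)
        (\<lambda>t. g' t u - 0) sequentially"
      by (intro uniform_limit_minus)
    moreover have "\<forall>\<^sub>F n in sequentially. \<forall>t\<in>\<Theta>. dir_deriv u (B_est \<Omega> K \<alpha> h n (b n) ((\<lambda>s. Z s \<omega>) \<circ> f)) t =
       - (1 / ((real n)\<^sup>2 * b n ^ 3)) * (\<Sum>w\<in>grid \<Omega> n. ?\<kappa> ((w - t) /\<^sub>R b n) * cv (?X n w) (?X n w)) - L.fluct n t \<omega>"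
      using eventually_ge_at_top[of ?N] by eventually_elim (auto simp: split)
    then have "uniform_limit \<Theta> (\<lambda>n t. dir_deriv u (B_est \<Omega> K \<alpha> h n (b n) ((\<lambda>s. Z s \<omega>) \<circ> f)) t) (\<lambda>t. g' t u) sequentially \<longleftrightarrow>
       uniform_limit \<Theta> (\<lambda>n t. - (1 / ((real n)\<^sup>2 * b n ^ 3)) * (\<Sum>w\<in>grid \<Omega> n. ?\<kappa> ((w - t) /\<^sub>R b n) * cv (?X n w) (?X n w)) - L.fluct n t \<omega>)
        (\<lambda>t. g' t u - 0) sequentially"
      by (rule uniform_limit_cong) simp
    ultimately have "uniform_limit \<Theta> (\<lambda>n t. dir_deriv u (B_est \<Omega> K \<alpha> h n (b n) ((\<lambda>s. Z s \<omega>) \<circ> f)) t) (\<lambda>t. g' t u) sequentially"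
      by (simp only:)
    then show ?case unfolding dg by (rule SUP_ennreal_tendsto_0)
  qed
qed

end
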